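(* Let $M$ be a smooth manifold of dimension $n\geqslant 3$ with a regular Lagrange function $L$, let $H$ be the corresponding Hamilton function, and let $\mathbf Q$ be a smooth extended covector field on $M$ with components $Q_i=Q_i(x,p)$. Fix any symmetric extended connection $\Gamma$ in $M$. Then the Newtonian dynamical system $$\dot x^i=\frac1\Omega\frac{\partial H}{\partial p_i},\qquad \dot p_i=-\frac1\Omega\frac{\partial H}{\partial x^i}+Q_i$$ satisfies the additional normality condition if and only if the following two systems of equations (the additional normality equations) hold at all points $q=(p,\mathbf p)$ of $T^*M$ with $\mathbf p\neq 0$. First, for all $i,j$, $$\sum_{s=1}^n\sum_{r=1}^n A_{sr}\,P^s_i\,P^r_j=\sum_{s=1}^n\sum_{r=1}^n A_{rs}\,P^s_i\,P^r_j,$$ where $$A_{sr}=\frac{|\mathbf p|^2\,\nabla_rH}{\Omega^2}Q_s-\sum_{q=1}^n p_q\frac{\nabla_r\tilde\nabla^qH}{\Omega}Q_s-\nabla_rQ_s+\sum_{q=1}^n p_q\frac{\nabla_rH}{\Omega}\tilde\nabla^qQ_s+\frac{\nabla_rH}{\Omega}Q_s+\sum_{q=1}^n p_q\,Q_s\,\tilde\nabla^qQ_r .$$ Second, for all $r,s$, $$\sum_{k=1}^n\sum_{q=1}^n P^r_q\left(p^q\frac{Q_k}{\Omega}+\tilde\nabla^qQ_k\right)P^k_s=\sum_{k=1}^n\sum_{q=1}^n\left(p^q\frac{Q_k}{\Omega}+\tilde\nabla^qQ_k\right)\frac{P^k_q\,P^r_s}{n-1}.$$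
   Context: Lagrangian geometry. $L$ is a smooth function on $TM$; in local coordinates $L=L(x^1,\dots,x^n,v^1,\dots,v^n)$. The Legendre map $\lambda:TM\to T^*M$ is $p_i=\partial L/\partial v^i$. Put $\Omega=\sum_i v^i\,\partial L/\partial v^i$, and let $\mu:(x,v)\mapsto(x,u)$ with $u^i=v^i/\Omega$. $L$ is called regular if $\lambda$ is a diffeomorphism, $\Omega>0$ at all points of $TM$ with $\mathbf v\ne0$, and $\mu$ is a diffeomorphism of $TM$ minus the zero section onto itself. The Hamilton function is $H=h\circ\lambda^{-1}$ with $h=\sum_i v^i\,\partial L/\partial v^i-L$, a function of $(x^1,\dots,x^n,p_1,\dots,p_n)$. One has $v^i=\partial H/\partial p_i$ (inverse Legendre map), and $\Omega$ viewed as a function on $T^*M$ is $\Omega=\sum_i p_i\,\partial H/\partial p_i$. Put $$g^{ij}=\frac{\partial^2H}{\partial p_i\partial p_j},\quad p^q=\sum_k g^{qk}p_k,\quad |\mathbf p|^2=\sum_{q,k}g^{qk}p_qp_k,\quad P^r_s=\delta^r_s-\frac{v^r p_s}{\Omega},\ v^r=\frac{\partial H}{\partial p_r}.$$ Extended tensor fields. An extended tensor field of type $(r,s)$ assigns to each point $(p,\mathbf p)\in T^*M$ a tensor of type $(r,s)$ at $p\in M$; so its components are functions of $x^1,\dots,x^n,p_1,\dots,p_n$. An extended connection $\Gamma$ is given in each chart by smooth functions $\Gamma^k_{ij}(x,p)$ on $T^*M$ obeying the usual transformation law of affine connection components; it is symmetric if $\Gamma^k_{ij}=\Gamma^k_{ji}$.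 Covariant derivatives: $\tilde\nabla^q X^{\dots}_{\dots}=\partial X^{\dots}_{\dots}/\partial p_q$, and $$\nabla_qX^{i_1\dots i_r}_{j_1\dots j_s}=\frac{\partial X^{i_1\dots i_r}_{j_1\dots j_s}}{\partial x^q}+\sum_{a,b}p_a\Gamma^a_{qb}\frac{\partial X^{i_1\dots i_r}_{j_1\dots j_s}}{\partial p_b}+\sum_{k=1}^r\sum_{a}\Gamma^{i_k}_{qa}X^{i_1\dots a\dots i_r}_{j_1\dots j_s}-\sum_{k=1}^s\sum_b\Gamma^b_{qj_k}X^{i_1\dots i_r}_{j_1\dots b\dots j_s}.$$ Here $\tilde\nabla^qH$ is treated as an extended vector field when $\nabla_r$ is applied to it. Additional normality condition. For a smooth hypersurface $S\subset M$ with local coordinates $y^1,\dots,y^{n-1}$, parametrized as $x^s=x^s(y^1,\dots,y^{n-1})$, put $\tau^s_i=\partial x^s/\partial y^i$ and let $\mathbf n=\mathbf n(y)$ be a (locally defined) smooth nowhere zero normal covector field, i.e. $\sum_s n_s\tau^s_i=0$ for all $i$. Consider the Pfaff system for a scalar function $\nu=\nu(y^1,\dots,y^{n-1})$ on $S$: $$\frac{\partial\nu}{\partial y^i}=-\sum_{s=1}^n\frac{\nu^2}{\Omega}\frac{\partial n_s}{\partial y^i}\frac{\partial H}{\partial p_s}-\sum_{s=1}^n\nu\left(\frac1\Omega\frac{\partial H}{\partial x^s}-Q_s\right)\tau^s_i,\qquad i=1,\dots,n-1,$$ where $H,\Omega,Q_s$ and their derivatives are evaluated at $(x(y),\mathbf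 p=\nu\,\mathbf n(y))$. The Newtonian dynamical system satisfies the additional normality condition if for every hypersurface $S$ in $M$ and every point $p_0\in S$ this Pfaff system is compatible, meaning that for every $\nu_0\ne0$ it has a solution $\nu$ in some neighbourhood of $p_0$ in $S$ with $\nu(p_0)=\nu_0$. *)

theory Defs
  imports "HOL-Analysis.Analysis"
begin

section \<open>Smooth functions and smooth manifolds\<close>

text \<open>The following two notions are only used on open sets.\<close>

primrec Ck_on :: "nat \<Rightarrow> 'a::real_normed_vector set \<Rightarrow> ('a \<Rightarrow> 'b::real_normed_vector) \<Rightarrow> bool" where
  "Ck_on 0 S f \<longleftrightarrow> continuous_on S f"
| "Ck_on (Suc k) S f \<longleftrightarrow>
     (\<forall>x\<in>S. f differentiable (at x)) \<and> (\<forall>v. Ck_on k S (\<lambda>x. frechet_derivative f (at x) v))"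

definition smooth_on :: "'a::real_normed_vector set \<Rightarrow> ('a \<Rightarrow> 'b::real_normed_vector) \<Rightarrow> bool" where
  "smooth_on S f \<longleftrightarrow> (\<forall>k. Ck_on k S f)"

text \<open>A chart is a pair of its domain and its coordinate map; the values of the coordinate map
  outside the domain are irrelevant.\<close>

type_synonym ('p, 'e) chart = "'p set \<times> ('p \<Rightarrow> 'e)"

definition chart_dom :: "('p, 'e) chart \<Rightarrow> 'p set" where
  "chart_dom c = fst c"

definition chart_map :: "('p, 'e) chart \<Rightarrow> 'p \<Rightarrow> 'e" where
  "chart_map c = snd c"

definition chart_image :: "('p, 'e) chart \<Rightarrow> 'e set" where
  "chart_image c = chart_map c ` chart_dom c"

definition chart_inv :: "('p, 'e) chart \<Rightarrow> 'e \<Rightarrow> 'p" where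
  "chart_inv c = inv_into (chart_dom c) (chart_map c)"

definition transition :: "('p, 'e) chart \<Rightarrow> ('p, 'e) chart \<Rightarrow> 'e \<Rightarrow> 'e" where
  "transition c d = chart_map d \<circ> chart_inv c"

definition smooth_atlas ::
    "('m::topological_space, 'e::euclidean_space) chart set \<Rightarrow> bool" where
  "smooth_atlas A \<longleftrightarrow>
     (\<Union>c\<in>A. chart_dom c) = UNIV \<and>
     (\<forall>c\<in>A. open (chart_dom c) \<and> open (chart_image c) \<and>
        homeomorphism (chart_dom c) (chart_image c) (chart_map c) (chart_inv c)) \<and>
     (\<forall>c\<in>A. \<forall>d\<in>A. smooth_on (chart_map c ` (chart_dom c \<inter> chart_dom d)) (transition c d))"

text \<open>Smoothness of a map between (open subsets \<open>X\<close>, \<open>Y\<close> of) manifolds with atlases \<open>A\<close>, \<open>B\<close>.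
  The openness clause expresses continuity in the topologies defined by the atlases,
  so that none has to be fixed on the bundles below.\<close>

definition smooth_map ::
    "('p, 'e::real_normed_vector) chart set \<Rightarrow> 'p set \<Rightarrow>
     ('r, 'f::real_normed_vector) chart set \<Rightarrow> 'r set \<Rightarrow> ('p \<Rightarrow> 'r) \<Rightarrow> bool" where
  "smooth_map A X B Y f \<longleftrightarrow> f ` X \<subseteq> Y \<and>
     (\<forall>c\<in>A. \<forall>d\<in>B.
        let D = chart_map c ` {x \<in> X \<inter> chart_dom c. f x \<in> chart_dom d}
        in open D \<and> smooth_on D (chart_map d \<circ> f \<circ> chart_inv c))"

definition diffeomorphism ::
    "('p, 'e::real_normed_vector) chart set \<Rightarrow> 'p set \<Rightarrow>
     ('r, 'f::real_normed_vector) chart set \<Rightarrow> 'r set \<Rightarrow> ('p \<Rightarrow> 'r) \<Rightarrow> bool" where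
  "diffeomorphism A X B Y f \<longleftrightarrow>
     bij_betw f X Y \<and> smooth_map A X B Y f \<and> smooth_map B Y A X (inv_into X f)"

section \<open>Tangent and cotangent bundle\<close>

text \<open>\<open>jacobian c d q $ j $ i\<close> is the derivative of the \<open>j\<close>-th coordinate of the chart \<open>d\<close>
  with respect to the \<open>i\<close>-th coordinate of the chart \<open>c\<close> at the point \<open>q\<close>.\<close>

definition jacobian :: "('m, real^'n) chart \<Rightarrow> ('m, real^'n) chart \<Rightarrow> 'm \<Rightarrow> real^'n^'n" where
  "jacobian c d q = matrix (frechet_derivative (transition c d) (at (chart_map c q)))"

text \<open>A (co)vector at \<open>q\<close> is the family of its components in all charts around \<open>q\<close>, subject to
  the transformation law. The value \<open>0\<close> is prescribed for all other charts, so that distinct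
  functions are distinct (co)vectors.\<close>

type_synonym ('m, 'n) components = "('m, real^'n) chart \<Rightarrow> real^'n"

definition tangent_space :: "('m, real^'n) chart set \<Rightarrow> 'm \<Rightarrow> ('m, 'n) components set" where
  "tangent_space A q =
     {X. (\<forall>c. c \<notin> A \<or> q \<notin> chart_dom c \<longrightarrow> X c = 0) \<and>
         (\<forall>c\<in>A. \<forall>d\<in>A. q \<in> chart_dom c \<inter> chart_dom d \<longrightarrow>
            (\<forall>j. X d $ j = (\<Sum>i\<in>UNIV. jacobian c d q $ j $ i * X c $ i)))}"

definition cotangent_space :: "('m, real^'n) chart set \<Rightarrow> 'm \<Rightarrow> ('m, 'n) components set" where
  "cotangent_space A q =
     {w. (\<forall>c. c \<notin> A \<or> q \<notin> chart_dom c \<longrightarrow> w c = 0) \<and>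
         (\<forall>c\<in>A. \<forall>d\<in>A. q \<in> chart_dom c \<inter> chart_dom d \<longrightarrow>
            (\<forall>i. w c $ i = (\<Sum>j\<in>UNIV. jacobian c d q $ j $ i * w d $ j)))}"

definition tangent_bundle :: "('m, real^'n) chart set \<Rightarrow> ('m \<times> ('m, 'n) components) set" where
  "tangent_bundle A = (SIGMA q:UNIV. tangent_space A q)"

definition cotangent_bundle :: "('m, real^'n) chart set \<Rightarrow> ('m \<times> ('m, 'n) components) set" where
  "cotangent_bundle A = (SIGMA q:UNIV. cotangent_space A q)"

definition nonzero_tangent_bundle ::
    "('m, real^'n) chart set \<Rightarrow> ('m \<times> ('m, 'n) components) set" where
  "nonzero_tangent_bundle A = {z \<in> tangent_bundle A. snd z \<noteq> (\<lambda>c. 0)}"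

definition tangent_chart ::
    "('m, real^'n) chart set \<Rightarrow> ('m, real^'n) chart \<Rightarrow>
     ('m \<times> ('m, 'n) components, (real^'n) \<times> (real^'n)) chart" where
  "tangent_chart A c =
     ({z \<in> tangent_bundle A. fst z \<in> chart_dom c}, \<lambda>z. (chart_map c (fst z), snd z c))"

definition cotangent_chart ::
    "('m, real^'n) chart set \<Rightarrow> ('m, real^'n) chart \<Rightarrow>
     ('m \<times> ('m, 'n) components, (real^'n) \<times> (real^'n)) chart" where
  "cotangent_chart A c =
     ({z \<in> cotangent_bundle A. fst z \<in> chart_dom c}, \<lambda>z. (chart_map c (fst z), snd z c))"

text \<open>Partial derivatives with respect to the base coordinate \<open>x\<^sup>i\<close> and
  the fibre coordinate (\<open>v\<^sup>i\<close> or \<open>p\<^sub>i\<close>).\<close>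

definition d_base :: "'n \<Rightarrow> ((real^'n) \<times> (real^'n) \<Rightarrow> real) \<Rightarrow> (real^'n) \<times> (real^'n) \<Rightarrow> real" where
  "d_base i f z = frechet_derivative f (at z) (axis i 1, 0)"

definition d_fibre :: "'n \<Rightarrow> ((real^'n) \<times> (real^'n) \<Rightarrow> real) \<Rightarrow> (real^'n) \<times> (real^'n) \<Rightarrow> real" where
  "d_fibre i f z = frechet_derivative f (at z) (0, axis i 1)"

section \<open>Regular Lagrange functions\<close>

definition smooth_lagrangian ::
    "('m, real^'n) chart set \<Rightarrow> ('m \<times> ('m, 'n) components \<Rightarrow> real) \<Rightarrow> bool" where
  "smooth_lagrangian A L \<longleftrightarrow>
     (\<forall>c\<in>A. smooth_on (chart_image (tangent_chart A c)) (L \<circ> chart_inv (tangent_chart A c)))"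

definition legendre ::
    "('m, real^'n) chart set \<Rightarrow> ('m \<times> ('m, 'n) components \<Rightarrow> real) \<Rightarrow>
     'm \<times> ('m, 'n) components \<Rightarrow> 'm \<times> ('m, 'n) components" where
  "legendre A L z =
     (fst z, \<lambda>c. if c \<in> A \<and> fst z \<in> chart_dom c
        then \<chi> i. d_fibre i (L \<circ> chart_inv (tangent_chart A c)) (chart_map c (fst z), snd z c)
        else 0)"

text \<open>The contraction of a covector with a vector does not depend on the chart, hence any chart
  around the point may be chosen.\<close>

definition contraction ::
    "('m, real^'n) chart set \<Rightarrow> 'm \<Rightarrow> ('m, 'n) components \<Rightarrow> ('m, 'n) components \<Rightarrow> real" where
  "contraction A q w X =
     (let c = (SOME c. c \<in> A \<and> q \<in> chart_dom c) in \<Sum>i\<in>UNIV. X c $ i * w c $ i)"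

definition Omega_TM ::
    "('m, real^'n) chart set \<Rightarrow> ('m \<times> ('m, 'n) components \<Rightarrow> real) \<Rightarrow>
     'm \<times> ('m, 'n) components \<Rightarrow> real" where
  "Omega_TM A L z = contraction A (fst z) (snd (legendre A L z)) (snd z)"

definition mu_map ::
    "('m, real^'n) chart set \<Rightarrow> ('m \<times> ('m, 'n) components \<Rightarrow> real) \<Rightarrow>
     'm \<times> ('m, 'n) components \<Rightarrow> 'm \<times> ('m, 'n) components" where
  "mu_map A L z = (fst z, \<lambda>c. snd z c /\<^sub>R Omega_TM A L z)"

definition regular_lagrangian ::
    "('m, real^'n) chart set \<Rightarrow> ('m \<times> ('m, 'n) components \<Rightarrow> real) \<Rightarrow> bool" where
  "regular_lagrangian A L \<longleftrightarrow>
     diffeomorphism (tangent_chart A ` A) (tangent_bundle A)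
       (cotangent_chart A ` A) (cotangent_bundle A) (legendre A L) \<and>
     (\<forall>z\<in>nonzero_tangent_bundle A. Omega_TM A L z > 0) \<and>
     diffeomorphism (tangent_chart A ` A) (nonzero_tangent_bundle A)
       (tangent_chart A ` A) (nonzero_tangent_bundle A) (mu_map A L)"

definition legendre_inv ::
    "('m, real^'n) chart set \<Rightarrow> ('m \<times> ('m, 'n) components \<Rightarrow> real) \<Rightarrow>
     'm \<times> ('m, 'n) components \<Rightarrow> 'm \<times> ('m, 'n) components" where
  "legendre_inv A L = inv_into (tangent_bundle A) (legendre A L)"

definition hamiltonian ::
    "('m, real^'n) chart set \<Rightarrow> ('m \<times> ('m, 'n) components \<Rightarrow> real) \<Rightarrow>
     'm \<times> ('m, 'n) components \<Rightarrow> real" where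
  "hamiltonian A L = (\<lambda>z. Omega_TM A L z - L z) \<circ> legendre_inv A L"

definition Omega ::
    "('m, real^'n) chart set \<Rightarrow> ('m \<times> ('m, 'n) components \<Rightarrow> real) \<Rightarrow>
     'm \<times> ('m, 'n) components \<Rightarrow> real" where
  "Omega A L = Omega_TM A L \<circ> legendre_inv A L"

text \<open>The functions \<open>H\<close> and \<open>\<Omega>\<close> of the coordinates \<open>(x, p)\<close> of the chart of the
  cotangent bundle induced by \<open>c\<close>.\<close>

definition H_in ::
    "('m, real^'n) chart set \<Rightarrow> ('m \<times> ('m, 'n) components \<Rightarrow> real) \<Rightarrow> ('m, real^'n) chart \<Rightarrow>
     (real^'n) \<times> (real^'n) \<Rightarrow> real" where
  "H_in A L c = hamiltonian A L \<circ> chart_inv (cotangent_chart A c)"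

definition Omega_in ::
    "('m, real^'n) chart set \<Rightarrow> ('m \<times> ('m, 'n) components \<Rightarrow> real) \<Rightarrow> ('m, real^'n) chart \<Rightarrow>
     (real^'n) \<times> (real^'n) \<Rightarrow> real" where
  "Omega_in A L c = Omega A L \<circ> chart_inv (cotangent_chart A c)"

section \<open>Extended covector fields and extended connections\<close>

text \<open>\<open>Q_in A Q c i\<close> is the component \<open>Q\<^sub>i(x, p)\<close> in the chart \<open>c\<close>.\<close>

definition Q_in ::
    "('m, real^'n) chart set \<Rightarrow> ('m \<times> ('m, 'n) components \<Rightarrow> ('m, 'n) components) \<Rightarrow>
     ('m, real^'n) chart \<Rightarrow> 'n \<Rightarrow> (real^'n) \<times> (real^'n) \<Rightarrow> real" where
  "Q_in A Q c i z = Q (chart_inv (cotangent_chart A c) z) c $ i"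

definition smooth_extended_covector_field ::
    "('m, real^'n) chart set \<Rightarrow> ('m \<times> ('m, 'n) components \<Rightarrow> ('m, 'n) components) \<Rightarrow> bool" where
  "smooth_extended_covector_field A Q \<longleftrightarrow>
     (\<forall>z\<in>cotangent_bundle A. Q z \<in> cotangent_space A (fst z)) \<and>
     (\<forall>c\<in>A. \<forall>i. smooth_on (chart_image (cotangent_chart A c)) (Q_in A Q c i))"

text \<open>For an extended connection, \<open>G c k i j\<close> is the component \<open>\<Gamma>\<^sup>k\<^sub>i\<^sub>j(x, p)\<close>
  in the chart \<open>c\<close>.\<close>

type_synonym 'n connection_components = "'n \<Rightarrow> 'n \<Rightarrow> 'n \<Rightarrow> (real^'n) \<times> (real^'n) \<Rightarrow> real"

definition extended_connection ::
    "('m, real^'n) chart set \<Rightarrow> (('m, real^'n) chart \<Rightarrow> 'n connection_components) \<Rightarrow> bool" where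
  "extended_connection A G \<longleftrightarrow>
     (\<forall>c\<in>A. \<forall>k i j. smooth_on (chart_image (cotangent_chart A c)) (G c k i j)) \<and>
     (\<forall>c\<in>A. \<forall>d\<in>A. \<forall>(q, w)\<in>cotangent_bundle A. q \<in> chart_dom c \<inter> chart_dom d \<longrightarrow>
        (\<forall>k i j. G c k i j (chart_map c q, w c) =
           (\<Sum>a\<in>UNIV. \<Sum>b\<in>UNIV. \<Sum>e\<in>UNIV.
              jacobian d c q $ k $ a * jacobian c d q $ b $ i * jacobian c d q $ e $ j
                * G d a b e (chart_map d q, w d)) +
           (\<Sum>a\<in>UNIV. jacobian d c q $ k $ a *
              frechet_derivative
                (\<lambda>x. frechet_derivative (transition c d) (at x) (axis j 1) $ a)
                (at (chart_map c q)) (axis i 1))))"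

definition symmetric_connection ::
    "('m, real^'n) chart set \<Rightarrow> (('m, real^'n) chart \<Rightarrow> 'n connection_components) \<Rightarrow> bool" where
  "symmetric_connection A G \<longleftrightarrow>
     (\<forall>c\<in>A. \<forall>k i j. \<forall>z\<in>chart_image (cotangent_chart A c). G c k i j z = G c k j i z)"

text \<open>The components in one chart of an extended tensor field of type \<open>(r, s)\<close> are represented
  by \<open>X is js z\<close>, with upper indices \<open>is\<close> and lower indices \<open>js\<close> given as lists of lengths
  \<open>r\<close> and \<open>s\<close>.\<close>

type_synonym 'n tensor_components =
  "'n list \<Rightarrow> 'n list \<Rightarrow> (real^'n) \<times> (real^'n) \<Rightarrow> real"

definition nabla ::
    "'n connection_components \<Rightarrow> 'n::finite \<Rightarrow> 'n tensor_components \<Rightarrow> 'n tensor_components" where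
  "nabla G q X is js z =
     d_base q (X is js) z
     + (\<Sum>a\<in>UNIV. \<Sum>b\<in>UNIV. snd z $ a * G a q b z * d_fibre b (X is js) z)
     + (\<Sum>k<length is. \<Sum>a\<in>UNIV. G (is ! k) q a z * X (is[k := a]) js z)
     - (\<Sum>k<length js. \<Sum>b\<in>UNIV. G b q (js ! k) z * X is (js[k := b]) z)"

text \<open>The derivative \<open>\<nabla>\<^sub>q\<close> of a scalar, a vector and a covector field.\<close>

definition nabla_scalar ::
    "'n connection_components \<Rightarrow> 'n::finite \<Rightarrow> ((real^'n) \<times> (real^'n) \<Rightarrow> real) \<Rightarrow>
     (real^'n) \<times> (real^'n) \<Rightarrow> real" where
  "nabla_scalar G q f = nabla G q (\<lambda>is js. f) [] []"

definition nabla_vector ::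
    "'n connection_components \<Rightarrow> 'n::finite \<Rightarrow> ('n \<Rightarrow> (real^'n) \<times> (real^'n) \<Rightarrow> real) \<Rightarrow>
     'n \<Rightarrow> (real^'n) \<times> (real^'n) \<Rightarrow> real" where
  "nabla_vector G q V i = nabla G q (\<lambda>is js. V (hd is)) [i] []"

definition nabla_covector ::
    "'n connection_components \<Rightarrow> 'n::finite \<Rightarrow> ('n \<Rightarrow> (real^'n) \<times> (real^'n) \<Rightarrow> real) \<Rightarrow>
     'n \<Rightarrow> (real^'n) \<times> (real^'n) \<Rightarrow> real" where
  "nabla_covector G q U j = nabla G q (\<lambda>is js. U (hd js)) [] [j]"

section \<open>The additional normality equations\<close>

text \<open>In this section \<open>H\<close>, \<open>W\<close>, \<open>Q\<close>, \<open>G\<close> stand for the Hamilton function, \<open>\<Omega>\<close>, the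
  covector field and the connection in the coordinates \<open>z = (x, p)\<close> of one chart. The derivative
  \<open>\<nabla>\<close> with upper index and tilde is \<^const>\<open>d_fibre\<close>.\<close>

definition g_up :: "((real^'n) \<times> (real^'n) \<Rightarrow> real) \<Rightarrow> 'n \<Rightarrow> 'n \<Rightarrow> (real^'n) \<times> (real^'n) \<Rightarrow> real" where
  "g_up H i j z = d_fibre i (d_fibre j H) z"

definition p_up :: "((real^'n) \<times> (real^'n) \<Rightarrow> real) \<Rightarrow> 'n \<Rightarrow> (real^'n) \<times> (real^'n) \<Rightarrow> real" where
  "p_up H q z = (\<Sum>k\<in>UNIV. g_up H q k z * snd z $ k)"

definition p_norm2 :: "((real^'n) \<times> (real^'n) \<Rightarrow> real) \<Rightarrow> (real^'n) \<times> (real^'n) \<Rightarrow> real" where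
  "p_norm2 H z = (\<Sum>q\<in>UNIV. \<Sum>k\<in>UNIV. g_up H q k z * snd z $ q * snd z $ k)"

definition P_proj ::
    "((real^'n) \<times> (real^'n) \<Rightarrow> real) \<Rightarrow> ((real^'n) \<times> (real^'n) \<Rightarrow> real) \<Rightarrow>
     'n \<Rightarrow> 'n \<Rightarrow> (real^'n) \<times> (real^'n) \<Rightarrow> real" where
  "P_proj H W r s z = (if r = s then 1 else 0) - d_fibre r H z * snd z $ s / W z"

definition A_coeff ::
    "'n connection_components \<Rightarrow> ((real^'n) \<times> (real^'n) \<Rightarrow> real) \<Rightarrow>
     ((real^'n) \<times> (real^'n) \<Rightarrow> real) \<Rightarrow> ('n::finite \<Rightarrow> (real^'n) \<times> (real^'n) \<Rightarrow> real) \<Rightarrow>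
     'n \<Rightarrow> 'n \<Rightarrow> (real^'n) \<times> (real^'n) \<Rightarrow> real" where
  "A_coeff G H W Q s r z =
     p_norm2 H z * nabla_scalar G r H z / (W z)\<^sup>2 * Q s z
     - (\<Sum>q\<in>UNIV. snd z $ q * (nabla_vector G r (\<lambda>i. d_fibre i H) q z / W z) * Q s z)
     - nabla_covector G r Q s z
     + (\<Sum>q\<in>UNIV. snd z $ q * (nabla_scalar G r H z / W z) * d_fibre q (Q s) z)
     + nabla_scalar G r H z / W z * Q s z
     + (\<Sum>q\<in>UNIV. snd z $ q * Q s z * d_fibre q (Q r) z)"

definition first_normality_equations ::
    "'n connection_components \<Rightarrow> ((real^'n) \<times> (real^'n) \<Rightarrow> real) \<Rightarrow>
     ((real^'n) \<times> (real^'n) \<Rightarrow> real) \<Rightarrow> ('n::finite \<Rightarrow> (real^'n) \<times> (real^'n) \<Rightarrow> real) \<Rightarrow>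
     (real^'n) \<times> (real^'n) \<Rightarrow> bool" where
  "first_normality_equations G H W Q z \<longleftrightarrow>
     (\<forall>i j.
       (\<Sum>s\<in>UNIV. \<Sum>r\<in>UNIV. A_coeff G H W Q s r z * P_proj H W s i z * P_proj H W r j z) =
       (\<Sum>s\<in>UNIV. \<Sum>r\<in>UNIV. A_coeff G H W Q r s z * P_proj H W s i z * P_proj H W r j z))"

definition second_normality_equations ::
    "((real^'n) \<times> (real^'n) \<Rightarrow> real) \<Rightarrow>
     ((real^'n) \<times> (real^'n) \<Rightarrow> real) \<Rightarrow> ('n::finite \<Rightarrow> (real^'n) \<times> (real^'n) \<Rightarrow> real) \<Rightarrow>
     (real^'n) \<times> (real^'n) \<Rightarrow> bool" where
  "second_normality_equations H W Q z \<longleftrightarrow>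
     (\<forall>r s.
       (\<Sum>k\<in>UNIV. \<Sum>q\<in>UNIV.
          P_proj H W r q z * (p_up H q z * (Q k z / W z) + d_fibre q (Q k) z) * P_proj H W k s z) =
       (\<Sum>k\<in>UNIV. \<Sum>q\<in>UNIV.
          (p_up H q z * (Q k z / W z) + d_fibre q (Q k) z)
            * (P_proj H W k q z * P_proj H W r s z / (real CARD('n) - 1))))"

definition additional_normality_equations ::
    "('m, real^'n) chart set \<Rightarrow> ('m \<times> ('m, 'n) components \<Rightarrow> real) \<Rightarrow>
     ('m \<times> ('m, 'n) components \<Rightarrow> ('m, 'n) components) \<Rightarrow>
     (('m, real^'n) chart \<Rightarrow> 'n connection_components) \<Rightarrow> bool" where
  "additional_normality_equations A L Q G \<longleftrightarrow>
     (\<forall>(q, w)\<in>cotangent_bundle A. w \<noteq> (\<lambda>c. 0) \<longrightarrow>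
        (\<forall>c\<in>A. q \<in> chart_dom c \<longrightarrow>
           first_normality_equations (G c) (H_in A L c) (Omega_in A L c) (Q_in A Q c)
             (chart_map c q, w c) \<and>
           second_normality_equations (H_in A L c) (Omega_in A L c) (Q_in A Q c)
             (chart_map c q, w c)))"

section \<open>The additional normality condition\<close>

text \<open>Local coordinates \<open>y\<close> on a hypersurface \<open>S\<close>, inside the domain of the chart \<open>c\<close> of the
  manifold: \<open>x\<close> is a smooth embedding of the open set \<open>U\<close>, written in the coordinates of \<open>c\<close>,
  whose image is an open piece of \<open>S\<close>.\<close>

definition local_parametrization ::
    "('m::topological_space, real^'n) chart \<Rightarrow> 'm set \<Rightarrow> (real^'k) set \<Rightarrow>
     (real^'k \<Rightarrow> real^'n) \<Rightarrow> bool" where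
  "local_parametrization c S U x \<longleftrightarrow>
     open U \<and> smooth_on U x \<and> (\<forall>y\<in>U. inj (frechet_derivative x (at y))) \<and>
     (\<exists>V g. open V \<and> V \<subseteq> chart_dom c \<and> homeomorphism U (chart_map c ` (S \<inter> V)) x g)"

text \<open>The dimension of a hypersurface is passed as a type \<open>'k\<close>, to be used with
  \<open>CARD('k) + 1 = CARD('n)\<close>.\<close>

definition hypersurface ::
    "'k::finite itself \<Rightarrow> ('m::topological_space, real^'n) chart set \<Rightarrow> 'm set \<Rightarrow> bool" where
  "hypersurface K A S \<longleftrightarrow>
     (\<forall>q\<in>S. \<exists>c\<in>A. \<exists>U (x :: real^'k \<Rightarrow> real^'n).
        q \<in> chart_dom c \<and> local_parametrization c S U x \<and> chart_map c q \<in> x ` U)"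

definition d_coord :: "'k \<Rightarrow> (real^'k \<Rightarrow> 'b::real_normed_vector) \<Rightarrow> real^'k \<Rightarrow> 'b" where
  "d_coord i f y = frechet_derivative f (at y) (axis i 1)"

definition pfaff_equation ::
    "((real^'n) \<times> (real^'n) \<Rightarrow> real) \<Rightarrow> ((real^'n) \<times> (real^'n) \<Rightarrow> real) \<Rightarrow>
     ('n \<Rightarrow> (real^'n) \<times> (real^'n) \<Rightarrow> real) \<Rightarrow> (real^'k \<Rightarrow> real^'n) \<Rightarrow> (real^'k \<Rightarrow> real^'n) \<Rightarrow>
     (real^'k \<Rightarrow> real) \<Rightarrow> 'k \<Rightarrow> real^'k \<Rightarrow> bool" where
  "pfaff_equation H W Q x n \<nu> i y \<longleftrightarrow>
     (let z = (x y, \<nu> y *\<^sub>R n y) in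
      d_coord i \<nu> y =
        - (\<Sum>s\<in>UNIV. (\<nu> y)\<^sup>2 / W z * (d_coord i n y $ s) * d_fibre s H z)
        - (\<Sum>s\<in>UNIV. \<nu> y * (1 / W z * d_base s H z - Q s z) * (d_coord i x y $ s)))"

text \<open>This is a property of the Newtonian dynamical system with
  \<open>dx\<^sup>i/dt = (\<partial>H/\<partial>p\<^sub>i)/\<Omega>\<close> and \<open>dp\<^sub>i/dt = - (\<partial>H/\<partial>x\<^sup>i)/\<Omega> + Q\<^sub>i\<close>, which is given
  by \<open>L\<close> (through \<open>H\<close> and \<open>\<Omega>\<close>) and \<open>Q\<close>. The Pfaff equations are meaningless where
  \<open>\<nu> = 0\<close>, since \<open>\<Omega>\<close> vanishes for zero momentum; a solution is therefore a smooth function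
  without zeros.\<close>

definition additional_normality_condition ::
    "'k::finite itself \<Rightarrow> ('m::topological_space, real^'n) chart set \<Rightarrow>
     ('m \<times> ('m, 'n) components \<Rightarrow> real) \<Rightarrow>
     ('m \<times> ('m, 'n) components \<Rightarrow> ('m, 'n) components) \<Rightarrow> bool" where
  "additional_normality_condition K A L Q \<longleftrightarrow>
     (\<forall>S. hypersurface K A S \<longrightarrow> (\<forall>q\<^sub>0\<in>S.
        \<forall>c\<in>A. \<forall>U (x :: real^'k \<Rightarrow> real^'n) (n :: real^'k \<Rightarrow> real^'n). \<forall>y\<^sub>0\<in>U. \<forall>\<nu>\<^sub>0.
          q\<^sub>0 \<in> chart_dom c \<and> local_parametrization c S U x \<and> x y\<^sub>0 = chart_map c q\<^sub>0 \<and>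
          smooth_on U n \<and>
          (\<forall>y\<in>U. n y \<noteq> 0 \<and> (\<forall>i. (\<Sum>s\<in>UNIV. n y $ s * d_coord i x y $ s) = 0)) \<and>
          \<nu>\<^sub>0 \<noteq> 0 \<longrightarrow>
          (\<exists>V \<nu>. open V \<and> y\<^sub>0 \<in> V \<and> V \<subseteq> U \<and> smooth_on V \<nu> \<and> (\<forall>y\<in>V. \<nu> y \<noteq> 0) \<and>
             \<nu> y\<^sub>0 = \<nu>\<^sub>0 \<and>
             (\<forall>y\<in>V. \<forall>i. pfaff_equation (H_in A L c) (Omega_in A L c) (Q_in A Q c) x n \<nu> i y))))"

end

theory Submission imports Defs begin

text \<open>
  Multiplying the Pfaff equations by \<open>\<Omega>/\<nu>\<close> turns them into \<open>d(H(x(y), \<nu> n)) = \<Omega> Q\<^sub>s dx\<^sup>s\<close>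
  on the hypersurface. Since \<open>ddH = 0\<close>, the Frobenius integrability condition is that the
  derivative along \<open>\<partial>\<^sub>j\<close> of \<open>\<Omega> Q\<^sub>s \<tau>\<^sup>s\<^sub>i\<close> be symmetric in \<open>i\<close>, \<open>j\<close>. It involves the
  hypersurface only through its tangent space, the annihilator of \<open>p\<close>, and, linearly, through its
  second fundamental form, which is an arbitrary symmetric form. The part without the second
  fundamental form gives the first system of normality equations. The other part says that an
  endomorphism of the tangent space is self-adjoint with respect to every symmetric form, hence
  a multiple of the identity; this is the second system. The connection enters the first system
  only through \<open>(P B u)\<^sup>r p\<^sub>a \<Gamma>\<^sup>a\<^sub>r\<^sub>b w\<^sup>b\<close>, where \<open>B\<^sup>q\<^sub>k = p\<^sup>q Q\<^sub>k/\<Omega> + \<partial>Q\<^sub>k/\<partial>p\<^sub>q\<close>,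
  and this is symmetric in the tangent vectors \<open>u\<close>, \<open>w\<close> by the second system.
\<close>

section \<open>Smooth functions\<close>

text \<open>Along a solution let \<pi> be the derivative of the momentum in a tangent direction. On
  tangent vectors \<pi> is, up to sign, the second fundamental form contracted with the momentum; on
  \<open>v = \<partial>H/\<partial>p\<close> the Pfaff equations prescribe its value. As p \<bullet>
  v = \<Omega> does not vanish, \<open>v\<close> is transversal to the hypersurface, so these two
  data determine \<pi>, and \<open>P\<close> is the projector onto the tangent space along
  \<open>v\<close>. This is how \<open>P\<close> enters the equations, and n - 1 is its trace, which
  fixes the scalar in the second system. Rank one forms c \<otimes> c already test self-adjointness;
  paraboloids through an arbitrary point with an arbitrary conormal realise them. In the other
  direction solutions come from a Frobenius theorem: the unknown is built by integration along the
  rays from the base point, and compatibility controls the remaining directions. The integrability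
  condition at a point needs the Pfaff equations at that point only, so it can be evaluated on
  affine functions before any solution is known.\<close>

lemma Ck_on_cong:
  assumes "open S" and "\<And>x. x \<in> S \<Longrightarrow> f x = g x" and "Ck_on k S f"
  shows "Ck_on k S g"
  using assms(2,3)
proof (induction k arbitrary: f g)
  case 0
  then show ?case by (simp cong: continuous_on_cong)
next
  case (Suc k)
  have "(g has_derivative frechet_derivative f (at x)) (at x)" if "x \<in> S" for x
    using Suc.prems assms(1) that
    by (metis (no_types, lifting) Ck_on.simps(2) frechet_derivative_works has_derivative_transform_within_open)
  then have "g differentiable (at x)" "frechet_derivative f (at x) = frechet_derivative g (at x)" if "x \<in> S" for x
    using that frechet_derivative_at differentiable_def by blast+
  then show ?case
    using Suc.IH[of "\<lambda>x. frechet_derivative f (at x) v" "\<lambda>x. frechet_derivative g (at x) v" for v] Suc.prems by simp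
qed

lemma Ck_onI:
  assumes "open S" and "\<And>x. x \<in> S \<Longrightarrow> (f has_derivative f' x) (at x)"
    and "\<And>v. Ck_on k S (\<lambda>x. f' x v)"
  shows "Ck_on (Suc k) S f"
proof -
  have "f' x = frechet_derivative f (at x)" if "x \<in> S" for x
    using assms(2)[OF that] by (rule frechet_derivative_at)
  then have "Ck_on k S (\<lambda>x. frechet_derivative f (at x) v)" for v
    by (intro Ck_on_cong[OF assms(1) _ assms(3)[of v]]) simp
  then show ?thesis
    using assms(2) by (auto simp: differentiable_def)
qed

lemma Ck_on_SucD: "Ck_on (Suc k) S f \<Longrightarrow> Ck_on k S f"
proof (induction k arbitrary: f)
  case 0
  then show ?case
    by (auto intro!: continuous_at_imp_continuous_on differentiable_imp_continuous_within)
next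
  case (Suc k)
  then have "Ck_on k S (\<lambda>x. frechet_derivative f (at x) v)" for v
    using Suc.IH[of "\<lambda>x. frechet_derivative f (at x) v"] by (subst (asm) Ck_on.simps(2)) blast
  then show ?case using Suc.prems by simp
qed

lemma Ck_on_subset: "Ck_on k S f \<Longrightarrow> T \<subseteq> S \<Longrightarrow> Ck_on k T f"
  by (induction k arbitrary: f) (auto intro: continuous_on_subset)

lemma Ck_on_has_derivative:
  "Ck_on (Suc k) S f \<Longrightarrow> x \<in> S \<Longrightarrow> (f has_derivative frechet_derivative f (at x)) (at x)"
  by (simp add: frechet_derivative_works)

lemma Ck_on_const: "Ck_on k S (\<lambda>x. c)"
  by (induction k arbitrary: c) auto

section \<open>Closure properties of k times continuously differentiable functions\<close>

lemma Ck_on_linear_comp: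
  assumes "open S" "bounded_linear h" "Ck_on k S f"
  shows "Ck_on k S (\<lambda>x. h (f x))"
  using assms(3)
proof (induction k arbitrary: f)
  case 0
  then show ?case using assms(2) by (simp add: bounded_linear.continuous_on)
next
  case (Suc k)
  show ?case
    by (rule Ck_onI[OF assms(1) bounded_linear.has_derivative[OF assms(2) Ck_on_has_derivative[OF Suc.prems]]])
      (use Suc in auto)
qed

lemma Ck_on_linear: "bounded_linear h \<Longrightarrow> Ck_on k S h"
proof (cases k)
  case (Suc j)
  assume h: "bounded_linear h"
  have "frechet_derivative h (at x) = h" for x
    using h bounded_linear_imp_has_derivative frechet_derivative_at by metis
  then show ?thesis
    using h Suc by (auto simp: Ck_on_const bounded_linear_imp_differentiable)
qed (simp add: linear_continuous_on)

lemma Ck_on_add: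
  assumes "open S" "Ck_on k S f" "Ck_on k S g"
  shows "Ck_on k S (\<lambda>x. f x + g x)"
  using assms(2,3)
proof (induction k arbitrary: f g)
  case 0
  then show ?case by (simp add: continuous_on_add)
next
  case (Suc k)
  show ?case
    by (rule Ck_onI[OF assms(1) has_derivative_add[OF Ck_on_has_derivative[OF Suc.prems(1)] Ck_on_has_derivative[OF Suc.prems(2)]]])
      (use Suc in auto)
qed

text \<open>Covers products, scalar multiples and inner products at once. Both factors are
  generalised in the induction, because the product rule replaces either of them by its
  derivative.\<close>

lemma Ck_on_bilinear:
  assumes "open S" "bounded_bilinear B" "Ck_on k S f" "Ck_on k S g"
  shows "Ck_on k S (\<lambda>x. B (f x) (g x))"
  using assms(3,4)
proof (induction k arbitrary: f g)
  case 0
  then show ?case using bounded_bilinear.continuous_on[OF assms(2)] by auto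
next
  case (Suc k)
  show ?case
  proof (rule Ck_onI[OF assms(1) bounded_bilinear.FDERIV[OF assms(2) Ck_on_has_derivative[OF Suc.prems(1)] Ck_on_has_derivative[OF Suc.prems(2)]]])
    fix v
    show "Ck_on k S (\<lambda>x. B (f x) (frechet_derivative g (at x) v) + B (frechet_derivative f (at x) v) (g x))"
      by (intro Ck_on_add assms(1) Suc.IH Ck_on_SucD[OF Suc.prems(1)] Ck_on_SucD[OF Suc.prems(2)])
        (use Suc.prems in simp_all)
  qed
qed

lemma Ck_on_sum:
  assumes "open S" "\<And>i. i \<in> I \<Longrightarrow> Ck_on k S (f i)"
  shows "Ck_on k S (\<lambda>x. \<Sum>i\<in>I. f i x)"
  using assms(2) by (induction I rule: infinite_finite_induct) (auto intro: Ck_on_const Ck_on_add[OF assms(1)])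

text \<open>The chain rule evaluates the derivative of \<open>g\<close> in a direction that varies
  with \<open>x\<close>, while \<open>Ck_on\<close> speaks about fixed directions only. Expanding
  the direction in an orthonormal basis leaves a sum of products to which the induction hypothesis
  applies; hence the Euclidean domain of \<open>g\<close>.\<close>

lemma Ck_on_compose:
  fixes g :: "'b::euclidean_space \<Rightarrow> 'c::real_normed_vector"
  assumes "open S" "open T" "f ` S \<subseteq> T" "Ck_on k T g" "Ck_on k S f"
  shows "Ck_on k S (\<lambda>x. g (f x))"
  using assms(4,5)
proof (induction k arbitrary: g)
  case 0
  then show ?case using assms(3) by (metis Ck_on.simps(1) continuous_on_compose2)
next
  case (Suc k)
  let ?f = "\<lambda>x. frechet_derivative f (at x)" and ?g = "\<lambda>y. frechet_derivative g (at y)"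
  have g: "(g has_derivative ?g (f x)) (at (f x))" if "x \<in> S" for x
    using Ck_on_has_derivative[OF Suc.prems(1)] assms(3) that by blast
  show ?case
  proof (rule Ck_onI[OF assms(1)])
    fix x assume x: "x \<in> S"
    have "((\<lambda>x. g (f x)) has_derivative (\<lambda>v. ?g (f x) (?f x v))) (at x)"
      using has_derivative_compose[OF Ck_on_has_derivative[OF Suc.prems(2) x] g[OF x]] by simp
    moreover have "?g (f x) (?f x v) = (\<Sum>b\<in>Basis. (?f x v \<bullet> b) *\<^sub>R ?g (f x) b)" for v
      using linear_sum[OF has_derivative_linear[OF g[OF x]], of "\<lambda>b. (?f x v \<bullet> b) *\<^sub>R b" Basis]
        linear_cmul[OF has_derivative_linear[OF g[OF x]]]
      by (simp add: euclidean_representation)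
    ultimately show "((\<lambda>x. g (f x)) has_derivative (\<lambda>v. \<Sum>b\<in>Basis. (?f x v \<bullet> b) *\<^sub>R ?g (f x) b)) (at x)"
      by simp
  next
    fix v
    show "Ck_on k S (\<lambda>x. \<Sum>b\<in>Basis. (?f x v \<bullet> b) *\<^sub>R ?g (f x) b)"
    proof (intro Ck_on_sum Ck_on_bilinear[OF _ bounded_bilinear_scaleR] assms(1))
      fix b
      show "Ck_on k S (\<lambda>x. ?f x v \<bullet> b)"
        using Suc.prems by (intro Ck_on_linear_comp[OF assms(1) bounded_linear_inner_left]) simp
      show "Ck_on k S (\<lambda>x. ?g (f x) b)"
        using Suc.prems Ck_on_SucD[OF Suc.prems(2)] by (intro Suc.IH) auto
    qed
  qed
qed

text \<open>The derivative of 1/f is a polynomial in 1/f and the derivative of \<open>f\<close>, so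
  the induction closes.\<close>

lemma Ck_on_inverse:
  fixes f :: "'a::real_normed_vector \<Rightarrow> real"
  assumes "open S" "\<And>x. x \<in> S \<Longrightarrow> f x \<noteq> 0" "Ck_on k S f"
  shows "Ck_on k S (\<lambda>x. inverse (f x))"
  using assms(3)
proof (induction k)
  case 0
  then show ?case using assms(2) by (auto intro: continuous_on_inverse)
next
  case (Suc k)
  show ?case
  proof (rule Ck_onI[OF assms(1)])
    fix x assume "x \<in> S"
    then show "((\<lambda>x. inverse (f x)) has_derivative (\<lambda>h. - (inverse (f x) * frechet_derivative f (at x) h * inverse (f x)))) (at x)"
      using assms(2) Ck_on_has_derivative[OF Suc.prems] by (auto intro: has_derivative_inverse)
  next
    fix v
    show "Ck_on k S (\<lambda>x. - (inverse (f x) * frechet_derivative f (at x) v * inverse (f x)))"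
      by (intro Ck_on_linear_comp[OF assms(1) bounded_linear_minus[OF bounded_linear_ident]]
          Ck_on_bilinear[OF assms(1) bounded_bilinear_mult] Suc.IH Ck_on_SucD[OF Suc.prems])
        (use Suc.prems in simp)
  qed
qed

section \<open>The same calculus for smooth functions\<close>

lemma smooth_on_cong: "open S \<Longrightarrow> (\<And>x. x \<in> S \<Longrightarrow> f x = g x) \<Longrightarrow> smooth_on S f \<Longrightarrow> smooth_on S g"
  by (auto simp: smooth_on_def intro: Ck_on_cong[of S f])

lemma smooth_on_subset: "smooth_on S f \<Longrightarrow> T \<subseteq> S \<Longrightarrow> smooth_on T f"
  by (auto simp: smooth_on_def intro: Ck_on_subset)

lemma smooth_on_const: "smooth_on S (\<lambda>x. c)"
  by (auto simp: smooth_on_def intro: Ck_on_const)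

lemma smooth_on_linear_comp: "open S \<Longrightarrow> bounded_linear h \<Longrightarrow> smooth_on S f \<Longrightarrow> smooth_on S (\<lambda>x. h (f x))"
  by (auto simp: smooth_on_def intro: Ck_on_linear_comp)

lemma smooth_on_linear: "bounded_linear h \<Longrightarrow> smooth_on S h"
  by (auto simp: smooth_on_def intro: Ck_on_linear)

lemma smooth_on_add: "open S \<Longrightarrow> smooth_on S f \<Longrightarrow> smooth_on S g \<Longrightarrow> smooth_on S (\<lambda>x. f x + g x)"
  by (auto simp: smooth_on_def intro: Ck_on_add)

lemma smooth_on_minus: "open S \<Longrightarrow> smooth_on S f \<Longrightarrow> smooth_on S (\<lambda>x. - f x)"
  by (rule smooth_on_linear_comp[OF _ bounded_linear_minus[OF bounded_linear_ident]])

lemma smooth_on_diff: "open S \<Longrightarrow> smooth_on S f \<Longrightarrow> smooth_on S g \<Longrightarrow> smooth_on S (\<lambda>x. f x - g x)"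
  using smooth_on_add[of S f "\<lambda>x. - g x"] smooth_on_minus[of S g] by simp

lemma smooth_on_bilinear:
  "open S \<Longrightarrow> bounded_bilinear B \<Longrightarrow> smooth_on S f \<Longrightarrow> smooth_on S g \<Longrightarrow> smooth_on S (\<lambda>x. B (f x) (g x))"
  by (auto simp: smooth_on_def intro: Ck_on_bilinear)

lemmas smooth_on_scaleR = smooth_on_bilinear[OF _ bounded_bilinear_scaleR]
lemmas smooth_on_inner = smooth_on_bilinear[OF _ bounded_bilinear_inner]
lemmas smooth_on_mult = smooth_on_bilinear[OF _ bounded_bilinear_mult]

lemma smooth_on_sum: "open S \<Longrightarrow> (\<And>i. i \<in> I \<Longrightarrow> smooth_on S (f i)) \<Longrightarrow> smooth_on S (\<lambda>x. \<Sum>i\<in>I. f i x)"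
  by (auto simp: smooth_on_def intro: Ck_on_sum)

lemma smooth_on_inverse:
  fixes f :: "'a::real_normed_vector \<Rightarrow> real"
  shows "open S \<Longrightarrow> (\<And>x. x \<in> S \<Longrightarrow> f x \<noteq> 0) \<Longrightarrow> smooth_on S f \<Longrightarrow> smooth_on S (\<lambda>x. inverse (f x))"
  by (auto simp: smooth_on_def intro: Ck_on_inverse)

lemma smooth_on_divide:
  fixes f :: "'a::real_normed_vector \<Rightarrow> real"
  shows "open S \<Longrightarrow> (\<And>x. x \<in> S \<Longrightarrow> g x \<noteq> 0) \<Longrightarrow> smooth_on S f \<Longrightarrow> smooth_on S g \<Longrightarrow> smooth_on S (\<lambda>x. f x / g x)"
  unfolding divide_inverse by (intro smooth_on_mult smooth_on_inverse)

lemma smooth_on_compose: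
  fixes g :: "'b::euclidean_space \<Rightarrow> 'c::real_normed_vector"
  shows "open S \<Longrightarrow> open T \<Longrightarrow> f ` S \<subseteq> T \<Longrightarrow> smooth_on T g \<Longrightarrow> smooth_on S f \<Longrightarrow> smooth_on S (\<lambda>x. g (f x))"
  unfolding smooth_on_def using Ck_on_compose[of S T f _ g] by blast

lemma smooth_on_has_derivative:
  "smooth_on S f \<Longrightarrow> x \<in> S \<Longrightarrow> (f has_derivative frechet_derivative f (at x)) (at x)"
  by (auto simp: smooth_on_def intro: Ck_on_has_derivative)

lemma smooth_on_frechet: "smooth_on S f \<Longrightarrow> smooth_on S (\<lambda>x. frechet_derivative f (at x) v)"
  unfolding smooth_on_def using Ck_on.simps(2)[of _ S f] by metis

lemma smooth_on_continuous_on: "smooth_on S f \<Longrightarrow> continuous_on S f"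
  by (auto simp: smooth_on_def dest: spec[of _ 0])

lemma smooth_on_Pair:
  assumes "open S" "smooth_on S f" "smooth_on S g"
  shows "smooth_on S (\<lambda>x. (f x, g x))"
proof -
  have "bounded_linear (\<lambda>a::'b. (a, 0::'c))" "bounded_linear (\<lambda>b::'c. (0::'b, b))"
    by (auto intro!: bounded_linear_intros)
  then have "smooth_on S (\<lambda>x. (f x, 0) + (0, g x))"
    by (rule smooth_on_add[OF assms(1) smooth_on_linear_comp[OF assms(1) _ assms(2)] smooth_on_linear_comp[OF assms(1) _ assms(3)]])
  then show ?thesis by simp
qed

lemma smooth_on_fst: "open S \<Longrightarrow> smooth_on S f \<Longrightarrow> smooth_on S (\<lambda>x. fst (f x))"
  by (rule smooth_on_linear_comp[OF _ bounded_linear_fst])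

lemma smooth_on_snd: "open S \<Longrightarrow> smooth_on S f \<Longrightarrow> smooth_on S (\<lambda>x. snd (f x))"
  by (rule smooth_on_linear_comp[OF _ bounded_linear_snd])

lemma smooth_on_vec_nth: "open S \<Longrightarrow> smooth_on S f \<Longrightarrow> smooth_on S (\<lambda>x. f x $ i)"
  by (rule smooth_on_linear_comp[OF _ bounded_linear_vec_nth])

lemma smooth_on_vec_lambda:
  fixes f :: "'n::finite \<Rightarrow> 'a::real_normed_vector \<Rightarrow> real"
  assumes "open S" "\<And>i. smooth_on S (f i)"
  shows "smooth_on S (\<lambda>x. \<chi> i. f i x)"
proof -
  have "smooth_on S (\<lambda>x. \<Sum>i\<in>UNIV. f i x *\<^sub>R (axis i 1 :: real^'n))"
    by (rule smooth_on_sum[OF assms(1) smooth_on_scaleR[OF assms smooth_on_const]])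
  moreover have "(\<Sum>i\<in>UNIV. f i x *\<^sub>R (axis i 1 :: real^'n)) = (\<chi> i. f i x)" for x
    by (simp add: vec_eq_iff axis_def if_distrib[of "\<lambda>x. _ * x"] cong: if_cong)
  ultimately show ?thesis by simp
qed

lemma smooth_on_ident: "smooth_on S (\<lambda>x. x)"
  by (rule smooth_on_linear[OF bounded_linear_ident])

text \<open>The second difference of \<open>f\<close> over the parallelogram with sides r u and r v
  does not depend on the order of the sides. Either order expresses it as r * r times a mixed second
  derivative at a nearby point, and continuity of the second derivatives lets the points tend to
  \<open>x\<close>.\<close>

lemma frechet_derivative_symmetric_real:
  fixes f :: "'a::real_normed_vector \<Rightarrow> real"
  assumes "open S" "smooth_on S f" "x \<in> S"
  shows "frechet_derivative (\<lambda>x. frechet_derivative f (at x) u) (at x) v =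
         frechet_derivative (\<lambda>x. frechet_derivative f (at x) v) (at x) u"
proof -
  let ?D = "\<lambda>a x. frechet_derivative f (at x) a"
  let ?DD = "\<lambda>a b x. frechet_derivative (?D a) (at x) b"
  \<comment> \<open>The mean value theorem is used twice: for the increment in direction
    \<open>b\<close> as a function of the \<open>a\<close>-parameter, and then along
    \<open>b\<close> for the first derivative.\<close>
  have key: "\<exists>s t. 0 < s \<and> s < r \<and> 0 < t \<and> t < r \<and>
      f (x + r *\<^sub>R a + r *\<^sub>R b) - f (x + r *\<^sub>R a) - f (x + r *\<^sub>R b) + f x = r * r * ?DD a b (x + s *\<^sub>R a + t *\<^sub>R b)"
    if r: "0 < r" and sub: "\<And>s t. 0 \<le> s \<Longrightarrow> s \<le> r \<Longrightarrow> 0 \<le> t \<Longrightarrow> t \<le> r \<Longrightarrow> x + s *\<^sub>R a + t *\<^sub>R b \<in> S" for a b r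
  proof -
    let ?g = "\<lambda>s. f (x + s *\<^sub>R a + r *\<^sub>R b) - f (x + s *\<^sub>R a)"
    have d1: "((\<lambda>s. f (x + s *\<^sub>R a + t *\<^sub>R b)) has_derivative (\<lambda>h. ?D a (x + s *\<^sub>R a + t *\<^sub>R b) * h)) (at s)"
      if "0 \<le> s" "s \<le> r" "0 \<le> t" "t \<le> r" for s t
    proof -
      have D: "(f has_derivative (\<lambda>v. ?D v (x + s *\<^sub>R a + t *\<^sub>R b))) (at (x + s *\<^sub>R a + t *\<^sub>R b))"
        using smooth_on_has_derivative[OF assms(2) sub] that by auto
      have "((\<lambda>s. x + s *\<^sub>R a + t *\<^sub>R b) has_derivative (\<lambda>h. h *\<^sub>R a)) (at s)"
        by (auto intro!: derivative_eq_intros)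
      from has_derivative_compose[OF this D] show ?thesis
        using linear_cmul[OF has_derivative_linear[OF D]] by (simp add: mult.commute)
    qed
    have "\<exists>s>0. s < r \<and> ?g r - ?g 0 = (r - 0) * (?D a (x + s *\<^sub>R a + r *\<^sub>R b) - ?D a (x + s *\<^sub>R a))"
      using r
    proof (intro MVT2)
      fix s assume s: "0 \<le> s" "s \<le> r"
      show "(?g has_real_derivative ?D a (x + s *\<^sub>R a + r *\<^sub>R b) - ?D a (x + s *\<^sub>R a)) (at s)"
        using has_derivative_diff[OF d1[of s r] d1[of s 0]] s r
        by (simp add: has_field_derivative_def left_diff_distrib[symmetric])
    qed
    then obtain s where s: "0 < s" "s < r"
      "?g r - ?g 0 = r * (?D a (x + s *\<^sub>R a + r *\<^sub>R b) - ?D a (x + s *\<^sub>R a))" by auto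
    have "\<exists>t>0. t < r \<and> ?D a (x + s *\<^sub>R a + r *\<^sub>R b) - ?D a (x + s *\<^sub>R a + 0 *\<^sub>R b) = (r - 0) * ?DD a b (x + s *\<^sub>R a + t *\<^sub>R b)"
      using r
    proof (intro MVT2)
      fix t assume t: "0 \<le> t" "t \<le> r"
      have D: "(?D a has_derivative (\<lambda>v. ?DD a v (x + s *\<^sub>R a + t *\<^sub>R b))) (at (x + s *\<^sub>R a + t *\<^sub>R b))"
        using smooth_on_has_derivative[OF smooth_on_frechet[OF assms(2)] sub] s t by auto
      have "((\<lambda>t. x + s *\<^sub>R a + t *\<^sub>R b) has_derivative (\<lambda>h. h *\<^sub>R b)) (at t)"
        by (auto intro!: derivative_eq_intros)
      from has_derivative_compose[OF this D]
      show "((\<lambda>t. ?D a (x + s *\<^sub>R a + t *\<^sub>R b)) has_real_derivative ?DD a b (x + s *\<^sub>R a + t *\<^sub>R b)) (at t)"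
        using linear_cmul[OF has_derivative_linear[OF D]]
        by (simp add: has_field_derivative_def mult.commute[of _ "?DD a b _"])
    qed
    then obtain t where t: "0 < t" "t < r"
      "?D a (x + s *\<^sub>R a + r *\<^sub>R b) - ?D a (x + s *\<^sub>R a) = r * ?DD a b (x + s *\<^sub>R a + t *\<^sub>R b)" by auto
    then show ?thesis using s by (intro exI[of _ s] exI[of _ t]) (auto simp: algebra_simps)
  qed
  obtain \<epsilon> where \<epsilon>: "0 < \<epsilon>" "ball x \<epsilon> \<subseteq> S" using assms openE by blast
  have close: "\<bar>?DD u v x - ?DD v u x\<bar> \<le> e" if e: "0 < e" for e
  proof -
    have cont: "continuous_on S (?DD a b)" for a b
      by (intro smooth_on_continuous_on smooth_on_frechet assms)
    have ev: "\<exists>d>0. \<forall>y. dist y x < d \<longrightarrow> \<bar>?DD a b y - ?DD a b x\<bar> < e / 2" for a b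
    proof -
      have "isCont (?DD a b) x" using cont assms(1,3) continuous_on_eq_continuous_at by blast
      then show ?thesis using e unfolding continuous_at_eps_delta
        by (auto simp: dist_real_def dest!: spec[of _ "e / 2"])
    qed
    obtain d1 where d1: "d1 > 0" "\<And>y. dist y x < d1 \<Longrightarrow> \<bar>?DD u v y - ?DD u v x\<bar> < e / 2" using ev by blast
    obtain d2 where d2: "d2 > 0" "\<And>y. dist y x < d2 \<Longrightarrow> \<bar>?DD v u y - ?DD v u x\<bar> < e / 2" using ev by blast
    define d where "d = min \<epsilon> (min d1 d2)"
    \<comment> \<open>So small that the whole parallelogram stays within distance \<open>d\<close>
      of \<open>x\<close>; the summand 1 keeps the denominator positive when \<open>u\<close> and
      \<open>v\<close> vanish.\<close>
    define r where "r = d / (2 * (1 + norm u + norm v))"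
    have pos: "0 < 1 + norm u + norm v" by (smt (verit) norm_ge_zero)
    have d: "d > 0" using d1 d2 \<epsilon> by (simp add: d_def)
    have r: "0 < r" using d pos by (simp add: r_def)
    have r2: "r * (1 + norm u + norm v) = d / 2" using pos by (simp add: r_def field_simps)
    have near: "dist (x + s *\<^sub>R a + t *\<^sub>R b) x < d"
      if "0 \<le> s" "s \<le> r" "0 \<le> t" "t \<le> r" "norm a + norm b = norm u + norm v" for s t a b
    proof -
      have "dist (x + s *\<^sub>R a + t *\<^sub>R b) x = norm (s *\<^sub>R a + t *\<^sub>R b)" by (simp add: dist_norm algebra_simps)
      also have "\<dots> \<le> s * norm a + t * norm b" using that norm_triangle_ineq[of "s *\<^sub>R a" "t *\<^sub>R b"] by simp
      also have "\<dots> \<le> r * norm a + r * norm b" using that by (intro add_mono mult_right_mono) auto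
      also have "\<dots> = r * (norm u + norm v)" using that by (simp flip: distrib_left)
      also have "\<dots> < d" using r2 r d by (simp add: algebra_simps)
      finally show ?thesis .
    qed
    have sub: "x + s *\<^sub>R a + t *\<^sub>R b \<in> S"
      if "0 \<le> s" "s \<le> r" "0 \<le> t" "t \<le> r" "norm a + norm b = norm u + norm v" for s t a b
      using near[OF that] \<epsilon>(2) by (auto simp: d_def dist_commute intro!: subsetD[OF \<epsilon>(2)])
    obtain s t where st: "0 < s" "s < r" "0 < t" "t < r"
      "f (x + r *\<^sub>R u + r *\<^sub>R v) - f (x + r *\<^sub>R u) - f (x + r *\<^sub>R v) + f x = r * r * ?DD u v (x + s *\<^sub>R u + t *\<^sub>R v)"
      using key[OF r sub[of _ _ u v]] by blast
    obtain s' t' where st': "0 < s'" "s' < r" "0 < t'" "t' < r"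
      "f (x + r *\<^sub>R v + r *\<^sub>R u) - f (x + r *\<^sub>R v) - f (x + r *\<^sub>R u) + f x = r * r * ?DD v u (x + s' *\<^sub>R v + t' *\<^sub>R u)"
      using key[OF r sub[of _ _ v u]] by (auto simp: add.commute[of "norm v"])
    have "x + r *\<^sub>R v + r *\<^sub>R u = x + r *\<^sub>R u + r *\<^sub>R v" by (simp add: algebra_simps)
    then have "r * r * ?DD u v (x + s *\<^sub>R u + t *\<^sub>R v) = r * r * ?DD v u (x + s' *\<^sub>R v + t' *\<^sub>R u)"
      using st(5) st'(5) by (smt (verit))
    then have "?DD u v (x + s *\<^sub>R u + t *\<^sub>R v) = ?DD v u (x + s' *\<^sub>R v + t' *\<^sub>R u)" using r by simp
    moreover have "\<bar>?DD u v (x + s *\<^sub>R u + t *\<^sub>R v) - ?DD u v x\<bar> < e / 2"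
      using near[of s t u v] st by (intro d1) (auto simp: d_def)
    moreover have "\<bar>?DD v u (x + s' *\<^sub>R v + t' *\<^sub>R u) - ?DD v u x\<bar> < e / 2"
      using near[of s' t' v u] st' by (intro d2) (auto simp: d_def)
    ultimately show ?thesis by linarith
  qed
  have "\<bar>?DD u v x - ?DD v u x\<bar> \<le> 0"
    using field_le_epsilon[of "\<bar>?DD u v x - ?DD v u x\<bar>" 0] close by simp
  then show ?thesis by simp
qed

section \<open>The Frobenius theorem for one unknown function\<close>

text \<open>Smoothness provides continuity of the derivative separately in each direction. A bound
  in each basis direction on the compact set adds up to a bound of the operator; the summand 1 makes
  the constant strictly positive.\<close>

lemma compact_derivative_bound:
  fixes f :: "'a::euclidean_space \<Rightarrow> 'b::real_normed_vector"
  assumes f: "smooth_on S f" and X: "compact X" "X \<subseteq> S"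
  shows "\<exists>L>0. \<forall>x\<in>X. \<forall>d. norm (frechet_derivative f (at x) d) \<le> L * norm d"
proof -
  have "\<exists>B. \<forall>x\<in>X. norm (frechet_derivative f (at x) b) \<le> B" for b
  proof -
    have "compact ((\<lambda>x. frechet_derivative f (at x) b) ` X)"
      using smooth_on_continuous_on[OF smooth_on_frechet[OF f]] X continuous_on_subset
      by (intro compact_continuous_image) blast+
    then show ?thesis using compact_imp_bounded bounded_iff by (metis (no_types, lifting) image_eqI)
  qed
  then obtain B where B: "\<And>b x. x \<in> X \<Longrightarrow> norm (frechet_derivative f (at x) b) \<le> B b" by metis
  show ?thesis
  proof (intro exI[of _ "1 + (\<Sum>b\<in>Basis. \<bar>B b\<bar>)"] conjI ballI allI)
    show "0 < 1 + (\<Sum>b\<in>Basis. \<bar>B b\<bar>)" by (smt (verit) sum_nonneg abs_ge_zero)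
    fix x d assume x: "x \<in> X"
    have D: "linear (frechet_derivative f (at x))"
      using smooth_on_has_derivative[OF f] x X(2) has_derivative_linear by blast
    have "frechet_derivative f (at x) d = frechet_derivative f (at x) (\<Sum>b\<in>Basis. (d \<bullet> b) *\<^sub>R b)"
      by (simp add: euclidean_representation)
    also have "\<dots> = (\<Sum>b\<in>Basis. (d \<bullet> b) *\<^sub>R frechet_derivative f (at x) b)"
      by (simp add: linear_sum[OF D] linear_cmul[OF D])
    also have "norm \<dots> \<le> (\<Sum>b\<in>Basis. norm d * \<bar>B b\<bar>)"
    proof (rule sum_norm_le)
      fix b :: 'a assume "b \<in> Basis"
      then have "\<bar>d \<bullet> b\<bar> \<le> norm d" by (rule Basis_le_norm)
      moreover have "norm (frechet_derivative f (at x) b) \<le> \<bar>B b\<bar>" using B[OF x, of b] by linarith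
      ultimately show "norm ((d \<bullet> b) *\<^sub>R frechet_derivative f (at x) b) \<le> norm d * \<bar>B b\<bar>"
        by (simp add: mult_mono)
    qed
    also have "\<dots> \<le> (1 + (\<Sum>b\<in>Basis. \<bar>B b\<bar>)) * norm d"
      by (simp add: sum_distrib_left[symmetric] algebra_simps)
    finally show "norm (frechet_derivative f (at x) d) \<le> (1 + (\<Sum>b\<in>Basis. \<bar>B b\<bar>)) * norm d" .
  qed
qed

lemma convex_lipschitz:
  fixes f :: "'a::euclidean_space \<Rightarrow> 'b::real_normed_vector"
  assumes f: "smooth_on S f" and X: "convex X" "X \<subseteq> S"
    and L: "\<And>x d. x \<in> X \<Longrightarrow> norm (frechet_derivative f (at x) d) \<le> L * norm d"
    and xy: "x \<in> X" "y \<in> X"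
  shows "norm (f x - f y) \<le> L * norm (x - y)"
proof (rule differentiable_bound[OF X(1) _ _ xy])
  show "onorm (frechet_derivative f (at x)) \<le> L" if "x \<in> X" for x
    by (rule onorm_le) (rule L[OF that])
  show "(f has_derivative frechet_derivative f (at x)) (at x within X)" if "x \<in> X" for x
    using smooth_on_has_derivative[OF f] that X(2) has_derivative_at_withinI by blast
qed

text \<open>On the compact convex set the derivative is Lipschitz in every basis direction, hence as
  an operator, and the mean value estimate for \<open>f\<close> minus its linearisation on the
  segment gives the quadratic remainder.\<close>

lemma compact_taylor_bound:
  fixes f :: "'a::euclidean_space \<Rightarrow> 'b::real_normed_vector"
  assumes f: "smooth_on S f" and X: "compact X" "convex X" "X \<subseteq> S"
  shows "\<exists>L>0. \<forall>x\<in>X. \<forall>y\<in>X. norm (f y - f x - frechet_derivative f (at x) (y - x)) \<le> L * (norm (y - x))\<^sup>2"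
proof -
  let ?D = "\<lambda>x. frechet_derivative f (at x)"
  have "\<exists>L>0. \<forall>x\<in>X. \<forall>y\<in>X. norm (?D x b - ?D y b) \<le> L * norm (x - y)" for b
    using compact_derivative_bound[OF smooth_on_frechet[OF f] X(1,3)] convex_lipschitz[OF smooth_on_frechet[OF f] X(2,3)]
    by meson
  then obtain L where L: "\<And>b. L b > 0" "\<And>b x y. x \<in> X \<Longrightarrow> y \<in> X \<Longrightarrow> norm (?D x b - ?D y b) \<le> L b * norm (x - y)"
    by metis
  define M where "M = (\<Sum>b\<in>Basis. L b)"
  have M: "M > 0" unfolding M_def using L(1) by (intro sum_pos) auto
  have lin: "linear (?D x)" if "x \<in> X" for x
    using smooth_on_has_derivative[OF f] that X(3) has_derivative_linear by blast
  have DL: "norm (?D x d - ?D y d) \<le> M * norm (x - y) * norm d" if xy: "x \<in> X" "y \<in> X" for x y d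
  proof -
    have "?D z d = (\<Sum>b\<in>Basis. (d \<bullet> b) *\<^sub>R ?D z b)" if "z \<in> X" for z
    proof -
      have "?D z d = ?D z (\<Sum>b\<in>Basis. (d \<bullet> b) *\<^sub>R b)" by (simp add: euclidean_representation)
      then show ?thesis by (simp add: linear_sum[OF lin[OF that]] linear_cmul[OF lin[OF that]])
    qed
    then have "?D x d - ?D y d = (\<Sum>b\<in>Basis. (d \<bullet> b) *\<^sub>R (?D x b - ?D y b))"
      using xy by (simp add: sum_subtractf scaleR_diff_right)
    also have "norm \<dots> \<le> (\<Sum>b\<in>Basis. norm d * (L b * norm (x - y)))"
    proof (rule sum_norm_le)
      fix b :: 'a assume "b \<in> Basis"
      then have "\<bar>d \<bullet> b\<bar> \<le> norm d" by (rule Basis_le_norm)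
      then show "norm ((d \<bullet> b) *\<^sub>R (?D x b - ?D y b)) \<le> norm d * (L b * norm (x - y))"
        using L(2)[OF xy, of b] by (simp add: mult_mono)
    qed
    also have "\<dots> = M * norm (x - y) * norm d"
      by (simp add: M_def sum_distrib_left[symmetric] sum_distrib_right[symmetric] mult_ac)
    finally show ?thesis .
  qed
  have "norm (f y - f x - ?D x (y - x)) \<le> M * (norm (y - x))\<^sup>2" if xy: "x \<in> X" "y \<in> X" for x y
  proof -
    have "norm (f y - f x - ?D x (y - x)) \<le> norm (y - x) * (M * norm (y - x))"
    proof (rule differentiable_bound_linearization[where S = "closed_segment x y" and f' = ?D])
      have sub: "closed_segment x y \<subseteq> X" using xy X(2) by (simp add: closed_segment_subset)
      show "x + t *\<^sub>R (y - x) \<in> closed_segment x y" if "t \<in> {0..1}" for t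
        using that by (auto simp: in_segment algebra_simps)
      show "(f has_derivative ?D z) (at z within closed_segment x y)" if "z \<in> closed_segment x y" for z
        using smooth_on_has_derivative[OF f] that X(3) sub has_derivative_at_withinI by blast
      show "onorm (?D z - ?D x) \<le> M * norm (y - x)" if z: "z \<in> closed_segment x y" for z
      proof (rule onorm_le)
        fix d :: "'a"
        have "norm (z - x) \<le> norm (y - x)" using segment_bound(1)[OF z] by simp
        then have "M * norm (z - x) * norm d \<le> M * norm (y - x) * norm d"
          using M by (intro mult_right_mono mult_left_mono) auto
        then show "norm ((?D z - ?D x) d) \<le> M * norm (y - x) * norm d"
          using DL[of z x d] sub z xy by auto
      qed
    qed simp
    then show ?thesis by (simp add: power2_eq_square mult_ac)
  qed
  then show ?thesis using M by blast
qed

text \<open>Replaces Gronwall's lemma on a domain so small that the Lipschitz constant is at most 1/2.\<close>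

lemma half_lipschitz_bound:
  fixes f :: "real \<Rightarrow> real"
  assumes "f 0 = 0"
    and f': "\<And>t. t \<in> {0..1} \<Longrightarrow> (f has_real_derivative f' t) (at t within {0..1})"
    and le: "\<And>t. t \<in> {0..1} \<Longrightarrow> \<bar>f' t\<bar> \<le> \<bar>f t\<bar> / 2 + C"
    and t: "t \<in> {0..1}"
  shows "\<bar>f t\<bar> \<le> 2 * C"
proof -
  have "continuous_on {0..1} f"
    using f' by (meson DERIV_continuous continuous_on_eq_continuous_within)
  then have "continuous_on {0..1} (\<lambda>t. \<bar>f t\<bar>)" by (rule continuous_on_rabs)
  \<comment> \<open>At a maximum of |f| the mean value estimate on [0, m], an interval of length at
    most 1, reads |f m| <= |f m| / 2 + C.\<close>
  then obtain m where m: "m \<in> {0..1}" "\<And>t. t \<in> {0..1} \<Longrightarrow> \<bar>f t\<bar> \<le> \<bar>f m\<bar>"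
    using continuous_attains_sup[of "{0..1::real}" "\<lambda>t. \<bar>f t\<bar>"] by auto
  have "norm (f m - f 0) \<le> (\<bar>f m\<bar> / 2 + C) * norm (m - 0)"
  proof (rule field_differentiable_bound[where S = "{0..1}" and f' = f'])
    fix z :: real assume z: "z \<in> {0..1}"
    show "(f has_field_derivative f' z) (at z within {0..1})" using f'[OF z] .
    show "norm (f' z) \<le> \<bar>f m\<bar> / 2 + C" using le[OF z] m(2)[OF z] by simp
  qed (use m in auto)
  moreover have "(\<bar>f m\<bar> / 2 + C) * m \<le> \<bar>f m\<bar> / 2 + C"
    using m(1) le[OF m(1)] by (intro mult_left_le) (auto intro: order_trans[OF abs_ge_zero])
  ultimately have "\<bar>f m\<bar> \<le> 2 * C" using assms(1) m(1) by auto
  then show ?thesis using m(2)[OF t] by linarith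
qed

text \<open>On each ray from \<open>y0\<close> the system is an ordinary differential equation. All
  rays are treated together, as one fixed point problem for a continuous function of
  \<open>y\<close>, so that continuity across the rays comes for free. The bound \<rho> * M <= s
  keeps the values in the ball around \<open>a0\<close>, and \<rho> * K <= 1/2 makes the integral
  operator a contraction.\<close>

lemma radial_solution_exists:
  fixes \<Psi> :: "'e::euclidean_space \<times> real \<Rightarrow> 'e"
  assumes cont: "continuous_on (cball y0 \<rho> \<times> cball a0 s) \<Psi>"
    and pos: "\<rho> > 0" "s > 0"
    and M: "\<And>z. z \<in> cball y0 \<rho> \<times> cball a0 s \<Longrightarrow> norm (\<Psi> z) \<le> M" "\<rho> * M \<le> s"
    and K: "\<And>y a b. y \<in> cball y0 \<rho> \<Longrightarrow> a \<in> cball a0 s \<Longrightarrow> b \<in> cball a0 s \<Longrightarrow>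
              norm (\<Psi> (y, a) - \<Psi> (y, b)) \<le> K * \<bar>a - b\<bar>" "\<rho> * K \<le> 1 / 2" "K \<ge> 0"
  shows "\<exists>\<nu>. continuous_on UNIV \<nu> \<and> (\<forall>y. \<nu> y \<in> cball a0 s) \<and> \<nu> y0 = a0 \<and>
      (\<forall>w. norm w \<le> \<rho> \<longrightarrow> (\<forall>t\<in>{0..1}. ((\<lambda>t. \<nu> (y0 + t *\<^sub>R w)) has_real_derivative
          \<Psi> (y0 + t *\<^sub>R w, \<nu> (y0 + t *\<^sub>R w)) \<bullet> w) (at t within {0..1})))"
proof -
  \<comment> \<open>Displacement from \<open>y0\<close> of the nearest point of the ball. It extends
    the integral operator to functions on the whole space, where the complete space of bounded
    continuous functions is at hand.\<close>
  define pr where "pr y = closest_point (cball y0 \<rho>) y - y0" for y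
  have pr: "norm (pr y) \<le> \<rho>" for y
    using closest_point_in_set[of "cball y0 \<rho>" y] pos by (auto simp: pr_def dist_norm norm_minus_commute)
  have pr_id: "pr y = y - y0" if "y \<in> cball y0 \<rho>" for y
    using that by (simp add: pr_def closest_point_self)
  have cpr: "continuous_on UNIV pr"
    unfolding pr_def using pos by (intro continuous_intros continuous_on_closest_point) auto
  have inb: "y0 + t *\<^sub>R w \<in> cball y0 \<rho>" if "norm w \<le> \<rho>" "t \<in> {0..1}" for t w
  proof -
    have "\<bar>t\<bar> * norm w \<le> 1 * \<rho>" using that pos by (intro mult_mono) auto
    then show ?thesis by (simp add: dist_norm)
  qed
  define F where "F \<nu> y t = \<Psi> (y0 + t *\<^sub>R pr y, \<nu> (y0 + t *\<^sub>R pr y)) \<bullet> pr y" for \<nu> :: "'e \<Rightarrow> real" and y and t :: real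
  define X where "X = (PiC UNIV (\<lambda>_. cball a0 s) :: ('e \<Rightarrow>\<^sub>C real) set)"
  have X: "\<nu> \<in> X \<longleftrightarrow> (\<forall>y. \<nu> y \<in> cball a0 s)" for \<nu> :: "'e \<Rightarrow>\<^sub>C real"
    by (auto simp: X_def mem_PiC_iff)
  have cF: "continuous_on (UNIV \<times> {0..1}) (\<lambda>(y, t). F \<nu> y t)" if "\<nu> \<in> X" for \<nu> :: "'e \<Rightarrow>\<^sub>C real"
  proof -
    have "continuous_on (UNIV \<times> {0..1}) (\<lambda>q::'e \<times> real. \<Psi> (y0 + snd q *\<^sub>R pr (fst q), \<nu> (y0 + snd q *\<^sub>R pr (fst q))))"
      using that inb[OF pr] X
      by (intro continuous_on_compose2[OF cont] continuous_intros continuous_on_compose2[OF cpr]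
          continuous_on_compose2[OF continuous_on_apply_bcontfun[of UNIV \<nu>]]) auto
    then show ?thesis
      unfolding F_def split_def by (intro continuous_intros continuous_on_compose2[OF cpr]) auto
  qed
  have cF1: "continuous_on {0..1} (F \<nu> y)" if "\<nu> \<in> X" for \<nu> :: "'e \<Rightarrow>\<^sub>C real" and y
  proof -
    have "continuous_on {0..1} (\<lambda>t::real. (y, t))" by (intro continuous_intros)
    from continuous_on_compose2[OF cF[OF that] this] show ?thesis by (auto simp: image_subset_iff)
  qed
  define T where "T \<nu> y = a0 + integral {0..1} (F \<nu> y)" for \<nu> y
  have bF: "\<bar>F \<nu> y t\<bar> \<le> s" if "\<nu> \<in> X" "t \<in> {0..1}" for \<nu> :: "'e \<Rightarrow>\<^sub>C real" and y t
  proof -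
    have "\<bar>F \<nu> y t\<bar> \<le> norm (\<Psi> (y0 + t *\<^sub>R pr y, \<nu> (y0 + t *\<^sub>R pr y))) * norm (pr y)"
      unfolding F_def by (rule Cauchy_Schwarz_ineq2)
    also have "\<dots> \<le> M * \<rho>"
      using M(1)[of "(y0 + t *\<^sub>R pr y, \<nu> (y0 + t *\<^sub>R pr y))"] inb[OF pr that(2)] that(1) X pr
      by (intro mult_mono) (auto intro: order_trans[OF norm_ge_zero])
    finally show ?thesis using M(2) by (simp add: mult.commute)
  qed
  have bT: "T \<nu> y \<in> cball a0 s" if "\<nu> \<in> X" for \<nu> :: "'e \<Rightarrow>\<^sub>C real" and y
    using integral_bound[of 0 1 "F \<nu> y" s] bF[OF that] cF1[OF that]
    by (auto simp: T_def dist_norm)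
  have cT: "T \<nu> \<in> bcontfun" if "\<nu> \<in> X" for \<nu> :: "'e \<Rightarrow>\<^sub>C real"
  proof (rule bcontfun_normI)
    have "continuous_on UNIV (\<lambda>y. integral (cbox 0 1) (F \<nu> y))"
      using cF[OF that] by (intro integral_continuous_on_param) simp
    then show "continuous_on UNIV (T \<nu>)"
      unfolding T_def by (auto intro!: continuous_intros)
    show "norm (T \<nu> y) \<le> \<bar>a0\<bar> + s" for y
      using bT[OF that, of y] by (auto simp: dist_real_def)
  qed
  have apT: "apply_bcontfun (Bcontfun (T \<nu>)) = T \<nu>" if "\<nu> \<in> X" for \<nu> :: "'e \<Rightarrow>\<^sub>C real"
    by (rule Bcontfun_inverse[OF cT[OF that]])
  have "\<exists>!\<nu>\<in>X. Bcontfun (T (apply_bcontfun \<nu>)) = \<nu>"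
  proof (rule Banach_fix[where c = "1/2"])
    show "complete X"
      unfolding X_def complete_eq_closed by (intro closed_PiC) simp
    show "X \<noteq> {}" 
      using X[of "const_bcontfun a0"] pos by (auto simp: const_bcontfun.rep_eq)
    show "(\<lambda>\<nu>. Bcontfun (T (apply_bcontfun \<nu>))) ` X \<subseteq> X"
      using bT apT X by auto
    fix f g assume fg: "f \<in> X" "g \<in> X"
    have "dist (T f y) (T g y) \<le> 1 / 2 * dist f g" for y
    proof -
      have "\<bar>F f y t - F g y t\<bar> \<le> 1 / 2 * dist f g" if t: "t \<in> {0..1}" for t
      proof -
        let ?y = "y0 + t *\<^sub>R pr y"
        have "F f y t - F g y t = (\<Psi> (?y, f ?y) - \<Psi> (?y, g ?y)) \<bullet> pr y"
          by (simp add: F_def inner_diff_left)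
        also have "\<bar>\<dots>\<bar> \<le> norm (\<Psi> (?y, f ?y) - \<Psi> (?y, g ?y)) * norm (pr y)"
          by (rule Cauchy_Schwarz_ineq2)
        also have "\<dots> \<le> (K * \<bar>f ?y - g ?y\<bar>) * \<rho>"
          using K(1)[OF inb[OF pr t], of "f ?y" "g ?y"] fg X pr[of y] K(3) by (intro mult_mono) auto
        also have "\<dots> \<le> (K * dist f g) * \<rho>"
          using dist_bounded[of f ?y g] K(3) pos by (intro mult_mono mult_left_mono) (auto simp: dist_real_def)
        also have "\<dots> \<le> 1 / 2 * dist f g"
          using mult_right_mono[OF K(2), of "dist f g"] by (simp add: mult_ac)
        finally show ?thesis .
      qed
      then have "norm (integral {0..1} (\<lambda>t. F f y t - F g y t)) \<le> 1 / 2 * dist f g * (1 - 0)"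
        using cF1[OF fg(1)] cF1[OF fg(2)] by (intro integral_bound continuous_intros) auto
      then show ?thesis
        using cF1[OF fg(1)] cF1[OF fg(2)]
        by (simp add: T_def dist_norm integral_diff integrable_continuous_real)
    qed
    then show "dist (Bcontfun (T f)) (Bcontfun (T g)) \<le> 1 / 2 * dist f g"
      by (intro dist_bound) (simp add: apT fg)
  qed auto
  then obtain \<nu> where \<nu>: "\<nu> \<in> X" "Bcontfun (T (apply_bcontfun \<nu>)) = \<nu>" by blast
  have fixp: "\<nu> y = T \<nu> y" for y using apT[OF \<nu>(1)] \<nu>(2) by metis
  have "((\<lambda>t. \<nu> (y0 + t *\<^sub>R w)) has_real_derivative
          \<Psi> (y0 + t *\<^sub>R w, \<nu> (y0 + t *\<^sub>R w)) \<bullet> w) (at t within {0..1})"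
    if w: "norm w \<le> \<rho>" and t: "t \<in> {0..1}" for w t
  proof -
    define f where "f t = \<Psi> (y0 + t *\<^sub>R w, \<nu> (y0 + t *\<^sub>R w)) \<bullet> w" for t
    define \<Phi> where "\<Phi> t = integral {0..t} f" for t
    have "f = F \<nu> (y0 + w)"
      using pr_id[of "y0 + w"] w by (auto simp: F_def f_def fun_eq_iff dist_norm)
    then have cf: "continuous_on {0..1} f" using cF1[OF \<nu>(1)] by simp
    have \<Phi>: "(\<Phi> has_real_derivative f t) (at t within {0..1})" if "t \<in> {0..1}" for t
      unfolding \<Phi>_def by (rule integral_has_real_derivative[OF cf that])
    have eq: "\<nu> (y0 + t *\<^sub>R w) = a0 + \<Phi> t" if t: "t \<in> {0..1}" for t
    proof -
      \<comment> \<open>At the point y0 + t w the operator \<open>T\<close> integrates over the unit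
        interval along a shortened segment. Rescaling the variable turns this into the integral of
        \<open>f\<close> over [0, t], which can be differentiated in \<open>t\<close>.\<close>
      have "((\<lambda>\<tau>. t * f (\<tau> * t)) has_integral \<Phi> (1 * t) - \<Phi> (0 * t)) {0..1}"
      proof (rule fundamental_theorem_of_calculus)
        fix \<tau> :: real assume \<tau>: "\<tau> \<in> {0..1}"
        have "\<tau> * t \<in> {0..1}" using \<tau> t by (auto simp: mult_le_one)
        moreover have "((\<lambda>\<tau>. \<tau> * t) has_real_derivative t) (at \<tau> within {0..1})"
          by (auto intro!: derivative_eq_intros)
        moreover have "(\<lambda>\<tau>. \<tau> * t) ` {0..1} \<subseteq> {0..1}" using t by (auto simp: mult_le_one)
        ultimately have "((\<lambda>\<tau>. \<Phi> (\<tau> * t)) has_real_derivative f (\<tau> * t) * t) (at \<tau> within {0..1})"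
          using DERIV_image_chain[of \<Phi> "f (\<tau> * t)" "\<lambda>\<tau>. \<tau> * t" \<tau> "{0..1}" t]
            DERIV_subset[OF \<Phi>] by (simp add: o_def)
        then show "((\<lambda>\<tau>. \<Phi> (\<tau> * t)) has_vector_derivative t * f (\<tau> * t)) (at \<tau> within {0..1})"
          by (simp add: has_real_derivative_iff_has_vector_derivative mult.commute)
      qed simp
      moreover have "F \<nu> (y0 + t *\<^sub>R w) \<tau> = t * f (\<tau> * t)" for \<tau>
        using pr_id[OF inb[OF w t]] by (simp add: F_def f_def)
      ultimately have "integral {0..1} (F \<nu> (y0 + t *\<^sub>R w)) = \<Phi> t - \<Phi> 0"
        by (simp add: integral_unique cong: integral_cong del: integral_mult_right)
      moreover have "\<Phi> 0 = 0" by (simp add: \<Phi>_def)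
      ultimately show ?thesis using fixp[of "y0 + t *\<^sub>R w"] by (simp add: T_def)
    qed
    have "((\<lambda>t. a0 + \<Phi> t) has_real_derivative f t) (at t within {0..1})"
      using \<Phi>[OF t] by (auto intro!: derivative_eq_intros)
    then show ?thesis
      unfolding f_def by (rule has_field_derivative_transform_within[OF _ zero_less_one t]) (simp add: eq)
  qed
  moreover have "\<nu> y0 = a0"
    using fixp[of y0] pr_id[of y0] pos by (simp add: T_def F_def[abs_def])
  ultimately show ?thesis
    using \<nu>(1) X by (intro exI[of _ "apply_bcontfun \<nu>"]) auto
qed

text \<open>The increment \<open>\<delta> t\<close> of the radial solution from the ray through \<open>y\<close> to the ray through
  \<open>y + h\<close>, minus \<open>t\<close> times the prescribed differential applied to \<open>h\<close>, satisfies
  \<open>\<bar>\<delta>'\<bar> \<le> \<bar>\<delta>\<bar> / 2 + O(\<bar>h\<bar>\<^sup>2)\<close>; the compatibility condition removes the terms linear in \<open>h\<close>.\<close>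

theorem frobenius_local:
  fixes \<Psi> :: "'e::euclidean_space \<times> real \<Rightarrow> 'e"
  assumes G: "open G" "(y0, a0) \<in> G" and smooth: "smooth_on G \<Psi>"
    and compat: "\<And>z u v. z \<in> G \<Longrightarrow>
      frechet_derivative \<Psi> (at z) (u, \<Psi> z \<bullet> u) \<bullet> v = frechet_derivative \<Psi> (at z) (v, \<Psi> z \<bullet> v) \<bullet> u"
  shows "\<exists>r>0. \<exists>\<nu>. smooth_on (ball y0 r) \<nu> \<and> \<nu> y0 = a0 \<and>
      (\<forall>y\<in>ball y0 r. (y, \<nu> y) \<in> G \<and> (\<nu> has_derivative (\<lambda>h. \<Psi> (y, \<nu> y) \<bullet> h)) (at y))"
proof -
  let ?D = "\<lambda>z. frechet_derivative \<Psi> (at z)"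
  obtain A B where AB: "open A" "open B" "y0 \<in> A" "a0 \<in> B" "A \<times> B \<subseteq> G"
    using G by (rule open_prod_elim) auto
  obtain r0 where r0: "r0 > 0" "cball y0 r0 \<subseteq> A" using AB open_contains_cball by blast
  obtain s where s: "s > 0" "cball a0 s \<subseteq> B" using AB open_contains_cball by blast
  define X where "X = cball y0 r0 \<times> cball a0 s"
  have X: "compact X" "convex X" "X \<subseteq> G"
    using r0 s AB by (auto simp: X_def intro!: compact_Times convex_Times)
  obtain L where L: "L > 0" "\<And>z d. z \<in> X \<Longrightarrow> norm (?D z d) \<le> L * norm d"
    using compact_derivative_bound[OF smooth X(1,3)] by blast
  have Lip: "norm (\<Psi> z - \<Psi> z') \<le> L * norm (z - z')" if "z \<in> X" "z' \<in> X" for z z'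
    by (rule convex_lipschitz[OF smooth X(2,3) _ that]) (rule L(2))
  obtain N where N: "N > 0" and taylor: "\<forall>z\<in>X. \<forall>z'\<in>X. norm (\<Psi> z' - \<Psi> z - ?D z (z' - z)) \<le> N * (norm (z' - z))\<^sup>2"
    using compact_taylor_bound[OF smooth X] by blast
  have "compact (\<Psi> ` X)"
    by (rule compact_continuous_image[OF continuous_on_subset[OF smooth_on_continuous_on[OF smooth] X(3)] X(1)])
  then obtain M where M: "M > 0" "\<And>z. z \<in> X \<Longrightarrow> norm (\<Psi> z) \<le> M"
    using compact_imp_bounded bounded_pos by (metis image_eqI)
  \<comment> \<open>The three bounds keep the rays in the domain, the radial solution within
    distance \<open>s\<close> of \<open>a0\<close>, and the Lipschitz constant along a ray at most
    1/2.\<close>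
  define \<rho> where "\<rho> = min r0 (min (s / M) (1 / (2 * L)))"
  have \<rho>: "\<rho> > 0" "\<rho> \<le> r0" "\<rho> * M \<le> s" "\<rho> * L \<le> 1 / 2"
  proof -
    show "\<rho> > 0" "\<rho> \<le> r0" using r0 s M L by (auto simp: \<rho>_def)
    have "\<rho> \<le> s / M" "\<rho> \<le> 1 / (2 * L)" by (auto simp: \<rho>_def)
    then show "\<rho> * M \<le> s" "\<rho> * L \<le> 1 / 2" using M(1) L(1) by (auto simp: field_simps)
  qed
  have sub: "cball y0 \<rho> \<times> cball a0 s \<subseteq> X" using \<rho> by (auto simp: X_def)
  have "\<exists>\<nu>. continuous_on UNIV \<nu> \<and> (\<forall>y. \<nu> y \<in> cball a0 s) \<and> \<nu> y0 = a0 \<and>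
      (\<forall>w. norm w \<le> \<rho> \<longrightarrow> (\<forall>t\<in>{0..1}. ((\<lambda>t. \<nu> (y0 + t *\<^sub>R w)) has_real_derivative
          \<Psi> (y0 + t *\<^sub>R w, \<nu> (y0 + t *\<^sub>R w)) \<bullet> w) (at t within {0..1})))"
  proof (rule radial_solution_exists[where K = L and M = M])
    show "continuous_on (cball y0 \<rho> \<times> cball a0 s) \<Psi>"
      using smooth_on_continuous_on[OF smooth] sub X(3) continuous_on_subset by blast
    show "norm (\<Psi> z) \<le> M" if "z \<in> cball y0 \<rho> \<times> cball a0 s" for z
      using M(2) that sub by blast
    show "norm (\<Psi> (y, a) - \<Psi> (y, b)) \<le> L * \<bar>a - b\<bar>"
      if "y \<in> cball y0 \<rho>" "a \<in> cball a0 s" "b \<in> cball a0 s" for y a b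
    proof -
      have "(y, a) \<in> X" "(y, b) \<in> X" using that sub by blast+
      from Lip[OF this] show ?thesis by (simp add: norm_Pair)
    qed
  qed (use \<rho> s L in auto)
  then obtain \<nu> where \<nu>: "continuous_on UNIV \<nu>" "\<And>y. \<nu> y \<in> cball a0 s" "\<nu> y0 = a0"
    and ray: "\<And>w t. norm w \<le> \<rho> \<Longrightarrow> t \<in> {0..1} \<Longrightarrow> ((\<lambda>t. \<nu> (y0 + t *\<^sub>R w)) has_real_derivative
          \<Psi> (y0 + t *\<^sub>R w, \<nu> (y0 + t *\<^sub>R w)) \<bullet> w) (at t within {0..1})" by blast
  \<comment> \<open>The 1 accounts for \<open>norm h\<close>, the rest is the bound for the
    increment \<open>b\<close> proved in \<open>bb\<close>.\<close>
  define C where "C = 1 + 2 * (1 / 2 + M)"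
  have C: "C > 0" using M by (simp add: C_def)
  \<comment> \<open>The first summand bounds the Taylor remainder paired with \<open>w\<close>, the
    second the change of \<Psi> paired with \<open>h\<close>; the factor 2 is that of
    \<open>half_lipschitz_bound\<close>.\<close>
  define E where "E = 2 * (N * C\<^sup>2 * \<rho> + L * C)"
  have main: "\<bar>\<nu> (y0 + w + h) - \<nu> (y0 + w) - \<Psi> (y0 + w, \<nu> (y0 + w)) \<bullet> h\<bar> \<le> E * (norm h)\<^sup>2"
    if w: "norm w \<le> \<rho>" and wh: "norm (w + h) \<le> \<rho>" for w h
  proof -
    define z where "z t = (y0 + t *\<^sub>R w, \<nu> (y0 + t *\<^sub>R w))" for t
    define z' where "z' t = (y0 + t *\<^sub>R (w + h), \<nu> (y0 + t *\<^sub>R (w + h)))" for t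
    have inb: "y0 + t *\<^sub>R w \<in> cball y0 \<rho>" if "norm w \<le> \<rho>" "t \<in> {0..1}" for t w
    proof -
      have "\<bar>t\<bar> * norm w \<le> 1 * \<rho>" using that \<rho>(1) by (intro mult_mono) auto
      then show ?thesis by (simp add: dist_norm)
    qed
    have zX: "z t \<in> X" "z' t \<in> X" if "t \<in> {0..1}" for t
      using inb[OF w that] inb[OF wh that] \<nu>(2) sub by (auto simp: z_def z'_def)
    define a where "a t = \<nu> (y0 + t *\<^sub>R w)" for t
    define b where "b t = \<nu> (y0 + t *\<^sub>R (w + h)) - \<nu> (y0 + t *\<^sub>R w)" for t
    have da: "(a has_real_derivative \<Psi> (z t) \<bullet> w) (at t within {0..1})" if "t \<in> {0..1}" for t
      using ray[OF w that] by (simp add: a_def[abs_def] z_def)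
    have db: "(b has_real_derivative \<Psi> (z' t) \<bullet> (w + h) - \<Psi> (z t) \<bullet> w) (at t within {0..1})"
      if "t \<in> {0..1}" for t
      unfolding b_def[abs_def] z_def z'_def by (rule DERIV_diff[OF ray[OF wh that] ray[OF w that]])
    have dz: "z' t - z t = (t *\<^sub>R h, b t)" for t by (simp add: z_def z'_def b_def algebra_simps)
    have nz: "norm (z' t - z t) \<le> norm h + \<bar>b t\<bar>" if "t \<in> {0..1}" for t
    proof -
      have "norm (z' t - z t) \<le> norm (t *\<^sub>R h) + norm (b t)" unfolding dz by (rule norm_Pair_le)
      also have "norm (t *\<^sub>R h) \<le> norm h" using that by (simp add: mult_left_le_one_le)
      finally show ?thesis by simp
    qed
    have Lz: "norm (\<Psi> (z' t) - \<Psi> (z t)) \<le> L * (norm h + \<bar>b t\<bar>)" if "t \<in> {0..1}" for t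
      using Lip[OF zX(2)[OF that] zX(1)[OF that]] mult_left_mono[OF nz[OF that], of L] L(1) by linarith
    \<comment> \<open>Since L * \<rho> <= 1/2. This puts the differential inequalities for
      \<open>b\<close> and for \<delta> into the shape that \<open>half_lipschitz_bound\<close>
      accepts.\<close>
    have small: "L * x * norm w \<le> x / 2" if "x \<ge> 0" for x
    proof -
      have "L * norm w \<le> L * \<rho>" using w L(1) by simp
      then have "L * norm w \<le> 1 / 2" using \<rho>(4) by (simp add: mult.commute)
      then show ?thesis using mult_right_mono[of "L * norm w" "1/2" x] that by (simp add: mult_ac)
    qed
    have bb: "\<bar>b t\<bar> \<le> 2 * ((1 / 2 + M) * norm h)" if "t \<in> {0..1}" for t
    proof (rule half_lipschitz_bound[OF _ db _ that])
      show "b 0 = 0" by (simp add: b_def)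
      fix t :: real assume t: "t \<in> {0..1}"
      have "\<Psi> (z' t) \<bullet> (w + h) - \<Psi> (z t) \<bullet> w = (\<Psi> (z' t) - \<Psi> (z t)) \<bullet> w + \<Psi> (z' t) \<bullet> h"
        by (simp add: algebra_simps)
      also have "\<bar>\<dots>\<bar> \<le> norm (\<Psi> (z' t) - \<Psi> (z t)) * norm w + norm (\<Psi> (z' t)) * norm h"
        by (intro order_trans[OF abs_triangle_ineq] add_mono Cauchy_Schwarz_ineq2)
      also have "\<dots> \<le> L * (norm h + \<bar>b t\<bar>) * norm w + M * norm h"
        using Lz[OF t] M(2)[OF zX(2)[OF t]] by (intro add_mono mult_right_mono) auto
      also have "\<dots> \<le> (norm h + \<bar>b t\<bar>) / 2 + M * norm h"
        using small[of "norm h + \<bar>b t\<bar>"] by simp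
      finally show "\<bar>\<Psi> (z' t) \<bullet> (w + h) - \<Psi> (z t) \<bullet> w\<bar> \<le> \<bar>b t\<bar> / 2 + (1 / 2 + M) * norm h"
        by (simp add: algebra_simps add_divide_distrib)
    qed
    have nC: "norm h + \<bar>b t\<bar> \<le> C * norm h" if "t \<in> {0..1}" for t
      using bb[OF that] by (simp add: C_def algebra_simps)
    \<comment> \<open>The increment predicted at the point of parameter \<open>t\<close>, where the
      displacement between the two rays is t h.\<close>
    define c where "c t = t * (\<Psi> (z t) \<bullet> h)" for t
    define \<delta> where "\<delta> t = b t - c t" for t
    \<comment> \<open>The derivative of \<delta> sorted by size: a Taylor remainder, a product of
      two increments, both of second order in \<open>h\<close>, and a term linear in
      \<delta>.\<close>
    define \<delta>' where "\<delta>' t = (\<Psi> (z' t) - \<Psi> (z t) - ?D (z t) (z' t - z t)) \<bullet> w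
      + (\<Psi> (z' t) - \<Psi> (z t)) \<bullet> h + ?D (z t) (0, \<delta> t) \<bullet> w" for t
    have d\<delta>: "(\<delta> has_real_derivative \<delta>' t) (at t within {0..1})" if t: "t \<in> {0..1}" for t
    proof -
      have D: "(\<Psi> has_derivative ?D (z t)) (at (z t))"
        using smooth_on_has_derivative[OF smooth] zX(1)[OF t] X(3) by blast
      then have lin: "linear (?D (z t))" by (rule has_derivative_linear)
      have "(z has_derivative (\<lambda>k. k *\<^sub>R (w, \<Psi> (z t) \<bullet> w))) (at t within {0..1})"
      proof -
        have "((\<lambda>t. (y0 + t *\<^sub>R w, a t)) has_derivative (\<lambda>k. (k *\<^sub>R w, (\<Psi> (z t) \<bullet> w) * k))) (at t within {0..1})"
          using da[OF t] by (intro has_derivative_Pair) (auto intro!: derivative_eq_intros simp: has_field_derivative_def)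
        then show ?thesis by (simp add: z_def[abs_def] a_def scaleR_prod_def mult.commute)
      qed
      from has_derivative_compose[OF this D]
      have "((\<lambda>t. \<Psi> (z t)) has_derivative (\<lambda>k. k *\<^sub>R ?D (z t) (w, \<Psi> (z t) \<bullet> w))) (at t within {0..1})"
        using linear_cmul[OF lin, of _ "(w, \<Psi> (z t) \<bullet> w)"] by simp
      then have "(c has_real_derivative \<Psi> (z t) \<bullet> h + t * (?D (z t) (w, \<Psi> (z t) \<bullet> w) \<bullet> h)) (at t within {0..1})"
        unfolding c_def has_field_derivative_def
        by (auto intro!: derivative_eq_intros simp: algebra_simps)
      from DERIV_diff[OF db[OF t] this]
      have "(\<delta> has_real_derivative \<Psi> (z' t) \<bullet> (w + h) - \<Psi> (z t) \<bullet> w -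
          (\<Psi> (z t) \<bullet> h + t * (?D (z t) (w, \<Psi> (z t) \<bullet> w) \<bullet> h))) (at t within {0..1})"
        by (simp add: \<delta>_def[abs_def])
      moreover have "\<delta>' t = \<Psi> (z' t) \<bullet> (w + h) - \<Psi> (z t) \<bullet> w -
          (\<Psi> (z t) \<bullet> h + t * (?D (z t) (w, \<Psi> (z t) \<bullet> w) \<bullet> h))"
      proof -
        \<comment> \<open>Compatibility exchanges the ray direction \<open>w\<close> with
          \<open>h\<close>. After scaling by \<open>t\<close>, the lifted vector of \<open>h\<close>
          differs from \<open>z' t - z t\<close> just by (0, \<delta> t), so the linearisation
          cancels up to \<delta>.\<close>
        have "?D (z t) (w, \<Psi> (z t) \<bullet> w) \<bullet> h = ?D (z t) (h, \<Psi> (z t) \<bullet> h) \<bullet> w"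
          using compat zX(1)[OF t] X(3) by blast
        moreover have "t *\<^sub>R ?D (z t) (h, \<Psi> (z t) \<bullet> h) = ?D (z t) (t *\<^sub>R h, c t)"
          using linear_cmul[OF lin, of t "(h, \<Psi> (z t) \<bullet> h)"] by (simp add: c_def)
        moreover have "?D (z t) (t *\<^sub>R h, c t) = ?D (z t) (z' t - z t) - ?D (z t) (0, \<delta> t)"
          by (simp add: linear_diff[OF lin, symmetric] dz \<delta>_def)
        ultimately have "t * (?D (z t) (w, \<Psi> (z t) \<bullet> w) \<bullet> h) =
            ?D (z t) (z' t - z t) \<bullet> w - ?D (z t) (0, \<delta> t) \<bullet> w"
          by (metis inner_scaleR_left inner_diff_left)
        then show ?thesis unfolding \<delta>'_def by (simp add: algebra_simps)
      qed
      ultimately show ?thesis by simp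
    qed
    have "\<bar>\<delta> 1\<bar> \<le> 2 * ((N * C\<^sup>2 * \<rho> + L * C) * (norm h)\<^sup>2)"
    proof (rule half_lipschitz_bound[OF _ d\<delta>])
      show "\<delta> 0 = 0" by (simp add: \<delta>_def b_def c_def)
      fix t :: real assume t: "t \<in> {0..1}"
      have "\<bar>(\<Psi> (z' t) - \<Psi> (z t) - ?D (z t) (z' t - z t)) \<bullet> w\<bar> \<le> (N * (C * norm h)\<^sup>2) * \<rho>"
      proof -
        have "norm (z' t - z t) \<le> C * norm h" using nz[OF t] nC[OF t] by linarith
        then have "N * (norm (z' t - z t))\<^sup>2 \<le> N * (C * norm h)\<^sup>2"
          using N by (intro mult_left_mono power_mono) auto
        then have "norm (\<Psi> (z' t) - \<Psi> (z t) - ?D (z t) (z' t - z t)) \<le> N * (C * norm h)\<^sup>2"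
          using taylor zX[OF t] by fastforce
        then show ?thesis
          using w N by (intro order_trans[OF Cauchy_Schwarz_ineq2] mult_mono) auto
      qed
      moreover have "\<bar>(\<Psi> (z' t) - \<Psi> (z t)) \<bullet> h\<bar> \<le> (L * (C * norm h)) * norm h"
        using Lz[OF t] nC[OF t] L(1)
        by (intro order_trans[OF Cauchy_Schwarz_ineq2] mult_right_mono order_trans[OF Lz[OF t]] mult_left_mono) auto
      moreover have "\<bar>?D (z t) (0, \<delta> t) \<bullet> w\<bar> \<le> \<bar>\<delta> t\<bar> / 2"
      proof -
        have "norm (?D (z t) (0, \<delta> t)) \<le> L * \<bar>\<delta> t\<bar>"
          using L(2)[OF zX(1)[OF t], of "(0, \<delta> t)"] by (simp add: norm_Pair)
        then have "\<bar>?D (z t) (0, \<delta> t) \<bullet> w\<bar> \<le> L * \<bar>\<delta> t\<bar> * norm w"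
          by (intro order_trans[OF Cauchy_Schwarz_ineq2] mult_right_mono) auto
        then show ?thesis using small[of "\<bar>\<delta> t\<bar>"] by simp
      qed
      ultimately show "\<bar>\<delta>' t\<bar> \<le> \<bar>\<delta> t\<bar> / 2 + (N * C\<^sup>2 * \<rho> + L * C) * (norm h)\<^sup>2"
        unfolding \<delta>'_def by (simp add: algebra_simps power2_eq_square)
    qed auto
    then show ?thesis
      by (simp add: \<delta>_def b_def c_def z_def E_def algebra_simps)
  qed
  have deriv: "(\<nu> has_derivative (\<lambda>h. \<Psi> (y, \<nu> y) \<bullet> h)) (at y)" if y: "y \<in> ball y0 \<rho>" for y
  proof (rule has_derivativeI_sandwich[where e = "\<rho> - dist y0 y" and H = "\<lambda>x. \<bar>E\<bar> * norm (x - y)"])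
    show "0 < \<rho> - dist y0 y" using y by simp
    show "bounded_linear (\<lambda>h. \<Psi> (y, \<nu> y) \<bullet> h)" by (rule bounded_linear_inner_right)
    show "((\<lambda>x. \<bar>E\<bar> * norm (x - y)) \<longlongrightarrow> 0) (at y)" by (auto intro!: tendsto_eq_intros)
    fix x assume x: "x \<noteq> y" "dist x y < \<rho> - dist y0 y"
    have "norm (y - y0) \<le> \<rho>" using y by (simp add: dist_norm norm_minus_commute)
    moreover have "norm ((y - y0) + (x - y)) \<le> \<rho>"
      using norm_triangle_ineq[of "y - y0" "x - y"] x(2) by (simp add: dist_norm norm_minus_commute)
    ultimately have "\<bar>\<nu> x - \<nu> y - \<Psi> (y, \<nu> y) \<bullet> (x - y)\<bar> \<le> E * (norm (x - y))\<^sup>2"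
      using main[of "y - y0" "x - y"] by simp
    also have "\<dots> \<le> \<bar>E\<bar> * (norm (x - y))\<^sup>2" by (intro mult_right_mono) auto
    finally show "norm (\<nu> x - \<nu> y - \<Psi> (y, \<nu> y) \<bullet> (x - y)) / norm (x - y) \<le> \<bar>E\<bar> * norm (x - y)"
      using x(1) by (simp add: field_simps power2_eq_square)
  qed
  have inG: "(y, \<nu> y) \<in> G" if "y \<in> ball y0 \<rho>" for y
    using that \<nu>(2) sub X(3) by (meson SigmaI ball_subset_cball subsetD)
  \<comment> \<open>Bootstrapping: the derivative of \<nu> is a smooth function of (y, \<nu> y), so
    each order of differentiability yields the next.\<close>
  have Ck: "Ck_on k (ball y0 \<rho>) \<nu>" for k
  proof (induction k)
    case 0
    show ?case using \<nu>(1) continuous_on_subset by auto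
  next
    case (Suc k)
    show ?case
    proof (rule Ck_onI[OF open_ball deriv])
      fix v
      have "Ck_on k (ball y0 \<rho>) (\<lambda>y. (y, \<nu> y))"
      proof -
        have "bounded_linear (\<lambda>a::'e. (a, 0::real))" "bounded_linear (\<lambda>b::real. (0::'e, b))"
          by (auto intro!: bounded_linear_intros)
        from Ck_on_add[OF open_ball Ck_on_linear[OF this(1)] Ck_on_linear_comp[OF open_ball this(2) Suc.IH]]
        show ?thesis by simp
      qed
      then have "Ck_on k (ball y0 \<rho>) (\<lambda>y. \<Psi> (y, \<nu> y))"
        using smooth inG G(1)
        by (intro Ck_on_compose[where g = \<Psi> and T = G and f = "\<lambda>y. (y, \<nu> y)"]) (auto simp: smooth_on_def)
      then show "Ck_on k (ball y0 \<rho>) (\<lambda>y. \<Psi> (y, \<nu> y) \<bullet> v)"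
        by (rule Ck_on_linear_comp[OF open_ball bounded_linear_inner_left])
    qed
  qed
  show ?thesis
    using \<rho>(1) Ck \<nu>(3) inG deriv by (intro exI[of _ \<rho>] exI[of _ \<nu>] conjI) (auto simp: smooth_on_def)
qed

section \<open>Charts of the tangent and cotangent bundles\<close>

lemma chart_map_in: "q \<in> chart_dom c \<Longrightarrow> chart_map c q \<in> chart_image c"
  by (simp add: chart_image_def)

lemma chart_inv_in: "x \<in> chart_image c \<Longrightarrow> chart_inv c x \<in> chart_dom c"
  unfolding chart_image_def chart_inv_def by (rule inv_into_into)

context
  fixes A :: "('m::topological_space, real^'n) chart set"
  assumes atlas: "smooth_atlas A"
begin

lemma chart_homeomorphism:
  assumes "c \<in> A"
  shows "open (chart_dom c)" "open (chart_image c)"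
    "homeomorphism (chart_dom c) (chart_image c) (chart_map c) (chart_inv c)"
  using atlas assms unfolding smooth_atlas_def by auto

lemma chart_inv_map: "c \<in> A \<Longrightarrow> q \<in> chart_dom c \<Longrightarrow> chart_inv c (chart_map c q) = q"
  using chart_homeomorphism(3) homeomorphism_apply1 by blast

lemma chart_map_inv: "c \<in> A \<Longrightarrow> x \<in> chart_image c \<Longrightarrow> chart_map c (chart_inv c x) = x"
  using chart_homeomorphism(3) homeomorphism_apply2 by blast

lemma chart_covers: "\<exists>c\<in>A. q \<in> chart_dom c"
  using atlas unfolding smooth_atlas_def by auto

lemma open_chart_map_image:
  assumes "c \<in> A" "open U" "U \<subseteq> chart_dom c"
  shows "open (chart_map c ` U)"
proof -
  have "openin (top_of_set (chart_dom c)) U"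
    using assms(2,3) openin_open_eq[OF chart_homeomorphism(1)[OF assms(1)]] by auto
  then have "openin (top_of_set (chart_image c)) (chart_map c ` U)"
    by (rule homeomorphism_imp_open_map[OF chart_homeomorphism(3)[OF assms(1)]])
  then show ?thesis using openin_open_eq[OF chart_homeomorphism(2)[OF assms(1)]] by auto
qed

lemma transition_map: "c \<in> A \<Longrightarrow> q \<in> chart_dom c \<Longrightarrow> transition c d (chart_map c q) = chart_map d q"
  by (simp add: transition_def chart_inv_map)

lemma transition_has_derivative:
  assumes "c \<in> A" "d \<in> A" "q \<in> chart_dom c" "q \<in> chart_dom d"
  shows "(transition c d has_derivative (\<lambda>v. jacobian c d q *v v)) (at (chart_map c q))"
proof -
  have "smooth_on (chart_map c ` (chart_dom c \<inter> chart_dom d)) (transition c d)"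
    using atlas assms unfolding smooth_atlas_def by blast
  then have D: "(transition c d has_derivative frechet_derivative (transition c d) (at (chart_map c q))) (at (chart_map c q))"
    using assms by (intro smooth_on_has_derivative) auto
  then show ?thesis
    by (simp add: jacobian_def matrix_vector_mul(2)[OF has_derivative_linear[OF D]])
qed

lemma jacobian_cocycle:
  assumes "c \<in> A" "d \<in> A" "e \<in> A" "q \<in> chart_dom c" "q \<in> chart_dom d" "q \<in> chart_dom e"
  shows "jacobian c e q = jacobian d e q ** jacobian c d q"
proof -
  let ?U = "chart_dom c \<inter> chart_dom d \<inter> chart_dom e"
  have "(transition d e has_derivative (\<lambda>v. jacobian d e q *v v)) (at (transition c d (chart_map c q)))"
    using transition_has_derivative[of d e q] assms by (simp add: transition_map)
  from has_derivative_compose[OF transition_has_derivative this] assms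
  have "((\<lambda>x. transition d e (transition c d x)) has_derivative (\<lambda>v. jacobian d e q *v (jacobian c d q *v v))) (at (chart_map c q))"
    by blast
  then have "(transition c e has_derivative (\<lambda>v. jacobian d e q *v (jacobian c d q *v v))) (at (chart_map c q))"
  proof (rule has_derivative_transform_within_open)
    show "open (chart_map c ` ?U)"
      using chart_homeomorphism(1) assms by (intro open_chart_map_image open_Int) auto
    show "chart_map c q \<in> chart_map c ` ?U" using assms by blast
    show "transition d e (transition c d x) = transition c e x" if "x \<in> chart_map c ` ?U" for x
      using that assms by (auto simp: transition_map)
  qed
  from has_derivative_unique[OF this transition_has_derivative[OF assms(1,3,4,6)]]
  have "jacobian d e q *v (jacobian c d q *v v) = jacobian c e q *v v" for v by meson
  then show ?thesis by (metis matrix_eq matrix_vector_mul_assoc)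
qed

lemma jacobian_self:
  assumes "c \<in> A" "q \<in> chart_dom c"
  shows "jacobian c c q = mat 1"
proof -
  have "(transition c c has_derivative (\<lambda>v. v)) (at (chart_map c q))"
  proof (rule has_derivative_transform_within_open[OF has_derivative_ident])
    show "open (chart_image c)" by (rule chart_homeomorphism(2)[OF assms(1)])
    show "chart_map c q \<in> chart_image c" using assms(2) by (rule chart_map_in)
    show "x = transition c c x" if "x \<in> chart_image c" for x
      using that assms(1) by (simp add: transition_def chart_map_inv)
  qed
  from has_derivative_unique[OF this transition_has_derivative[OF assms(1,1,2,2)]]
  have "jacobian c c q *v v = mat 1 *v v" for v by (metis matrix_vector_mul_lid)
  then show ?thesis by (simp add: matrix_eq)
qed

section \<open>Vectors and covectors as their components in a single chart\<close>

lemma cotangent_law: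
  assumes "w \<in> cotangent_space A q" "c \<in> A" "d \<in> A" "q \<in> chart_dom c" "q \<in> chart_dom d"
  shows "w c = transpose (jacobian c d q) *v w d"
proof -
  have "w c $ i = (\<Sum>j\<in>UNIV. jacobian c d q $ j $ i * w d $ j)" for i
    using assms unfolding cotangent_space_def by blast
  then show ?thesis
    by (simp add: vec_eq_iff matrix_vector_mult_def transpose_def del: transpose_matrix_vector)
qed

lemma tangent_law:
  assumes "X \<in> tangent_space A q" "c \<in> A" "d \<in> A" "q \<in> chart_dom c" "q \<in> chart_dom d"
  shows "X d = jacobian c d q *v X c"
proof -
  have "X d $ j = (\<Sum>i\<in>UNIV. jacobian c d q $ j $ i * X c $ i)" for j
    using assms unfolding tangent_space_def by blast
  then show ?thesis by (simp add: vec_eq_iff matrix_vector_mult_def)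
qed

text \<open>The transformation law from \<open>c\<close> dictates the components in every other
  chart around \<open>q\<close>; the cocycle identity makes them consistent among each
  other.\<close>

lemma cotangent_exists:
  assumes "c \<in> A" "q \<in> chart_dom c"
  shows "\<exists>w\<in>cotangent_space A q. w c = p"
proof -
  define w where "w d = (if d \<in> A \<and> q \<in> chart_dom d then transpose (jacobian d c q) *v p else 0)" for d
  have "w d $ i = (transpose (jacobian d e q) *v w e) $ i"
    if "d \<in> A" "e \<in> A" "q \<in> chart_dom d" "q \<in> chart_dom e" for d e i
    using that jacobian_cocycle[of d e c q] assms
    by (simp add: w_def matrix_vector_mul_assoc matrix_transpose_mul del: transpose_matrix_vector)
  moreover have "w c = p" using assms by (simp add: w_def jacobian_self)
  moreover have "\<forall>d. d \<notin> A \<or> q \<notin> chart_dom d \<longrightarrow> w d = 0" by (auto simp: w_def)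
  ultimately have "w \<in> cotangent_space A q"
    unfolding cotangent_space_def mem_Collect_eq matrix_vector_mult_def transpose_def vec_lambda_beta by blast
  then show ?thesis using \<open>w c = p\<close> by blast
qed

lemma cotangent_eqI:
  assumes "w \<in> cotangent_space A q" "w' \<in> cotangent_space A q" "c \<in> A" "q \<in> chart_dom c" "w c = w' c"
  shows "w = w'"
proof
  fix d
  show "w d = w' d"
  proof (cases "d \<in> A \<and> q \<in> chart_dom d")
    case True
    then show ?thesis
      using cotangent_law[OF assms(1), of d c] cotangent_law[OF assms(2), of d c] assms(3-5) by simp
  next
    case False
    then have "w d = 0" "w' d = 0" using assms(1,2) unfolding cotangent_space_def by blast+
    then show ?thesis by simp
  qed
qed

lemma tangent_exists:
  assumes "c \<in> A" "q \<in> chart_dom c"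
  shows "\<exists>X\<in>tangent_space A q. X c = v"
proof -
  define X where "X d = (if d \<in> A \<and> q \<in> chart_dom d then jacobian c d q *v v else 0)" for d
  have "X e $ j = (jacobian d e q *v X d) $ j"
    if "d \<in> A" "e \<in> A" "q \<in> chart_dom d" "q \<in> chart_dom e" for d e j
    using that jacobian_cocycle[of c d e q] assms
    by (simp add: X_def matrix_vector_mul_assoc)
  moreover have "X c = v" using assms by (simp add: X_def jacobian_self)
  moreover have "\<forall>d. d \<notin> A \<or> q \<notin> chart_dom d \<longrightarrow> X d = 0" by (auto simp: X_def)
  ultimately have "X \<in> tangent_space A q"
    unfolding tangent_space_def mem_Collect_eq matrix_vector_mult_def vec_lambda_beta by blast
  then show ?thesis using \<open>X c = v\<close> by blast
qed

lemma tangent_eqI: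
  assumes "X \<in> tangent_space A q" "X' \<in> tangent_space A q" "c \<in> A" "q \<in> chart_dom c" "X c = X' c"
  shows "X = X'"
proof
  fix d
  show "X d = X' d"
  proof (cases "d \<in> A \<and> q \<in> chart_dom d")
    case True
    then show ?thesis
      using tangent_law[OF assms(1), of c d] tangent_law[OF assms(2), of c d] assms(3-5) by simp
  next
    case False
    then have "X d = 0" "X' d = 0" using assms(1,2) unfolding tangent_space_def by blast+
    then show ?thesis by simp
  qed
qed

text \<open>Vectors transform with the Jacobian and covectors with its transpose, which passes from
  one factor of the inner product to the other; the chart chosen in the definition therefore does
  not matter.\<close>

lemma contraction_eq:
  assumes "w \<in> cotangent_space A q" "X \<in> tangent_space A q" "c \<in> A" "q \<in> chart_dom c"
  shows "contraction A q w X = X c \<bullet> w c"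
proof -
  define d where "d = (SOME c. c \<in> A \<and> q \<in> chart_dom c)"
  have d: "d \<in> A" "q \<in> chart_dom d"
    using someI_ex[of "\<lambda>c. c \<in> A \<and> q \<in> chart_dom c"] chart_covers[of q] by (auto simp: d_def)
  have "X c = jacobian d c q *v X d"
    using tangent_law assms d by blast
  moreover have "w d = transpose (jacobian d c q) *v w c"
    using cotangent_law assms d by blast
  ultimately have "X d \<bullet> w d = X c \<bullet> w c"
    by (simp add: inner_commute[of "X d"] dot_lmul_matrix inner_commute[of "w c"])
  then show ?thesis
    by (simp add: contraction_def d_def[symmetric] Let_def inner_vec_def)
qed

text \<open>Serves both bundles. It rests on two facts only: an element of the fibre over
  \<open>q\<close> is determined by its components in \<open>c\<close>, and these can be prescribed
  at will.\<close>

lemma bundle_chart: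
  fixes E :: "'m \<Rightarrow> ('m, 'n) components set"
  assumes c: "c \<in> A"
    and ex: "\<And>q p. q \<in> chart_dom c \<Longrightarrow> \<exists>w\<in>E q. w c = p"
    and uniq: "\<And>q w w'. q \<in> chart_dom c \<Longrightarrow> w \<in> E q \<Longrightarrow> w' \<in> E q \<Longrightarrow> w c = w' c \<Longrightarrow> w = w'"
  defines "C \<equiv> ({z \<in> Sigma UNIV E. fst z \<in> chart_dom c}, \<lambda>z. (chart_map c (fst z), snd z c))"
  shows "chart_image C = chart_image c \<times> UNIV"
    and "\<And>z. z \<in> Sigma UNIV E \<Longrightarrow> fst z \<in> chart_dom c \<Longrightarrow> chart_inv C (chart_map c (fst z), snd z c) = z"
    and "\<And>x p. x \<in> chart_image c \<Longrightarrow> chart_inv C (x, p) \<in> Sigma UNIV E \<and>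
        fst (chart_inv C (x, p)) = chart_inv c x \<and> snd (chart_inv C (x, p)) c = p"
proof -
  have dom: "chart_dom C = {z \<in> Sigma UNIV E. fst z \<in> chart_dom c}"
    and map: "chart_map C = (\<lambda>z. (chart_map c (fst z), snd z c))"
    by (simp_all add: C_def chart_dom_def chart_map_def)
  have pre: "\<exists>z\<in>chart_dom C. chart_map C z = (x, p) \<and> fst z = chart_inv c x" if x: "x \<in> chart_image c" for x p
  proof -
    obtain w where "w \<in> E (chart_inv c x)" "w c = p"
      using ex[OF chart_inv_in[OF x]] by blast
    then show ?thesis
      using chart_map_inv[OF c x] chart_inv_in[OF x]
      by (intro bexI[of _ "(chart_inv c x, w)"]) (simp_all add: dom map)
  qed
  have inj: "inj_on (chart_map C) (chart_dom C)"
  proof (rule inj_onI)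
    fix z z' assume z: "z \<in> chart_dom C" "z' \<in> chart_dom C" "chart_map C z = chart_map C z'"
    then have "fst z = fst z'" using chart_inv_map[OF c] unfolding dom map by (metis (no_types, lifting) mem_Collect_eq prod.inject)
    then show "z = z'" using z uniq[of "fst z" "snd z" "snd z'"] unfolding dom map by (auto simp: prod_eq_iff)
  qed
  show 1: "chart_image C = chart_image c \<times> UNIV"
  proof
    show "chart_image C \<subseteq> chart_image c \<times> UNIV"
      by (auto simp: chart_image_def dom map)
    show "chart_image c \<times> UNIV \<subseteq> chart_image C"
      using pre unfolding chart_image_def[of C] by (auto simp: image_iff Bex_def) metis
  qed
  show 2: "chart_inv C (chart_map c (fst z), snd z c) = z" if "z \<in> Sigma UNIV E" "fst z \<in> chart_dom c" for z
    using inv_into_f_f[OF inj, of z] that by (simp add: chart_inv_def dom map)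
  show "chart_inv C (x, p) \<in> Sigma UNIV E \<and> fst (chart_inv C (x, p)) = chart_inv c x \<and>
        snd (chart_inv C (x, p)) c = p" if x: "x \<in> chart_image c" for x p
  proof -
    obtain z where "z \<in> Sigma UNIV E" "fst z \<in> chart_dom c" "(chart_map c (fst z), snd z c) = (x, p)" "fst z = chart_inv c x"
      using pre[OF x, of p] unfolding dom map by blast
    then show ?thesis using 2[of z] by auto
  qed
qed

lemma cotangent_chart:
  assumes "c \<in> A"
  shows "chart_image (cotangent_chart A c) = chart_image c \<times> UNIV"
    and "\<And>z. z \<in> cotangent_bundle A \<Longrightarrow> fst z \<in> chart_dom c \<Longrightarrow>
        chart_inv (cotangent_chart A c) (chart_map c (fst z), snd z c) = z"
    and "\<And>x p. x \<in> chart_image c \<Longrightarrow> chart_inv (cotangent_chart A c) (x, p) \<in> cotangent_bundle A \<and>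
        fst (chart_inv (cotangent_chart A c) (x, p)) = chart_inv c x \<and>
        snd (chart_inv (cotangent_chart A c) (x, p)) c = p"
  unfolding cotangent_chart_def cotangent_bundle_def
  by (rule bundle_chart[OF assms cotangent_exists[OF assms] cotangent_eqI[OF _ _ assms]]; assumption)+

lemma tangent_chart:
  assumes "c \<in> A"
  shows "chart_image (tangent_chart A c) = chart_image c \<times> UNIV"
    and "\<And>z. z \<in> tangent_bundle A \<Longrightarrow> fst z \<in> chart_dom c \<Longrightarrow>
        chart_inv (tangent_chart A c) (chart_map c (fst z), snd z c) = z"
    and "\<And>x v. x \<in> chart_image c \<Longrightarrow> chart_inv (tangent_chart A c) (x, v) \<in> tangent_bundle A \<and>
        fst (chart_inv (tangent_chart A c) (x, v)) = chart_inv c x \<and>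
        snd (chart_inv (tangent_chart A c) (x, v)) c = v"
  unfolding tangent_chart_def tangent_bundle_def
  by (rule bundle_chart[OF assms tangent_exists[OF assms] tangent_eqI[OF _ _ assms]]; assumption)+

lemma nonzero_covector_iff:
  assumes "(q, w) \<in> cotangent_bundle A" "c \<in> A" "q \<in> chart_dom c"
  shows "w = (\<lambda>c. 0) \<longleftrightarrow> w c = 0"
proof
  assume "w c = 0"
  have "(\<lambda>c. 0) \<in> cotangent_space A q" by (simp add: cotangent_space_def)
  then show "w = (\<lambda>c. 0)"
    using cotangent_eqI[of w q "\<lambda>c. 0"] assms \<open>w c = 0\<close> by (auto simp: cotangent_bundle_def)
qed simp

lemma additional_normality_equations_in_charts:
  "additional_normality_equations A L Q G \<longleftrightarrow>
    (\<forall>c\<in>A. \<forall>x\<in>chart_image c. \<forall>p. p \<noteq> 0 \<longrightarrow>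
      first_normality_equations (G c) (H_in A L c) (Omega_in A L c) (Q_in A Q c) (x, p) \<and>
      second_normality_equations (H_in A L c) (Omega_in A L c) (Q_in A Q c) (x, p))"
    (is "?lhs \<longleftrightarrow> (\<forall>c\<in>A. \<forall>x\<in>chart_image c. \<forall>p. p \<noteq> 0 \<longrightarrow> ?P c x p)")
proof
  assume lhs: ?lhs
  show "\<forall>c\<in>A. \<forall>x\<in>chart_image c. \<forall>p. p \<noteq> 0 \<longrightarrow> ?P c x p"
  proof (intro ballI allI impI)
    fix c x p assume c: "c \<in> A" "x \<in> chart_image c" "(p::real^'n) \<noteq> 0"
    obtain w where w: "w \<in> cotangent_space A (chart_inv c x)" "w c = p"
      using cotangent_exists c(1) chart_inv_in[OF c(2)] by blast
    then have "(chart_inv c x, w) \<in> cotangent_bundle A" "w \<noteq> (\<lambda>c. 0)" using c by (auto simp: cotangent_bundle_def)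
    with lhs have "?P c (chart_map c (chart_inv c x)) (w c)"
      using c(1) chart_inv_in[OF c(2)] unfolding additional_normality_equations_def by blast
    then show "?P c x p" using w chart_map_inv c by simp
  qed
next
  assume "\<forall>c\<in>A. \<forall>x\<in>chart_image c. \<forall>p. p \<noteq> 0 \<longrightarrow> ?P c x p"
  then show ?lhs
    unfolding additional_normality_equations_def using nonzero_covector_iff chart_map_in by fast
qed

end

section \<open>The Hamilton function in a chart\<close>

lemma frechet_derivative_partials:
  fixes f :: "(real^'n) \<times> (real^'n) \<Rightarrow> real"
  assumes "(f has_derivative frechet_derivative f (at z)) (at z)"
  shows "frechet_derivative f (at z) (a, b) = (\<Sum>i\<in>UNIV. a $ i * d_base i f z) + (\<Sum>i\<in>UNIV. b $ i * d_fibre i f z)"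
proof -
  let ?D = "frechet_derivative f (at z)"
  have lin: "linear ?D" using assms by (rule has_derivative_linear)
  have "(a, b) = (\<Sum>i\<in>UNIV. a $ i *\<^sub>R (axis i 1, 0)) + (\<Sum>i\<in>UNIV. b $ i *\<^sub>R (0, axis i 1))"
    by (simp add: prod_eq_iff fst_sum snd_sum scalar_mult_eq_scaleR[symmetric] basis_expansion)
  then have "?D (a, b) = ?D ((\<Sum>i\<in>UNIV. a $ i *\<^sub>R (axis i 1, 0)) + (\<Sum>i\<in>UNIV. b $ i *\<^sub>R (0, axis i 1)))" by simp
  also have "\<dots> = (\<Sum>i\<in>UNIV. a $ i * ?D (axis i 1, 0)) + (\<Sum>i\<in>UNIV. b $ i * ?D (0, axis i 1))"
    using linear_cmul[OF lin] by (simp add: linear_add[OF lin] linear_sum[OF lin] del: scaleR_Pair)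
  finally show ?thesis by (simp add: d_base_def d_fibre_def)
qed

lemma smooth_on_d_fibre: "smooth_on S f \<Longrightarrow> smooth_on S (d_fibre i f)"
  unfolding d_fibre_def[abs_def] by (rule smooth_on_frechet)

lemma smooth_on_d_base: "smooth_on S f \<Longrightarrow> smooth_on S (d_base i f)"
  unfolding d_base_def[abs_def] by (rule smooth_on_frechet)

text \<open>Along the i-th axis the fibre derivative has the sign of the parameter, so by continuity
  it vanishes at 0. Thus the Legendre map sends zero vectors to zero covectors; consequently a
  nonzero momentum has a nonzero velocity, which is where regularity makes \<Omega>
  positive.\<close>

lemma positive_radial_derivative_imp_zero_covector:
  fixes l :: "(real^'n) \<times> (real^'n) \<Rightarrow> real"
  assumes "open D" "smooth_on (D \<times> UNIV) l" "x \<in> D"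
    and pos: "\<And>v. v \<noteq> 0 \<Longrightarrow> (\<Sum>i\<in>UNIV. v $ i * d_fibre i l (x, v)) > 0"
  shows "d_fibre i l (x, 0) = 0"
proof -
  define \<phi> where "\<phi> t = d_fibre i l (x, t *\<^sub>R axis i 1)" for t :: real
  have "continuous_on UNIV \<phi>"
    unfolding \<phi>_def using assms(3)
    by (intro continuous_on_compose2[OF smooth_on_continuous_on[OF smooth_on_d_fibre[OF assms(2)]]] continuous_intros) auto
  then have cont: "isCont \<phi> 0" by (simp add: continuous_on_eq_continuous_at)
  have "t * \<phi> t > 0" if "t \<noteq> 0" for t
  proof -
    have "(\<Sum>j\<in>UNIV. (t *\<^sub>R axis i 1 :: real^'n) $ j * d_fibre j l (x, t *\<^sub>R axis i 1)) = t * \<phi> t"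
      by (simp add: \<phi>_def axis_def if_distrib[of "\<lambda>a. _ * a"] if_distrib[of "\<lambda>a. a * _"] cong: if_cong)
    then show ?thesis using pos[of "t *\<^sub>R axis i 1"] that by (simp add: axis_eq_0_iff)
  qed
  then have sgn: "\<phi> t > 0" if "t > 0" for t using that by (metis less_numeral_extra(3) zero_less_mult_pos)
  have sgn': "\<phi> t < 0" if "t < 0" for t using \<open>\<And>t. t \<noteq> 0 \<Longrightarrow> t * \<phi> t > 0\<close>[of t] that by (simp add: zero_less_mult_iff)
  have "\<phi> 0 \<ge> 0"
  proof (rule tendsto_lowerbound)
    show "(\<phi> \<longlongrightarrow> \<phi> 0) (at_right 0)" using cont by (simp add: isCont_def filterlim_at_split)
    show "\<forall>\<^sub>F t in at_right 0. 0 \<le> \<phi> t"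
      using sgn by (auto simp: eventually_at_filter intro!: always_eventually less_imp_le)
  qed simp
  moreover have "\<phi> 0 \<le> 0"
  proof (rule tendsto_upperbound)
    show "(\<phi> \<longlongrightarrow> \<phi> 0) (at_left 0)" using cont by (simp add: isCont_def filterlim_at_split)
    show "\<forall>\<^sub>F t in at_left 0. \<phi> t \<le> 0"
      using sgn' by (auto simp: eventually_at_filter intro!: always_eventually less_imp_le)
  qed simp
  ultimately show ?thesis by (simp add: \<phi>_def)
qed

text \<open>The terms with the derivative of \<open>V\<close> cancel, because the fibre derivative
  of \<open>l\<close> at \<open>V\<close> is the momentum itself.\<close>

lemma legendre_dual:
  fixes l H :: "(real^'n) \<times> (real^'n) \<Rightarrow> real" and V :: "(real^'n) \<times> (real^'n) \<Rightarrow> real^'n"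
  assumes D: "open D" and l: "smooth_on (D \<times> UNIV) l" and V: "smooth_on (D \<times> UNIV) V"
    and lV: "\<And>x p i. x \<in> D \<Longrightarrow> d_fibre i l (x, V (x, p)) = p $ i"
    and H: "\<And>x p. x \<in> D \<Longrightarrow> H (x, p) = V (x, p) \<bullet> p - l (x, V (x, p))"
  shows "smooth_on (D \<times> UNIV) H" and "\<And>x p i. x \<in> D \<Longrightarrow> d_fibre i H (x, p) = V (x, p) $ i"
proof -
  let ?S = "D \<times> (UNIV :: (real^'n) set)"
  have S: "open ?S" using D by (simp add: open_Times)
  have xV: "smooth_on ?S (\<lambda>z. (fst z, V z))"
    by (rule smooth_on_Pair[OF S smooth_on_fst[OF S smooth_on_ident] V])
  have H': "H z = V z \<bullet> snd z - l (fst z, V z)" if "z \<in> ?S" for z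
    using H[of "fst z" "snd z"] that by auto
  have "smooth_on ?S (\<lambda>z. l (fst z, V z))" by (rule smooth_on_compose[OF S S _ l xV]) auto
  then have "smooth_on ?S (\<lambda>z. V z \<bullet> snd z - l (fst z, V z))"
    by (intro smooth_on_diff smooth_on_inner V smooth_on_snd smooth_on_ident S)
  then show "smooth_on ?S H"
    by (rule smooth_on_cong[OF S, rotated]) (simp add: H')
  fix x :: "real^'n" and p :: "real^'n" and i assume x: "x \<in> D"
  define z where "z = (x, p)"
  have z: "z \<in> ?S" using x by (simp add: z_def)
  let ?V = "frechet_derivative V (at z)" and ?l = "frechet_derivative l (at (x, V z))"
  have dV: "(V has_derivative ?V) (at z)" by (rule smooth_on_has_derivative[OF V z])
  have dl: "(l has_derivative ?l) (at (x, V z))" using x by (intro smooth_on_has_derivative[OF l]) simp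
  have d1: "((\<lambda>z. (fst z, V z)) has_derivative (\<lambda>h. (fst h, ?V h))) (at z)"
    by (intro has_derivative_Pair dV) (auto intro!: derivative_eq_intros)
  have "((\<lambda>z. l (fst z, V z)) has_derivative (\<lambda>h. ?l (fst h, ?V h))) (at z)"
    using has_derivative_compose[OF d1, of l ?l] dl by (simp add: z_def)
  moreover have "((\<lambda>z. V z \<bullet> snd z) has_derivative (\<lambda>h. V z \<bullet> snd h + ?V h \<bullet> snd z)) (at z)"
    using dV by (auto intro!: derivative_eq_intros)
  ultimately have "((\<lambda>z. V z \<bullet> snd z - l (fst z, V z)) has_derivative
      (\<lambda>h. V z \<bullet> snd h + ?V h \<bullet> snd z - ?l (fst h, ?V h))) (at z)"
    by (intro has_derivative_diff)
  then have "(H has_derivative (\<lambda>h. V z \<bullet> snd h + ?V h \<bullet> snd z - ?l (fst h, ?V h))) (at z)"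
    by (rule has_derivative_transform_within_open[OF _ S z]) (simp add: H')
  then have "d_fibre i H z = V z \<bullet> axis i 1 + ?V (0, axis i 1) \<bullet> p - ?l (0, ?V (0, axis i 1))"
    by (simp add: d_fibre_def frechet_derivative_at[symmetric] z_def)
  also have "?l (0, ?V (0, axis i 1)) = ?V (0, axis i 1) \<bullet> p"
    using frechet_derivative_partials[OF dl] lV[OF x, of _ p] by (simp add: inner_vec_def z_def)
  finally show "d_fibre i H (x, p) = V (x, p) $ i" by (simp add: z_def inner_axis)
qed

theorem hamiltonian_in_chart:
  fixes A :: "('m::topological_space, real^'n) chart set"
  assumes atlas: "smooth_atlas A" and c: "c \<in> A" and L: "smooth_lagrangian A L" and reg: "regular_lagrangian A L"
  shows "smooth_on (chart_image c \<times> UNIV) (H_in A L c)"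
    and "\<And>x p. x \<in> chart_image c \<Longrightarrow> Omega_in A L c (x, p) = (\<Sum>i\<in>UNIV. p $ i * d_fibre i (H_in A L c) (x, p))"
    and "\<And>x p. x \<in> chart_image c \<Longrightarrow> p \<noteq> 0 \<Longrightarrow> Omega_in A L c (x, p) > 0"
proof -
  let ?D = "chart_image c" and ?T = "tangent_chart A c" and ?C = "cotangent_chart A c"
  note co = cotangent_chart[OF atlas c] and ta = tangent_chart[OF atlas c]
  define l where "l = L \<circ> chart_inv ?T"
  define \<eta> where "\<eta> z = legendre_inv A L (chart_inv ?C z)" for z
  define V where "V z = snd (\<eta> z) c" for z
  have diff: "diffeomorphism (tangent_chart A ` A) (tangent_bundle A) (cotangent_chart A ` A) (cotangent_bundle A) (legendre A L)"
    using reg by (simp add: regular_lagrangian_def)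
  then have bij: "bij_betw (legendre A L) (tangent_bundle A) (cotangent_bundle A)"
    and sm: "smooth_map (cotangent_chart A ` A) (cotangent_bundle A) (tangent_chart A ` A) (tangent_bundle A) (legendre_inv A L)"
    by (simp_all add: diffeomorphism_def legendre_inv_def)
  have \<eta>: "\<eta> (x, p) \<in> tangent_bundle A" "legendre A L (\<eta> (x, p)) = chart_inv ?C (x, p)" "fst (\<eta> (x, p)) = chart_inv c x"
    if "x \<in> ?D" for x p
  proof -
    have in_co: "chart_inv ?C (x, p) \<in> cotangent_bundle A" using co(3)[OF that] by blast
    show "\<eta> (x, p) \<in> tangent_bundle A"
      using bij_betw_inv_into[OF bij] in_co unfolding \<eta>_def legendre_inv_def by (rule bij_betw_apply)
    show *: "legendre A L (\<eta> (x, p)) = chart_inv ?C (x, p)"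
      unfolding \<eta>_def legendre_inv_def by (rule bij_betw_inv_into_right[OF bij in_co])
    have "fst (legendre A L (\<eta> (x, p))) = fst (\<eta> (x, p))" by (simp add: legendre_def)
    with * have "fst (\<eta> (x, p)) = fst (chart_inv ?C (x, p))" by simp
    then show "fst (\<eta> (x, p)) = chart_inv c x" using co(3)[OF that] by simp
  qed
  have \<eta>V: "chart_inv ?T (x, V (x, p)) = \<eta> (x, p)" if "x \<in> ?D" for x p
    using ta(2)[OF \<eta>(1)[OF that]] \<eta>(3)[OF that] chart_map_inv[OF atlas c that] chart_inv_in[OF that]
    by (simp add: V_def)
  have leg: "snd (legendre A L (chart_inv ?T (x, v))) c $ i = d_fibre i l (x, v)" if "x \<in> ?D" for x v i
    using ta(3)[OF that] c chart_inv_in[OF that] chart_map_inv[OF atlas c that]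
    by (simp add: legendre_def l_def)
  have Om: "Omega_TM A L (chart_inv ?T (x, v)) = (\<Sum>i\<in>UNIV. v $ i * d_fibre i l (x, v))" if x: "x \<in> ?D" for x v
  proof -
    let ?z = "chart_inv ?T (x, v)"
    have z: "?z \<in> tangent_bundle A" "fst ?z = chart_inv c x" "snd ?z c = v" using ta(3)[OF x] by auto
    then have "legendre A L ?z \<in> cotangent_bundle A" using bij bij_betw_apply by metis
    moreover have "fst (legendre A L ?z) = chart_inv c x" using z by (simp add: legendre_def)
    ultimately have "snd (legendre A L ?z) \<in> cotangent_space A (chart_inv c x)"
      by (auto simp: cotangent_bundle_def)
    moreover have "snd ?z \<in> tangent_space A (chart_inv c x)" using z by (auto simp: tangent_bundle_def)
    ultimately have "Omega_TM A L ?z = snd ?z c \<bullet> snd (legendre A L ?z) c"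
      using contraction_eq[OF atlas _ _ c chart_inv_in[OF x]] z(2) by (simp add: Omega_TM_def)
    then show ?thesis using leg[OF x] z(3) by (simp add: inner_vec_def)
  qed
  have l: "smooth_on (?D \<times> UNIV) l"
    using L c unfolding ta(1)[symmetric] smooth_lagrangian_def l_def by blast
  have V: "smooth_on (?D \<times> UNIV) V"
  proof -
    \<comment> \<open>\<open>smooth_map\<close> gives smoothness only where the image lies in the
      domain of \<open>?T\<close>. The Legendre map preserves base points, so this is everything
      over the chart.\<close>
    let ?S = "{z \<in> cotangent_bundle A \<inter> chart_dom ?C. legendre_inv A L z \<in> chart_dom ?T}"
    have cm: "chart_map ?C w = (chart_map c (fst w), snd w c)" for w
      by (simp add: cotangent_chart_def chart_map_def)
    have all: "chart_map ?C ` ?S = ?D \<times> UNIV"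
    proof
      show "chart_map ?C ` ?S \<subseteq> ?D \<times> UNIV" using co(1) by (auto simp: chart_image_def)
      show "?D \<times> UNIV \<subseteq> chart_map ?C ` ?S"
      proof
        fix z assume z: "z \<in> ?D \<times> (UNIV :: (real^'n) set)"
        obtain x p where xp: "z = (x, p)" "x \<in> ?D" using z by auto
        have "chart_inv ?C z \<in> ?S"
          using co(3)[OF xp(2), of p] \<eta>(1,3)[OF xp(2), of p] chart_inv_in[OF xp(2)] xp
          by (auto simp: cotangent_chart_def tangent_chart_def chart_dom_def \<eta>_def)
        moreover have "chart_map ?C (chart_inv ?C z) = z"
          using co(3)[OF xp(2), of p] xp chart_map_inv[OF atlas c xp(2)] cm by simp
        ultimately show "z \<in> chart_map ?C ` ?S" by force
      qed
    qed
    have "smooth_on (chart_map ?C ` ?S) (chart_map ?T \<circ> legendre_inv A L \<circ> chart_inv ?C)"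
      using sm c unfolding smooth_map_def Let_def by blast
    then have *: "smooth_on (?D \<times> UNIV) (chart_map ?T \<circ> legendre_inv A L \<circ> chart_inv ?C)" unfolding all .
    have "open (?D \<times> (UNIV :: (real^'n) set))"
      using chart_homeomorphism(2)[OF atlas c] by (simp add: open_Times)
    from smooth_on_snd[OF this *] show ?thesis
      by (simp add: chart_map_def tangent_chart_def V_def[abs_def] \<eta>_def)
  qed
  have lV: "d_fibre i l (x, V (x, p)) = p $ i" if "x \<in> ?D" for x p i
    using leg[OF that, of "V (x, p)" i] \<eta>V[OF that] \<eta>(2)[OF that] co(3)[OF that] by simp
  have Om_in: "Omega_in A L c (x, p) = V (x, p) \<bullet> p" if "x \<in> ?D" for x p
    using Om[OF that, of "V (x, p)"] \<eta>V[OF that, of p] lV[OF that]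
    by (simp add: Omega_in_def Omega_def \<eta>_def inner_vec_def)
  have H: "H_in A L c (x, p) = V (x, p) \<bullet> p - l (x, V (x, p))" if "x \<in> ?D" for x p
    using Om_in[OF that, of p] \<eta>V[OF that, of p] by (simp add: H_in_def hamiltonian_def l_def Omega_in_def Omega_def \<eta>_def)
  note dual = legendre_dual[OF chart_homeomorphism(2)[OF atlas c] l V lV H]
  show "smooth_on (?D \<times> UNIV) (H_in A L c)" by (rule dual(1))
  fix x :: "real^'n" and p :: "real^'n" assume x: "x \<in> ?D"
  show "Omega_in A L c (x, p) = (\<Sum>i\<in>UNIV. p $ i * d_fibre i (H_in A L c) (x, p))"
  proof -
    have "d_fibre i (H_in A L c) (x, p) = V (x, p) $ i" for i
      by (rule dual(2)) (simp_all add: x)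
    then show ?thesis using Om_in[OF x] by (simp add: inner_vec_def mult.commute)
  qed
  have pos: "(\<Sum>i\<in>UNIV. v $ i * d_fibre i l (x, v)) > 0" if "v \<noteq> 0" for v
  proof -
    let ?z = "chart_inv ?T (x, v)"
    have "?z \<in> nonzero_tangent_bundle A"
      using ta(3)[OF x, of v] that by (auto simp: nonzero_tangent_bundle_def)
    then have "Omega_TM A L ?z > 0" using reg by (simp add: regular_lagrangian_def)
    then show ?thesis using Om[OF x] by simp
  qed
  assume "p \<noteq> 0"
  have "V (x, p) \<noteq> 0"
  proof
    assume "V (x, p) = 0"
    then have "p $ i = 0" for i
      using lV[OF x, of i p] positive_radial_derivative_imp_zero_covector[OF chart_homeomorphism(2)[OF atlas c] l x pos] by simp
    with \<open>p \<noteq> 0\<close> show False by (simp add: vec_eq_iff)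
  qed
  from pos[OF this] show "Omega_in A L c (x, p) > 0"
    using lV[OF x] Om_in[OF x] by (simp add: inner_vec_def)
qed

section \<open>The normality equations at a point\<close>

text \<open>At a point of the cotangent bundle, \<open>h\<close> and \<open>v\<close> stand for \<open>\<partial>H/\<partial>x\<close> and \<open>\<partial>H/\<partial>p\<close>, \<open>m\<close> and \<open>r\<close> for
  \<open>p\<^sub>k \<partial>\<^sup>2H/\<partial>p\<^sub>k\<partial>x\<close> and \<open>p\<^sub>k \<partial>\<^sup>2H/\<partial>p\<^sub>k\<partial>p\<close>, \<open>f\<close>, \<open>X\<close>, \<open>Y\<close> for \<open>Q\<close> and its derivatives along \<open>x\<close>
  and \<open>p\<close>, and \<open>N\<close>, \<open>S\<close> for the contractions of \<open>\<Gamma>\<close> with \<open>p\<close> and \<open>Q\<close>. The integrability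
  condition on a hypersurface is the symmetry of \<open>curv u \<pi> w\<close>, where \<open>u\<close> and \<open>w\<close> are tangent vectors
  and \<open>\<pi>\<close> is the derivative of the momentum along \<open>u\<close>; \<open>base\<close> is what remains of \<open>curv\<close> after
  removing the contribution of the second fundamental form.\<close>

locale normality_algebra =
  fixes p v h m r f :: "real^'n" and X Y N S :: "real^'n^'n" and W :: real
  assumes pv: "p \<bullet> v = W" and W: "W \<noteq> 0" and N: "transpose N = N" and S: "transpose S = S"
begin

definition proj :: "real^'n \<Rightarrow> real^'n" where
  "proj u = u - ((p \<bullet> u) / W) *\<^sub>R v"

definition B :: "real^'n \<Rightarrow> real^'n" where
  "B w = ((f \<bullet> w) / W) *\<^sub>R r + transpose Y *v w"

definition base :: "real^'n \<Rightarrow> real^'n \<Rightarrow> real" where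
  "base u w = ((m - h) \<bullet> u) * (f \<bullet> w) / W + w \<bullet> (X *v u) + (p \<bullet> B w) * (f \<bullet> u - (h \<bullet> u) / W)"

definition curv :: "real^'n \<Rightarrow> real^'n \<Rightarrow> real^'n \<Rightarrow> real" where
  "curv u \<pi> w = ((m - h) \<bullet> u + r \<bullet> \<pi>) * (f \<bullet> w) / W + w \<bullet> (X *v u) + w \<bullet> (Y *v \<pi>)"

text \<open>The bilinear form with coefficients \<open>A_coeff\<close>, the index \<open>s\<close>
  contracted with \<open>u\<close> and \<open>r\<close> with \<open>w\<close>.\<close>

definition form :: "real^'n \<Rightarrow> real^'n \<Rightarrow> real" where
  "form u w = (f \<bullet> u) * ((p \<bullet> r) / W\<^sup>2 * ((h + N *v v) \<bullet> w) - ((m + N *v r + N *v v) \<bullet> w) / W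
      + ((h + N *v v) \<bullet> w) / W + (Y *v p) \<bullet> w)
    - u \<bullet> (X *v w) - u \<bullet> (Y *v (N *v w)) + u \<bullet> (S *v w) + ((h + N *v v) \<bullet> w) / W * (u \<bullet> (Y *v p))"

lemma N_inner: "(N *v a) \<bullet> b = a \<bullet> (N *v b)"
  by (metis N dot_lmul_matrix transpose_matrix_vector)

lemma S_inner: "a \<bullet> (S *v b) = b \<bullet> (S *v a)"
  by (metis S dot_lmul_matrix inner_commute transpose_matrix_vector)

lemma B_inner: "B w \<bullet> \<pi> = (f \<bullet> w) / W * (r \<bullet> \<pi>) + w \<bullet> (Y *v \<pi>)"
  by (simp add: B_def inner_add_left dot_lmul_matrix)

lemma p_proj: "p \<bullet> proj u = 0"
  using pv W by (simp add: proj_def inner_diff_right)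

lemma proj_id: "p \<bullet> u = 0 \<Longrightarrow> proj u = u"
  by (simp add: proj_def)

lemma proj_v: "proj v = 0"
  using pv W by (simp add: proj_def)

lemma linear_proj: "linear proj"
  by (rule linearI) (simp_all add: proj_def algebra_simps add_divide_distrib)

lemma linear_B: "linear B"
  by (rule linearI) (simp_all add: B_def algebra_simps add_divide_distrib vector_matrix_mult_add_rdistrib
     flip: transpose_matrix_vector add: matrix_vector_right_distrib matrix_vector_mult_scaleR del: transpose_matrix_vector)

text \<open>Up to terms symmetric in \<open>u\<close> and \<open>w\<close>, \<open>form u w\<close>
  is minus \<open>base w u\<close> and a single term with the connection: its contributions along
  \<open>r\<close> and through \<open>Y\<close> assemble \<open>B u\<close>, and those along
  \<open>v\<close> subtract the component of \<open>B u\<close> in direction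
  \<open>v\<close>.\<close>

lemma form_base:
  "form u w + base w u = (f \<bullet> u) * ((Y *v p) \<bullet> w) + (u \<bullet> (Y *v p)) * (f \<bullet> w) + (p \<bullet> r) / W * (f \<bullet> u) * (f \<bullet> w)
     + u \<bullet> (S *v w) - proj (B u) \<bullet> (N *v w)"
proof -
  have pB: "p \<bullet> B u = (f \<bullet> u) / W * (p \<bullet> r) + u \<bullet> (Y *v p)"
    using B_inner[of u p] by (simp add: inner_commute)
  have "proj (B u) \<bullet> (N *v w) = (f \<bullet> u) / W * (r \<bullet> (N *v w)) + u \<bullet> (Y *v (N *v w)) - (p \<bullet> B u) / W * (v \<bullet> (N *v w))"
    by (simp add: proj_def inner_diff_left B_inner)
  then show ?thesis
    unfolding form_def base_def inner_add_left inner_diff_left N_inner pB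
    by (simp add: divide_inverse power2_eq_square algebra_simps)
qed

text \<open>\<open>B w\<close> is the sum of \<open>proj (B w)\<close> and a multiple of
  \<open>v\<close>. The assumption prescribes \<pi> on \<open>v\<close>, which turns that multiple
  into the last term of \<open>base\<close>; what remains sees \<pi> on tangent vectors
  only.\<close>

lemma curv_base:
  assumes "v \<bullet> \<pi> = W * (f \<bullet> u) - h \<bullet> u"
  shows "curv u \<pi> w = base u w + proj (B w) \<bullet> \<pi>"
proof -
  have "proj (B w) \<bullet> \<pi> = B w \<bullet> \<pi> - (p \<bullet> B w) / W * (v \<bullet> \<pi>)"
    by (simp add: proj_def inner_diff_left)
  then show ?thesis
    unfolding curv_def base_def assms B_inner using W by (simp add: field_simps)
qed

lemma form_symmetric_iff_base_symmetric:
  assumes "\<And>u. p \<bullet> u = 0 \<Longrightarrow> proj (B u) = \<kappa> *\<^sub>R u"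
  shows "(\<forall>u w. p \<bullet> u = 0 \<longrightarrow> p \<bullet> w = 0 \<longrightarrow> form u w = form w u) \<longleftrightarrow>
    (\<forall>u w. p \<bullet> u = 0 \<longrightarrow> p \<bullet> w = 0 \<longrightarrow> base u w = base w u)"
proof -
  have "form u w - form w u = base u w - base w u" if "p \<bullet> u = 0" "p \<bullet> w = 0" for u w
  proof -
    have "proj (B u) \<bullet> (N *v w) = proj (B w) \<bullet> (N *v u)"
      using assms that N_inner[of w u] by (simp add: inner_commute)
    then show ?thesis
      using form_base[of u w] form_base[of w u] S_inner[of u w] by (simp add: inner_commute algebra_simps)
  qed
  then show ?thesis by (metis eq_iff_diff_eq_0)
qed

text \<open>By the first assumption \<open>proj (B w) \<bullet> \<pi>\<close> is \<kappa> times the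
  second fundamental form, which is symmetric.\<close>

lemma curv_symmetric:
  assumes "\<And>u. p \<bullet> u = 0 \<Longrightarrow> proj (B u) = \<kappa> *\<^sub>R u"
    and "\<And>u w. p \<bullet> u = 0 \<Longrightarrow> p \<bullet> w = 0 \<Longrightarrow> base u w = base w u"
    and "p \<bullet> u = 0" "p \<bullet> w = 0" "\<pi> \<bullet> w = \<rho> \<bullet> u"
    and "v \<bullet> \<pi> = W * (f \<bullet> u) - h \<bullet> u" "v \<bullet> \<rho> = W * (f \<bullet> w) - h \<bullet> w"
  shows "curv u \<pi> w = curv w \<rho> u"
  using assms by (simp add: curv_base inner_commute)

text \<open>Hypersurfaces whose second fundamental form is \<open>c \<otimes> c\<close> suffice to test integrability.\<close>

lemma curv_symmetric_imp:
  fixes \<tau> :: "'a::real_inner \<Rightarrow> real^'n"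
  assumes \<tau>: "range \<tau> = {u. p \<bullet> u = 0}" and iso: "\<And>a b. \<tau> a \<bullet> \<tau> b = a \<bullet> b"
    and hyp: "\<And>c. \<exists>\<pi>. (\<forall>a b. \<pi> a \<bullet> \<tau> b = (c \<bullet> a) * (c \<bullet> b)) \<and> (\<forall>a. v \<bullet> \<pi> a = W * (f \<bullet> \<tau> a) - h \<bullet> \<tau> a) \<and>
        (\<forall>a b. curv (\<tau> a) (\<pi> a) (\<tau> b) = curv (\<tau> b) (\<pi> b) (\<tau> a))"
  shows "\<exists>\<kappa>. \<forall>u. p \<bullet> u = 0 \<longrightarrow> proj (B u) = \<kappa> *\<^sub>R u"
    and "\<And>u w. p \<bullet> u = 0 \<Longrightarrow> p \<bullet> w = 0 \<Longrightarrow> base u w = base w u"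
proof -
  have "\<exists>b. proj (B (\<tau> a)) = \<tau> b" for a
    using p_proj \<tau> by (metis (mono_tags, lifting) mem_Collect_eq rangeE)
  \<comment> \<open>\<open>M\<close> is P B carried to the parameter space by the isometry \<tau>;
    it has to be shown to be a scalar.\<close>
  then obtain M where M: "\<And>a. proj (B (\<tau> a)) = \<tau> (M a)" by metis
  have key: "base (\<tau> a) (\<tau> b) + (c \<bullet> a) * (c \<bullet> M b) = base (\<tau> b) (\<tau> a) + (c \<bullet> b) * (c \<bullet> M a)" for a b c
  proof -
    obtain \<pi> where \<pi>: "\<And>a b. \<pi> a \<bullet> \<tau> b = (c \<bullet> a) * (c \<bullet> b)" "\<And>a. v \<bullet> \<pi> a = W * (f \<bullet> \<tau> a) - h \<bullet> \<tau> a"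
      "\<And>a b. curv (\<tau> a) (\<pi> a) (\<tau> b) = curv (\<tau> b) (\<pi> b) (\<tau> a)"
      using hyp[of c] by auto
    have "curv (\<tau> a) (\<pi> a) (\<tau> b) = base (\<tau> a) (\<tau> b) + (c \<bullet> a) * (c \<bullet> M b)" for a b
      using curv_base[OF \<pi>(2)] \<pi>(1) M by (simp add: inner_commute)
    then show ?thesis using \<pi>(3)[of a b] by simp
  qed
  have base_\<tau>: "base (\<tau> a) (\<tau> b) = base (\<tau> b) (\<tau> a)" for a b
    using key[of a b 0] by simp
  then show "base u w = base w u" if "p \<bullet> u = 0" "p \<bullet> w = 0" for u w
    using that \<tau> by (metis (mono_tags, lifting) mem_Collect_eq rangeE)
  \<comment> \<open>The form c = 0 has isolated \<open>base\<close>; what is left is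
    self-adjointness of \<open>M\<close> with respect to c \<otimes> c.\<close>
  have M2: "(c \<bullet> a) * (c \<bullet> M b) = (c \<bullet> b) * (c \<bullet> M a)" for a b c
    using key[of a b c] base_\<tau>[of a b] by simp
  define \<mu> where "\<mu> a = (a \<bullet> M a) / (a \<bullet> a)" for a
  have M_eq: "M a = \<mu> a *\<^sub>R a" if "a \<noteq> 0" for a
  proof -
    \<comment> \<open>The part of \<open>M a\<close> orthogonal to \<open>a\<close> is used as the
      test covector: then \<open>M2\<close> leaves (c \<bullet> c) * (c \<bullet> M a) = 0, and c
      \<bullet> M a = c \<bullet> c.\<close>
    define c where "c = M a - \<mu> a *\<^sub>R a"
    have ca: "c \<bullet> a = 0" using that by (simp add: c_def \<mu>_def inner_diff_left inner_commute[of "M a"])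
    have "(c \<bullet> a) * (c \<bullet> M c) = (c \<bullet> c) * (c \<bullet> M a)" by (rule M2)
    with ca have "(c \<bullet> c) * (c \<bullet> M a) = 0" by simp
    then have "c \<bullet> c = 0 \<or> c \<bullet> (M a - \<mu> a *\<^sub>R a) = 0" using ca by (simp add: inner_diff_right)
    then show ?thesis by (simp add: c_def)
  qed
  have \<mu>_eq: "\<mu> a = \<mu> c" if "c \<bullet> a \<noteq> 0" for a c
  proof -
    have "a \<noteq> 0" "c \<noteq> 0" using that by auto
    then show ?thesis using M2[of c a c] M_eq[of a] M_eq[of c] that by simp
  qed
  have \<mu>_const: "\<mu> a = \<mu> c" if "a \<noteq> 0" "c \<noteq> 0" for a c
  proof (cases "c \<bullet> a = 0")
    case True
    \<comment> \<open>Orthogonal vectors are compared through their sum, which is orthogonal to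
      neither of them.\<close>
    have "\<mu> a = \<mu> (a + c)" "\<mu> c = \<mu> (a + c)"
      using that True by (intro \<mu>_eq; simp add: inner_add_left inner_add_right inner_commute)+
    then show ?thesis by simp
  qed (rule \<mu>_eq)
  have "\<exists>\<kappa>. \<forall>a. a \<noteq> 0 \<longrightarrow> M a = \<kappa> *\<^sub>R a"
  proof (cases "\<exists>a::'a. a \<noteq> 0")
    case True
    then obtain a0 :: 'a where "a0 \<noteq> 0" by blast
    then have "M a = \<mu> a0 *\<^sub>R a" if "a \<noteq> 0" for a
      using M_eq[OF that] \<mu>_const[OF that \<open>a0 \<noteq> 0\<close>] by simp
    then show ?thesis by blast
  qed simp
  then obtain \<kappa> where \<kappa>: "\<And>a. a \<noteq> 0 \<Longrightarrow> M a = \<kappa> *\<^sub>R a" by blast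
  have "proj (B u) = \<kappa> *\<^sub>R u" if u: "p \<bullet> u = 0" for u
  proof (cases "u = 0")
    case True
    then show ?thesis by (simp add: linear_0[OF linear_B] linear_0[OF linear_proj])
  next
    case False
    obtain a where a: "u = \<tau> a" using \<tau> u by blast
    \<comment> \<open>Linearity of \<tau> is not among the assumptions; homogeneity follows from the
      preservation of inner products.\<close>
    have "norm (\<tau> (\<kappa> *\<^sub>R a) - \<kappa> *\<^sub>R \<tau> a) ^ 2 = 0"
      by (simp add: power2_norm_eq_inner inner_diff_left inner_diff_right iso)
    moreover have "a \<noteq> 0" using False a iso[of a a] by auto
    ultimately show ?thesis using M[of a] \<kappa>[of a] a by simp
  qed
  then show "\<exists>\<kappa>. \<forall>u. p \<bullet> u = 0 \<longrightarrow> proj (B u) = \<kappa> *\<^sub>R u" by blast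
qed

text \<open>B P differs from \<kappa> P by a map into the line of \<open>v\<close>, and the trace of
  that map is a multiple of p \<bullet> B (P v) = 0. The trace of \<open>P\<close> is n - 1 because
  p \<bullet> v = W.\<close>

lemma proj_B_trace:
  assumes "\<And>u. p \<bullet> u = 0 \<Longrightarrow> proj (B u) = \<kappa> *\<^sub>R u"
  shows "(\<Sum>i\<in>UNIV. B (proj (axis i 1)) $ i) = \<kappa> * (real CARD('n) - 1)"
proof -
  let ?e = "\<lambda>i. axis i 1 :: real^'n"
  have BP: "B (proj u) = \<kappa> *\<^sub>R proj u + ((p \<bullet> B (proj u)) / W) *\<^sub>R v" for u
    using assms[OF p_proj, of u] by (simp add: proj_def[of "B _"] algebra_simps)
  have lin: "linear (\<lambda>u. p \<bullet> B (proj u))"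
    using linear_compose[OF linear_compose[OF linear_proj linear_B] bounded_linear.linear[OF bounded_linear_inner_right[of p]]] by (simp add: o_def)
  have "(\<Sum>i\<in>UNIV. (p \<bullet> B (proj (?e i))) * v $ i) = p \<bullet> B (proj (\<Sum>i\<in>UNIV. v $ i *\<^sub>R ?e i))"
    by (simp add: linear_sum[OF lin] linear_cmul[OF lin] mult.commute)
  also have "(\<Sum>i\<in>UNIV. v $ i *\<^sub>R ?e i) = v"
    by (simp add: scalar_mult_eq_scaleR[symmetric] basis_expansion)
  finally have 1: "(\<Sum>i\<in>UNIV. (p \<bullet> B (proj (?e i))) * v $ i) = 0"
    by (simp add: proj_v linear_0[OF linear_B])
  have "proj (?e i) $ i = 1 - p $ i * v $ i / W" for i
    by (simp add: proj_def inner_axis)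
  then have "(\<Sum>i\<in>UNIV. proj (?e i) $ i) = real CARD('n) - (\<Sum>i\<in>UNIV. p $ i * v $ i) / W"
    by (simp add: sum_subtractf sum_divide_distrib)
  also have "\<dots> = real CARD('n) - 1" using pv W by (simp add: inner_vec_def)
  finally have 2: "(\<Sum>i\<in>UNIV. proj (?e i) $ i) = real CARD('n) - 1" .
  have "(\<Sum>i\<in>UNIV. B (proj (?e i)) $ i) = (\<Sum>i\<in>UNIV. \<kappa> * proj (?e i) $ i + (p \<bullet> B (proj (?e i))) * v $ i / W)"
    by (subst BP) simp
  also have "\<dots> = \<kappa> * (\<Sum>i\<in>UNIV. proj (?e i) $ i) + (\<Sum>i\<in>UNIV. (p \<bullet> B (proj (?e i))) * v $ i) / W"
    by (simp add: sum.distrib sum_distrib_left sum_divide_distrib)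
  finally show ?thesis using 1 2 by simp
qed

end

section \<open>From index expressions at a point to vectors and matrices\<close>

definition grad_base :: "((real^'n) \<times> (real^'n) \<Rightarrow> real) \<Rightarrow> (real^'n) \<times> (real^'n) \<Rightarrow> real^'n" where
  "grad_base F z = (\<chi> i. d_base i F z)"

definition grad_fibre :: "((real^'n) \<times> (real^'n) \<Rightarrow> real) \<Rightarrow> (real^'n) \<times> (real^'n) \<Rightarrow> real^'n" where
  "grad_fibre F z = (\<chi> i. d_fibre i F z)"

definition p_grad_base :: "((real^'n) \<times> (real^'n) \<Rightarrow> real) \<Rightarrow> (real^'n) \<times> (real^'n) \<Rightarrow> real^'n" where
  "p_grad_base H z = (\<chi> a. \<Sum>k\<in>UNIV. snd z $ k * d_base a (d_fibre k H) z)"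

definition p_upper :: "((real^'n) \<times> (real^'n) \<Rightarrow> real) \<Rightarrow> (real^'n) \<times> (real^'n) \<Rightarrow> real^'n" where
  "p_upper H z = (\<chi> q. p_up H q z)"

definition covector :: "('n \<Rightarrow> (real^'n) \<times> (real^'n) \<Rightarrow> real) \<Rightarrow> (real^'n) \<times> (real^'n) \<Rightarrow> real^'n" where
  "covector Q z = (\<chi> s. Q s z)"

definition jac_base :: "('n \<Rightarrow> (real^'n) \<times> (real^'n) \<Rightarrow> real) \<Rightarrow> (real^'n) \<times> (real^'n) \<Rightarrow> real^'n^'n" where
  "jac_base Q z = (\<chi> s a. d_base a (Q s) z)"

definition jac_fibre :: "('n \<Rightarrow> (real^'n) \<times> (real^'n) \<Rightarrow> real) \<Rightarrow> (real^'n) \<times> (real^'n) \<Rightarrow> real^'n^'n" where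
  "jac_fibre Q z = (\<chi> s a. d_fibre a (Q s) z)"

definition p_connection :: "'n connection_components \<Rightarrow> (real^'n) \<times> (real^'n) \<Rightarrow> real^'n^'n" where
  "p_connection G z = (\<chi> r b. \<Sum>a\<in>UNIV. snd z $ a * G a r b z)"

definition Q_connection ::
  "'n connection_components \<Rightarrow> ('n \<Rightarrow> (real^'n) \<times> (real^'n) \<Rightarrow> real) \<Rightarrow> (real^'n) \<times> (real^'n) \<Rightarrow> real^'n^'n" where
  "Q_connection G Q z = (\<chi> s r. \<Sum>b\<in>UNIV. G b r s z * Q b z)"

lemmas gradient_defs = grad_base_def grad_fibre_def p_grad_base_def p_upper_def covector_def
  jac_base_def jac_fibre_def p_connection_def Q_connection_def

text \<open>All connection terms are absorbed by \<open>N\<close> and \<open>S\<close>. The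
  covariant derivative of H is \<open>h + N *v v\<close>; that of \<partial>H/\<partial>p,
  contracted with \<open>p\<close>, is \<open>m + N *v r + N *v v\<close>, where the last summand
  stems from the vector index.\<close>

lemma A_coeff_eq:
  fixes H :: "(real^'n) \<times> (real^'n) \<Rightarrow> real" and Q :: "'n \<Rightarrow> (real^'n) \<times> (real^'n) \<Rightarrow> real"
    and G :: "'n connection_components" and z
  defines "p \<equiv> snd z" and "v \<equiv> grad_fibre H z" and "h \<equiv> grad_base H z" and "m \<equiv> p_grad_base H z"
    and "r \<equiv> p_upper H z" and "f \<equiv> covector Q z" and "X \<equiv> jac_base Q z" and "Y \<equiv> jac_fibre Q z"
    and "N \<equiv> p_connection G z" and "S \<equiv> Q_connection G Q z"
  shows "A_coeff G H W Q i j z =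
    f $ i * ((p \<bullet> r) / (W z)\<^sup>2 * (h + N *v v) $ j - (m + N *v r + N *v v) $ j / W z + (h + N *v v) $ j / W z + (Y *v p) $ j)
    - X $ i $ j - (\<Sum>b\<in>UNIV. N $ j $ b * Y $ i $ b) + S $ i $ j + (h + N *v v) $ j / W z * (Y *v p) $ i"
proof -
  have 1: "p_norm2 H z = p \<bullet> r"
    by (simp add: p_norm2_def p_def r_def gradient_defs p_up_def inner_vec_def sum_distrib_left mult_ac)
  have 2: "nabla_scalar G j H z = (h + N *v v) $ j"
    by (simp add: nabla_scalar_def nabla_def h_def N_def v_def gradient_defs matrix_vector_mult_def sum_distrib_right) (rule sum.swap)
  have 3: "(\<Sum>q\<in>UNIV. p $ q * nabla_vector G j (\<lambda>i. d_fibre i H) q z) = (m + N *v r + N *v v) $ j"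
  proof -
    have "nabla_vector G j (\<lambda>i. d_fibre i H) q z = d_base j (d_fibre q H) z
        + (\<Sum>b\<in>UNIV. N $ j $ b * g_up H b q z) + (\<Sum>a\<in>UNIV. G q j a z * d_fibre a H z)" for q
      by (simp add: nabla_vector_def nabla_def N_def g_up_def gradient_defs sum_distrib_right) (rule sum.swap)
    then have "(\<Sum>q\<in>UNIV. p $ q * nabla_vector G j (\<lambda>i. d_fibre i H) q z) = m $ j
        + (\<Sum>q\<in>UNIV. \<Sum>b\<in>UNIV. N $ j $ b * (g_up H b q z * p $ q)) + (\<Sum>q\<in>UNIV. \<Sum>a\<in>UNIV. p $ q * G q j a z * v $ a)"
      by (simp add: algebra_simps sum.distrib sum_distrib_left m_def p_def v_def gradient_defs)
    also have "(\<Sum>q\<in>UNIV. \<Sum>b\<in>UNIV. N $ j $ b * (g_up H b q z * p $ q)) = (N *v r) $ j"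
      by (subst sum.swap) (simp add: matrix_vector_mult_def r_def p_def p_upper_def p_up_def sum_distrib_left)
    also have "(\<Sum>q\<in>UNIV. \<Sum>a\<in>UNIV. p $ q * G q j a z * v $ a) = (N *v v) $ j"
      by (subst sum.swap) (simp add: matrix_vector_mult_def N_def p_def p_connection_def sum_distrib_right)
    finally show ?thesis by simp
  qed
  have 4: "nabla_covector G j Q i z = X $ i $ j + (\<Sum>b\<in>UNIV. N $ j $ b * Y $ i $ b) - S $ i $ j"
    by (simp add: nabla_covector_def nabla_def X_def Y_def N_def S_def gradient_defs sum_distrib_right) (rule sum.swap)
  have 5: "(\<Sum>q\<in>UNIV. p $ q * x * d_fibre q (Q k) z) = x * (Y *v p) $ k" for x k
    by (simp add: Y_def gradient_defs matrix_vector_mult_def sum_distrib_left mult_ac)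
  have 6: "(\<Sum>q\<in>UNIV. p $ q * (nabla_vector G j (\<lambda>i. d_fibre i H) q z / W z) * Q i z) = (m + N *v r + N *v v) $ j / W z * f $ i"
    unfolding 3[symmetric] by (simp add: f_def gradient_defs sum_divide_distrib sum_distrib_right)
  have 7: "Q k z = f $ k" for k by (simp add: f_def covector_def)
  show ?thesis
    unfolding A_coeff_def p_def[symmetric] 1 2 4 6 5 unfolding 7
    by (simp add: algebra_simps)
qed

lemma bilinear_symmetric_axis:
  fixes \<Phi> :: "real^'k \<Rightarrow> real^'k \<Rightarrow> real"
  assumes lin: "\<And>w. linear (\<lambda>u. \<Phi> u w)" "\<And>u. linear (\<Phi> u)"
    and sym: "\<And>i j. \<Phi> (axis i 1) (axis j 1) = \<Phi> (axis j 1) (axis i 1)"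
  shows "\<Phi> u w = \<Phi> w u"
proof -
  have ex: "u = (\<Sum>i\<in>UNIV. u $ i *\<^sub>R axis i 1)" for u :: "real^'k"
    by (simp add: scalar_mult_eq_scaleR[symmetric] basis_expansion)
  have expand: "\<Phi> u w = (\<Sum>i\<in>UNIV. \<Sum>j\<in>UNIV. u $ i * w $ j * \<Phi> (axis i 1) (axis j 1))" for u w
  proof -
    have "\<Phi> u w = (\<Sum>i\<in>UNIV. u $ i * \<Phi> (axis i 1) w)"
      by (subst ex[of u]) (simp add: linear_sum[OF lin(1)] linear_cmul[OF lin(1)])
    moreover have "\<Phi> (axis i 1) w = (\<Sum>j\<in>UNIV. w $ j * \<Phi> (axis i 1) (axis j 1))" for i
      by (subst ex[of w]) (simp add: linear_sum[OF lin(2)] linear_cmul[OF lin(2)])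
    ultimately show ?thesis by (simp add: sum_distrib_left mult.assoc)
  qed
  have "\<Phi> u w = (\<Sum>j\<in>UNIV. \<Sum>i\<in>UNIV. u $ i * w $ j * \<Phi> (axis i 1) (axis j 1))"
    unfolding expand[of u w] by (rule sum.swap)
  also have "\<dots> = (\<Sum>j\<in>UNIV. \<Sum>i\<in>UNIV. w $ j * u $ i * \<Phi> (axis j 1) (axis i 1))"
    using sym by (intro sum.cong refl) (metis mult.commute)
  finally show ?thesis unfolding expand[of w u] .
qed

text \<open>The connection enters \<open>form\<close> alone; \<open>proj\<close>, \<open>B\<close>,
  \<open>base\<close> and \<open>curv\<close> are free of it. Arguments about hypersurfaces can
  therefore instantiate the locale with the zero connection.\<close>

locale momentum_point =
  fixes H W :: "(real^'n) \<times> (real^'n) \<Rightarrow> real" and Q :: "'n \<Rightarrow> (real^'n) \<times> (real^'n) \<Rightarrow> real"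
    and G :: "'n connection_components" and z :: "(real^'n) \<times> (real^'n)"
  assumes W_eq: "W z = (\<Sum>i\<in>UNIV. snd z $ i * d_fibre i H z)" and W_nz: "W z \<noteq> 0"
    and G_sym: "\<And>k i j. G k i j z = G k j i z"
begin

sublocale normality_algebra "snd z" "grad_fibre H z" "grad_base H z" "p_grad_base H z" "p_upper H z"
  "covector Q z" "jac_base Q z" "jac_fibre Q z" "p_connection G z" "Q_connection G Q z" "W z"
proof
  show "snd z \<bullet> grad_fibre H z = W z" by (simp add: W_eq inner_vec_def grad_fibre_def)
  show "transpose (p_connection G z) = p_connection G z" "transpose (Q_connection G Q z) = Q_connection G Q z"
    using G_sym by (simp_all add: transpose_def p_connection_def Q_connection_def vec_eq_iff)
qed (rule W_nz)

lemma A_coeff_form: "(\<Sum>s\<in>UNIV. \<Sum>r\<in>UNIV. A_coeff G H W Q s r z * u $ s * w $ r) = form u w"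
proof -
  let ?p = "snd z" and ?v = "grad_fibre H z" and ?h = "grad_base H z" and ?m = "p_grad_base H z"
    and ?r = "p_upper H z" and ?f = "covector Q z" and ?X = "jac_base Q z" and ?Y = "jac_fibre Q z"
    and ?N = "p_connection G z" and ?S = "Q_connection G Q z" and ?w = "W z"
  \<comment> \<open>\<gamma> is \<nabla>H/\<Omega>, and \<alpha> gathers every factor that
    accompanies Q_s with free index \<open>r\<close>.\<close>
  define \<gamma> where "\<gamma> = (1 / ?w) *\<^sub>R (?h + ?N *v ?v)"
  define \<alpha> where "\<alpha> = ((?p \<bullet> ?r) / ?w\<^sup>2) *\<^sub>R (?h + ?N *v ?v) - (1 / ?w) *\<^sub>R (?m + ?N *v ?r + ?N *v ?v) + \<gamma> + ?Y *v ?p"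
  have A: "A_coeff G H W Q s r z = ?f $ s * \<alpha> $ r - ?X $ s $ r - (\<Sum>b\<in>UNIV. ?N $ r $ b * ?Y $ s $ b) + ?S $ s $ r + \<gamma> $ r * (?Y *v ?p) $ s" for s r
    unfolding A_coeff_eq by (simp add: \<alpha>_def \<gamma>_def)
  have row: "(\<Sum>r\<in>UNIV. A_coeff G H W Q s r z * w $ r) =
    (?f $ s * (\<alpha> \<bullet> w) - (?X *v w) $ s - (?Y *v (?N *v w)) $ s + (?S *v w) $ s + (\<gamma> \<bullet> w) * (?Y *v ?p) $ s)" for s
  proof -
    have "(\<Sum>r\<in>UNIV. (\<Sum>b\<in>UNIV. ?N $ r $ b * ?Y $ s $ b) * w $ r) = (\<Sum>b\<in>UNIV. ?Y $ s $ b * (\<Sum>r\<in>UNIV. ?N $ b $ r * w $ r))"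
    proof -
      have "transpose ?N $ r $ b = ?N $ b $ r" for r b by (simp add: transpose_def)
      then have sym: "?N $ r $ b = ?N $ b $ r" for r b using N by simp
      have "(\<Sum>r\<in>UNIV. (\<Sum>b\<in>UNIV. ?N $ r $ b * ?Y $ s $ b) * w $ r) = (\<Sum>r\<in>UNIV. \<Sum>b\<in>UNIV. ?Y $ s $ b * (?N $ b $ r * w $ r))"
        unfolding sum_distrib_right by (intro sum.cong refl) (subst sym, simp)
      also have "\<dots> = (\<Sum>b\<in>UNIV. \<Sum>r\<in>UNIV. ?Y $ s $ b * (?N $ b $ r * w $ r))" by (rule sum.swap)
      finally show ?thesis by (simp add: sum_distrib_left)
    qed
    then have "(\<Sum>r\<in>UNIV. (\<Sum>b\<in>UNIV. ?N $ r $ b * ?Y $ s $ b) * w $ r) = (?Y *v (?N *v w)) $ s"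
      by (simp add: matrix_vector_mult_def)
    moreover have "(\<Sum>r\<in>UNIV. ?f $ s * \<alpha> $ r * w $ r) = ?f $ s * (\<alpha> \<bullet> w)"
      by (simp add: inner_vec_def sum_distrib_left mult.assoc)
    moreover have "(\<Sum>r\<in>UNIV. \<gamma> $ r * (?Y *v ?p) $ s * w $ r) = (\<gamma> \<bullet> w) * (?Y *v ?p) $ s"
      unfolding inner_vec_def sum_distrib_right by (simp add: mult.assoc mult.commute[of "w $ _"])
    ultimately show ?thesis
      unfolding A left_diff_distrib distrib_right sum.distrib sum_subtractf
      by (simp add: matrix_vector_mult_def)
  qed
  have "(\<Sum>s\<in>UNIV. \<Sum>r\<in>UNIV. A_coeff G H W Q s r z * u $ s * w $ r) = (\<Sum>s\<in>UNIV. u $ s * (\<Sum>r\<in>UNIV. A_coeff G H W Q s r z * w $ r))"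
    by (simp add: sum_distrib_left mult_ac)
  also have "\<dots> = u \<bullet> ((\<alpha> \<bullet> w) *\<^sub>R ?f - ?X *v w - ?Y *v (?N *v w) + ?S *v w + (\<gamma> \<bullet> w) *\<^sub>R (?Y *v ?p))"
    unfolding row inner_vec_def[of u] by (simp add: mult.commute[of _ "\<alpha> \<bullet> w"])
  also have "\<dots> = form u w"
    by (simp add: form_def \<alpha>_def \<gamma>_def inner_add_left inner_add_right inner_diff_right inner_diff_left inner_commute[of ?f])
  finally show ?thesis .
qed

lemma P_proj_eq: "P_proj H W r s z = proj (axis s 1) $ r"
  unfolding proj_def inner_axis by (simp add: P_proj_def grad_fibre_def axis_def)

lemma proj_sum: "(\<Sum>q\<in>UNIV. P_proj H W r q z * u $ q) = proj u $ r"
proof -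
  have "(\<Sum>q\<in>UNIV. P_proj H W r q z * u $ q) = (\<Sum>q\<in>UNIV. (if r = q then u $ q else 0) - grad_fibre H z $ r / W z * (snd z $ q * u $ q))"
    by (rule sum.cong) (auto simp: P_proj_def grad_fibre_def algebra_simps)
  also have "\<dots> = proj u $ r"
    unfolding sum_subtractf sum_distrib_left[symmetric] by (simp add: proj_def inner_vec_def)
  finally show ?thesis .
qed

lemma B_sum: "(\<Sum>k\<in>UNIV. (p_up H q z * (Q k z / W z) + d_fibre q (Q k) z) * u $ k) = B u $ q"
  unfolding B_def by (simp add: gradient_defs inner_vec_def vector_matrix_mult_def distrib_left sum.distrib sum_distrib_left
      sum_distrib_right sum_divide_distrib mult_ac)

text \<open>Contraction with \<open>P\<close> inserts the vectors \<open>proj (axis i 1)\<close>.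
  They span the annihilator of \<open>p\<close>, on which \<open>proj\<close> is the identity, so
  bilinearity extends the symmetry to all tangent vectors.\<close>

lemma first_normality_equations_iff:
  "first_normality_equations G H W Q z \<longleftrightarrow>
    (\<forall>u w. snd z \<bullet> u = 0 \<longrightarrow> snd z \<bullet> w = 0 \<longrightarrow> form u w = form w u)" (is "_ \<longleftrightarrow> ?rhs")
proof -
  let ?e = "\<lambda>i. proj (axis i 1)"
  have "first_normality_equations G H W Q z \<longleftrightarrow> (\<forall>i j. form (?e i) (?e j) = form (?e j) (?e i))"
  proof -
    have "(\<Sum>s\<in>UNIV. \<Sum>r\<in>UNIV. A_coeff G H W Q r s z * ?e i $ s * ?e j $ r) = form (?e j) (?e i)" for i j
      unfolding A_coeff_form[symmetric] by (subst sum.swap) (simp add: mult_ac)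
    then show ?thesis unfolding first_normality_equations_def P_proj_eq A_coeff_form by simp
  qed
  also have "\<dots> \<longleftrightarrow> ?rhs"
  proof
    assume sym: "\<forall>i j. form (?e i) (?e j) = form (?e j) (?e i)"
    have lin: "linear (\<lambda>u. form u w)" "linear (\<lambda>u. form w u)" for w
      by (rule linearI; simp add: A_coeff_form[symmetric] algebra_simps sum.distrib sum_distrib_left)+
    have "form (proj u) (proj w) = form (proj w) (proj u)" for u w
      using bilinear_symmetric_axis[of "\<lambda>u w. form (proj u) (proj w)"]
        linear_compose[OF linear_proj lin(1)] linear_compose[OF linear_proj lin(2)] sym
      by (simp add: o_def)
    then show ?rhs using proj_id by metis
  next
    assume ?rhs
    then show "\<forall>i j. form (?e i) (?e j) = form (?e j) (?e i)" using p_proj by blast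
  qed
  finally show ?thesis .
qed

text \<open>The left-hand sides are the entries of P B P, the right-hand sides those of t P, where
  \<open>t\<close> is the trace of B P divided by n - 1. If P B acts on the annihilator as a scalar,
  the trace formula forces that scalar to be \<open>t\<close>.\<close>

lemma second_normality_equations_iff:
  assumes "CARD('n) \<ge> 2"
  shows "second_normality_equations H W Q z \<longleftrightarrow> (\<exists>\<kappa>. \<forall>u. snd z \<bullet> u = 0 \<longrightarrow> proj (B u) = \<kappa> *\<^sub>R u)"
proof -
  let ?b = "\<lambda>q k. p_up H q z * (Q k z / W z) + d_fibre q (Q k) z"
  let ?e = "\<lambda>i. axis i 1 :: real^'n"
  define t where "t = (\<Sum>i\<in>UNIV. B (proj (?e i)) $ i) / (real CARD('n) - 1)"
  have lhs: "(\<Sum>k\<in>UNIV. \<Sum>q\<in>UNIV. P_proj H W r q z * ?b q k * P_proj H W k s z) = proj (B (proj (?e s))) $ r" for r s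
    by (subst sum.swap) (simp add: P_proj_eq[of _ s] proj_sum[symmetric] B_sum[symmetric] sum_distrib_left mult.assoc)
  have rhs: "(\<Sum>k\<in>UNIV. \<Sum>q\<in>UNIV. ?b q k * (P_proj H W k q z * P_proj H W r s z / (real CARD('n) - 1))) = t * proj (?e s) $ r" for r s
    by (subst sum.swap) (simp add: P_proj_eq t_def B_sum[symmetric] sum_distrib_right sum_divide_distrib mult.assoc)
  have "second_normality_equations H W Q z \<longleftrightarrow> (\<forall>s. proj (B (proj (?e s))) = t *\<^sub>R proj (?e s))"
    unfolding second_normality_equations_def lhs rhs by (auto simp: vec_eq_iff)
  also have "\<dots> \<longleftrightarrow> (\<exists>\<kappa>. \<forall>u. snd z \<bullet> u = 0 \<longrightarrow> proj (B u) = \<kappa> *\<^sub>R u)"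
  proof
    assume eq: "\<forall>s. proj (B (proj (?e s))) = t *\<^sub>R proj (?e s)"
    have lin: "linear (\<lambda>u. proj (B (proj u)))"
      using linear_compose[OF linear_compose[OF linear_proj linear_B] linear_proj] by (simp add: o_def)
    have "proj (B (proj u)) = t *\<^sub>R proj u" for u
    proof -
      have ex: "u = (\<Sum>i\<in>UNIV. u $ i *\<^sub>R ?e i)"
        by (simp add: scalar_mult_eq_scaleR[symmetric] basis_expansion)
      have "proj (B (proj u)) = (\<Sum>i\<in>UNIV. u $ i *\<^sub>R proj (B (proj (?e i))))"
        by (subst ex) (simp add: linear_sum[OF lin] linear_cmul[OF lin])
      also have "\<dots> = t *\<^sub>R (\<Sum>i\<in>UNIV. u $ i *\<^sub>R proj (?e i))" using eq by (simp add: scaleR_sum_right mult.commute)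
      also have "(\<Sum>i\<in>UNIV. u $ i *\<^sub>R proj (?e i)) = proj u"
        by (subst (2) ex) (simp add: linear_sum[OF linear_proj] linear_cmul[OF linear_proj])
      finally show ?thesis .
    qed
    then show "\<exists>\<kappa>. \<forall>u. snd z \<bullet> u = 0 \<longrightarrow> proj (B u) = \<kappa> *\<^sub>R u" using proj_id by metis
  next
    assume "\<exists>\<kappa>. \<forall>u. snd z \<bullet> u = 0 \<longrightarrow> proj (B u) = \<kappa> *\<^sub>R u"
    then obtain \<kappa> where \<kappa>: "\<And>u. snd z \<bullet> u = 0 \<Longrightarrow> proj (B u) = \<kappa> *\<^sub>R u" by blast
    have "t = \<kappa>" using proj_B_trace[OF \<kappa>] assms by (simp add: t_def)
    then show "\<forall>s. proj (B (proj (?e s))) = t *\<^sub>R proj (?e s)" using \<kappa> p_proj by blast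
  qed
  finally show ?thesis .
qed

lemma normality_equations_iff:
  assumes "CARD('n) \<ge> 2"
  shows "first_normality_equations G H W Q z \<and> second_normality_equations H W Q z \<longleftrightarrow>
    (\<exists>\<kappa>. \<forall>u. snd z \<bullet> u = 0 \<longrightarrow> proj (B u) = \<kappa> *\<^sub>R u) \<and>
    (\<forall>u w. snd z \<bullet> u = 0 \<longrightarrow> snd z \<bullet> w = 0 \<longrightarrow> base u w = base w u)"
  unfolding first_normality_equations_iff second_normality_equations_iff[OF assms]
  using form_symmetric_iff_base_symmetric by blast

end

section \<open>Compatibility of the Pfaff system\<close>

lemma d_coord_at: "(f has_derivative f') (at y) \<Longrightarrow> d_coord i f y = f' (axis i 1)"
  by (simp add: d_coord_def frechet_derivative_at[symmetric])

lemma smooth_on_d_coord: "smooth_on V f \<Longrightarrow> smooth_on V (d_coord i f)"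
  unfolding d_coord_def[abs_def] by (rule smooth_on_frechet)

text \<open>Functions that agree near \<open>y\<close> have the same derivatives there, hence the
  same chosen one; differentiability itself need not be known.\<close>

lemma d_coord_cong:
  assumes "open V" "y \<in> V" "\<And>y. y \<in> V \<Longrightarrow> f y = g y"
  shows "d_coord i f y = d_coord i g y"
proof -
  have "(f has_derivative D) (at y) \<longleftrightarrow> (g has_derivative D) (at y)" for D
    using has_derivative_transform_within_open[of f D y UNIV V g] has_derivative_transform_within_open[of g D y UNIV V f] assms
    by auto
  then show ?thesis by (simp add: d_coord_def frechet_derivative_def)
qed

lemma d_coord_vec_nth:
  assumes "smooth_on V f" "y \<in> V"
  shows "d_coord i (\<lambda>y. f y $ s) y = d_coord i f y $ s"
  using d_coord_at[OF bounded_linear.has_derivative[OF bounded_linear_vec_nth smooth_on_has_derivative[OF assms]]]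
  by (simp add: d_coord_def)

lemma d_coord_mult:
  fixes f g :: "real^'k \<Rightarrow> real"
  assumes "smooth_on V f" "smooth_on V g" "y \<in> V"
  shows "d_coord i (\<lambda>y. f y * g y) y = d_coord i f y * g y + f y * d_coord i g y"
  using d_coord_at[OF has_derivative_mult[OF smooth_on_has_derivative[OF assms(1,3)] smooth_on_has_derivative[OF assms(2,3)]]]
  by (simp add: d_coord_def)

lemma d_coord_add:
  assumes "smooth_on V f" "smooth_on V g" "y \<in> V"
  shows "d_coord i (\<lambda>y. f y + g y) y = d_coord i f y + d_coord i g y"
  using d_coord_at[OF has_derivative_add[OF smooth_on_has_derivative[OF assms(1,3)] smooth_on_has_derivative[OF assms(2,3)]]]
  by (simp add: d_coord_def)

lemma d_coord_diff:
  assumes "smooth_on V f" "smooth_on V g" "y \<in> V"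
  shows "d_coord i (\<lambda>y. f y - g y) y = d_coord i f y - d_coord i g y"
  using d_coord_at[OF has_derivative_diff[OF smooth_on_has_derivative[OF assms(1,3)] smooth_on_has_derivative[OF assms(2,3)]]]
  by (simp add: d_coord_def)

lemma d_coord_scaleR:
  fixes f :: "real^'k \<Rightarrow> real"
  assumes "smooth_on V f" "smooth_on V g" "y \<in> V"
  shows "d_coord i (\<lambda>y. f y *\<^sub>R g y) y = d_coord i f y *\<^sub>R g y + f y *\<^sub>R d_coord i g y"
  using d_coord_at[OF has_derivative_scaleR[OF smooth_on_has_derivative[OF assms(1,3)] smooth_on_has_derivative[OF assms(2,3)]]]
  by (simp add: d_coord_def)

lemma d_coord_inner:
  assumes "smooth_on V f" "smooth_on V g" "y \<in> V"
  shows "d_coord i (\<lambda>y. f y \<bullet> g y) y = d_coord i f y \<bullet> g y + f y \<bullet> d_coord i g y"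
  using d_coord_at[OF has_derivative_inner[OF smooth_on_has_derivative[OF assms(1,3)] smooth_on_has_derivative[OF assms(2,3)]]]
  by (simp add: d_coord_def)

lemma d_coord_symmetric:
  fixes f :: "real^'k \<Rightarrow> real"
  assumes "open V" "smooth_on V f" "y \<in> V"
  shows "d_coord i (d_coord j f) y = d_coord j (d_coord i f) y"
  using frechet_derivative_symmetric_real[OF assms] unfolding d_coord_def[abs_def] .

lemma d_coord_symmetric_vec:
  fixes f :: "real^'k \<Rightarrow> real^'n"
  assumes "open V" "smooth_on V f" "y \<in> V"
  shows "d_coord i (d_coord j f) y = d_coord j (d_coord i f) y"
proof -
  have "d_coord i (d_coord j f) y $ s = d_coord i (d_coord j (\<lambda>y. f y $ s)) y" for i j s
    using d_coord_vec_nth[OF smooth_on_d_coord[OF assms(2)] assms(3)]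
      d_coord_cong[OF assms(1,3), of "\<lambda>y. d_coord j f y $ s" "d_coord j (\<lambda>y. f y $ s)"]
      d_coord_vec_nth[OF assms(2)] by metis
  then show ?thesis
    using d_coord_symmetric[OF assms(1) smooth_on_vec_nth[OF assms(1,2)] assms(3)] by (simp add: vec_eq_iff)
qed

text \<open>The right-hand side as a function of the point and the value of \<nu> alone, the form in
  which the Frobenius theorem takes it.\<close>

definition pfaff_rhs ::
    "((real^'n) \<times> (real^'n) \<Rightarrow> real) \<Rightarrow> ((real^'n) \<times> (real^'n) \<Rightarrow> real) \<Rightarrow>
     ('n \<Rightarrow> (real^'n) \<times> (real^'n) \<Rightarrow> real) \<Rightarrow> (real^'k \<Rightarrow> real^'n) \<Rightarrow> (real^'k \<Rightarrow> real^'n) \<Rightarrow>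
     'k \<Rightarrow> (real^'k) \<times> real \<Rightarrow> real" where
  "pfaff_rhs H W Q x n i w =
     (let z = (x (fst w), snd w *\<^sub>R n (fst w)) in
       - ((snd w)\<^sup>2 / W z * (grad_fibre H z \<bullet> d_coord i n (fst w)))
       - snd w * ((grad_base H z \<bullet> d_coord i x (fst w)) / W z - covector Q z \<bullet> d_coord i x (fst w)))"

lemma pfaff_equation_iff: "pfaff_equation H W Q x n \<nu> i y \<longleftrightarrow> d_coord i \<nu> y = pfaff_rhs H W Q x n i (y, \<nu> y)"
  unfolding pfaff_equation_def pfaff_rhs_def Let_def
  by (simp add: gradient_defs inner_vec_def sum_distrib_left algebra_simps sum_subtractf sum_divide_distrib)

definition curvature ::
    "((real^'n) \<times> (real^'n) \<Rightarrow> real) \<Rightarrow> ((real^'n) \<times> (real^'n) \<Rightarrow> real) \<Rightarrow>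
     ('n \<Rightarrow> (real^'n) \<times> (real^'n) \<Rightarrow> real) \<Rightarrow> (real^'n) \<times> (real^'n) \<Rightarrow> real^'n \<Rightarrow> real^'n \<Rightarrow> real^'n \<Rightarrow> real" where
  "curvature H W Q z = normality_algebra.curv (grad_base H z) (p_grad_base H z) (p_upper H z)
     (covector Q z) (jac_base Q z) (jac_fibre Q z) (W z)"

locale local_dynamics =
  fixes D :: "(real^'n) set" and H W :: "(real^'n) \<times> (real^'n) \<Rightarrow> real"
    and Q :: "'n \<Rightarrow> (real^'n) \<times> (real^'n) \<Rightarrow> real"
  assumes D: "open D" and H: "smooth_on (D \<times> UNIV) H" and Q: "\<And>i. smooth_on (D \<times> UNIV) (Q i)"
    and W_eq: "\<And>x p. x \<in> D \<Longrightarrow> W (x, p) = (\<Sum>i\<in>UNIV. p $ i * d_fibre i H (x, p))"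
    and W_nz: "\<And>x p. x \<in> D \<Longrightarrow> p \<noteq> 0 \<Longrightarrow> W (x, p) \<noteq> 0"
begin

lemma open_phase: "open (D \<times> (UNIV :: (real^'n) set))"
  using D by (simp add: open_Times)

lemma smooth_gradients:
  "smooth_on (D \<times> UNIV) (grad_base H)" "smooth_on (D \<times> UNIV) (grad_fibre H)" "smooth_on (D \<times> UNIV) (covector Q)"
  unfolding grad_base_def[abs_def] grad_fibre_def[abs_def] covector_def[abs_def]
  by (intro smooth_on_vec_lambda open_phase smooth_on_d_base smooth_on_d_fibre H Q)+

lemma W_inner: "x \<in> D \<Longrightarrow> W (x, p) = p \<bullet> grad_fibre H (x, p)"
  by (simp add: W_eq inner_vec_def grad_fibre_def)

lemma smooth_W: "smooth_on (D \<times> UNIV) W"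
proof (rule smooth_on_cong[OF open_phase])
  show "smooth_on (D \<times> UNIV) (\<lambda>z. snd z \<bullet> grad_fibre H z)"
    by (intro smooth_on_inner open_phase smooth_on_snd smooth_on_ident smooth_gradients)
qed (auto simp: W_inner)

lemma momentum_pointI:
  assumes "x \<in> D" "p \<noteq> 0" "\<And>k i j. G k i j (x, p) = G k j i (x, p)"
  shows "momentum_point H W G (x, p)"
  by unfold_locales (use assms W_eq W_nz in auto)

end

locale hypersurface_patch = local_dynamics D H W Q
  for D :: "(real^'n) set" and H W :: "(real^'n) \<times> (real^'n) \<Rightarrow> real"
    and Q :: "'n \<Rightarrow> (real^'n) \<times> (real^'n) \<Rightarrow> real" +
  fixes U :: "(real^'k) set" and x n :: "real^'k \<Rightarrow> real^'n"
  assumes U: "open U" and x: "smooth_on U x" and n: "smooth_on U n" and xD: "x ` U \<subseteq> D"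
    and n_nz: "\<And>y. y \<in> U \<Longrightarrow> n y \<noteq> 0" and normal: "\<And>y i. y \<in> U \<Longrightarrow> n y \<bullet> d_coord i x y = 0"
begin

text \<open>The right-hand side divides by \<Omega>, which vanishes where the momentum is
  zero.\<close>

definition nonzero_patch :: "((real^'k) \<times> real) set" where
  "nonzero_patch = U \<times> (- {0})"

lemma open_nonzero_patch: "open nonzero_patch"
  unfolding nonzero_patch_def using U by (intro open_Times) auto

lemma smooth_pfaff_rhs: "smooth_on nonzero_patch (pfaff_rhs H W Q x n i)"
proof -
  let ?S = nonzero_patch
  note S = open_nonzero_patch
  have base: "smooth_on ?S (\<lambda>w. g (fst w))" if "smooth_on U g" for g :: "real^'k \<Rightarrow> real^'n"
    using that by (intro smooth_on_compose[OF S U _ _ smooth_on_fst[OF S smooth_on_ident]]) (auto simp: nonzero_patch_def)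
  have a: "smooth_on ?S snd" using smooth_on_snd[OF S smooth_on_ident] by simp
  define \<zeta> where "\<zeta> w = (x (fst w), snd w *\<^sub>R n (fst w))" for w :: "(real^'k) \<times> real"
  have \<zeta>: "smooth_on ?S \<zeta>"
    unfolding \<zeta>_def[abs_def] by (intro smooth_on_Pair S smooth_on_scaleR base x n a)
  have \<zeta>D: "\<zeta> ` ?S \<subseteq> D \<times> UNIV" using xD by (auto simp: \<zeta>_def nonzero_patch_def)
  have comp: "smooth_on ?S (\<lambda>w. F (\<zeta> w))" if "smooth_on (D \<times> UNIV) F" for F :: "(real^'n) \<times> (real^'n) \<Rightarrow> 'c::real_normed_vector"
    by (rule smooth_on_compose[OF S open_phase \<zeta>D that \<zeta>])
  have nz: "W (\<zeta> w) \<noteq> 0" if "w \<in> ?S" for w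
    using that xD n_nz W_nz by (auto simp: \<zeta>_def nonzero_patch_def)
  have "smooth_on ?S (\<lambda>w. - ((snd w * snd w) / W (\<zeta> w) * (grad_fibre H (\<zeta> w) \<bullet> d_coord i n (fst w)))
       - snd w * ((grad_base H (\<zeta> w) \<bullet> d_coord i x (fst w)) / W (\<zeta> w) - covector Q (\<zeta> w) \<bullet> d_coord i x (fst w)))"
    by (intro smooth_on_diff smooth_on_minus smooth_on_mult smooth_on_divide smooth_on_inner S a nz comp[OF smooth_W]
        comp[OF smooth_gradients(1)] comp[OF smooth_gradients(2)] comp[OF smooth_gradients(3)] base smooth_on_d_coord x n)
  then show ?thesis
    by (simp add: pfaff_rhs_def[abs_def] Let_def \<zeta>_def power2_eq_square)
qed

end

text \<open>\<nu> is any smooth function without zeros, not necessarily a solution, so that the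
  locale also applies to an affine function satisfying the equations at just one point.\<close>

locale momentum_section = hypersurface_patch D H W Q U x n
  for D :: "(real^'n) set" and H W :: "(real^'n) \<times> (real^'n) \<Rightarrow> real"
    and Q :: "'n \<Rightarrow> (real^'n) \<times> (real^'n) \<Rightarrow> real"
    and U :: "(real^'k) set" and x n :: "real^'k \<Rightarrow> real^'n" +
  fixes V and \<nu> :: "real^'k \<Rightarrow> real"
  assumes V: "open V" "V \<subseteq> U" and \<nu>: "smooth_on V \<nu>" and \<nu>_nz: "\<And>y. y \<in> V \<Longrightarrow> \<nu> y \<noteq> 0"
begin

definition lift :: "real^'k \<Rightarrow> (real^'n) \<times> (real^'n)" where
  "lift y = (x y, \<nu> y *\<^sub>R n y)"

definition dp :: "'k \<Rightarrow> real^'k \<Rightarrow> real^'n" where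
  "dp i y = d_coord i (\<lambda>y. \<nu> y *\<^sub>R n y) y"

abbreviation rhs :: "'k \<Rightarrow> real^'k \<Rightarrow> real" where
  "rhs i y \<equiv> pfaff_rhs H W Q x n i (y, \<nu> y)"

lemma smooth_patch: "smooth_on V x" "smooth_on V n"
  using x n V(2) smooth_on_subset by blast+

lemma smooth_p: "smooth_on V (\<lambda>y. \<nu> y *\<^sub>R n y)"
  by (intro smooth_on_scaleR V \<nu> smooth_patch)

lemma smooth_lift: "smooth_on V lift"
  unfolding lift_def[abs_def] by (intro smooth_on_Pair V smooth_patch smooth_p)

lemma lift_in: "lift ` V \<subseteq> D \<times> UNIV"
  using xD V(2) by (auto simp: lift_def)

lemma smooth_along:
  "smooth_on (D \<times> UNIV) F \<Longrightarrow> smooth_on V (\<lambda>y. F (lift y))"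
  by (rule smooth_on_compose[OF V(1) open_phase lift_in _ smooth_lift])

lemma smooth_rhs: "smooth_on V (rhs i)"
  using smooth_on_compose[OF V(1) open_nonzero_patch _ smooth_pfaff_rhs smooth_on_Pair[OF V(1) smooth_on_ident \<nu>]] \<nu>_nz V(2)
  by (auto simp: nonzero_patch_def)

lemma d_coord_along:
  assumes F: "smooth_on (D \<times> UNIV) F" and y: "y \<in> V"
  shows "d_coord i (\<lambda>y. F (lift y)) y = grad_base F (lift y) \<bullet> d_coord i x y + grad_fibre F (lift y) \<bullet> dp i y"
proof -
  let ?F = "frechet_derivative F (at (lift y))"
  have dF: "(F has_derivative ?F) (at (lift y))"
    using smooth_on_has_derivative[OF F] lift_in y by blast
  have "(lift has_derivative (\<lambda>h. (frechet_derivative x (at y) h, frechet_derivative (\<lambda>y. \<nu> y *\<^sub>R n y) (at y) h))) (at y)"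
    unfolding lift_def[abs_def]
    by (intro has_derivative_Pair smooth_on_has_derivative[OF smooth_patch(1) y] smooth_on_has_derivative[OF smooth_p y])
  from d_coord_at[OF has_derivative_compose[OF this dF]] show ?thesis
    by (simp add: frechet_derivative_partials[OF dF] d_coord_def dp_def grad_base_def grad_fibre_def inner_vec_def mult.commute)
qed

lemma dp_eq: "y \<in> V \<Longrightarrow> dp i y = d_coord i \<nu> y *\<^sub>R n y + \<nu> y *\<^sub>R d_coord i n y"
  unfolding dp_def by (rule d_coord_scaleR[OF \<nu> smooth_patch(2)])

lemma W_lift: "y \<in> V \<Longrightarrow> W (lift y) = \<nu> y * (grad_fibre H (lift y) \<bullet> n y)"
  using W_inner[of "x y" "\<nu> y *\<^sub>R n y"] lift_in by (auto simp: lift_def inner_commute)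

lemma W_lift_nz: "y \<in> V \<Longrightarrow> W (lift y) \<noteq> 0"
  using W_nz[of "x y" "\<nu> y *\<^sub>R n y"] xD V(2) n_nz \<nu>_nz by (auto simp: lift_def)

text \<open>The defect of the Pfaff equation is kept as an explicit term, because the identity will
  be differentiated at a point where the defect may vanish without vanishing nearby.\<close>

lemma d_coord_energy:
  assumes y: "y \<in> V"
  shows "d_coord i (\<lambda>y. H (lift y)) y =
    W (lift y) * (covector Q (lift y) \<bullet> d_coord i x y) + W (lift y) / \<nu> y * (d_coord i \<nu> y - rhs i y)"
proof -
  let ?z = "lift y"
  have "W ?z / \<nu> y * rhs i y = - (\<nu> y * (grad_fibre H ?z \<bullet> d_coord i n y))
      - (grad_base H ?z \<bullet> d_coord i x y - W ?z * (covector Q ?z \<bullet> d_coord i x y))"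
    using W_lift_nz[OF y] \<nu>_nz[OF y]
    by (simp add: pfaff_rhs_def Let_def lift_def[symmetric] field_simps power2_eq_square)
  moreover have "W ?z / \<nu> y * d_coord i \<nu> y = d_coord i \<nu> y * (grad_fibre H ?z \<bullet> n y)"
    using W_lift[OF y] \<nu>_nz[OF y] by simp
  ultimately show ?thesis
    by (simp add: d_coord_along[OF H y] dp_eq[OF y] inner_add_right right_diff_distrib)
qed

lemma momentum_point_lift: "y \<in> V \<Longrightarrow> momentum_point H W (\<lambda>_ _ _ _. 0) (lift y)"
  unfolding lift_def using xD V(2) n_nz \<nu>_nz by (intro momentum_pointI) auto

lemma tangent_normal: "y \<in> V \<Longrightarrow> snd (lift y) \<bullet> d_coord i x y = 0"
  using normal V(2) by (auto simp: lift_def)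

text \<open>Differentiating p \<bullet> \<partial>_j x = 0 along \<partial>_i shows that both sides
  are minus p contracted with the second derivative of \<open>x\<close>.\<close>

lemma second_form_symmetric:
  assumes y: "y \<in> V"
  shows "dp i y \<bullet> d_coord j x y = dp j y \<bullet> d_coord i x y"
proof -
  have "dp i y \<bullet> d_coord j x y + snd (lift y) \<bullet> d_coord i (d_coord j x) y = 0" for i j
  proof -
    have "d_coord i (\<lambda>y. (\<nu> y *\<^sub>R n y) \<bullet> d_coord j x y) y = d_coord i (\<lambda>y. 0) y"
      using tangent_normal by (intro d_coord_cong[OF V(1) y]) (simp add: lift_def)
    then show ?thesis
      using d_coord_inner[OF smooth_p smooth_on_d_coord[OF smooth_patch(1)] y, of i j]
      by (simp add: dp_def lift_def d_coord_def)
  qed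
  from this[of i j] this[of j i] show ?thesis
    using d_coord_symmetric_vec[OF V(1) smooth_patch(1) y, of i j] by simp
qed

text \<open>The Pfaff equations are assumed at the single point \<open>y\<close>. Symmetry of the
  second derivatives of H along the hypersurface compares the derivatives of the source term
  \<open>R\<close> with those of the defect \<open>T\<close>; second derivatives of \<nu> and of
  \<open>x\<close> cancel.\<close>

lemma compatibility_iff:
  assumes y: "y \<in> V" and sol: "\<And>i. d_coord i \<nu> y = rhs i y"
  shows "grad_fibre H (lift y) \<bullet> dp i y = W (lift y) * (covector Q (lift y) \<bullet> d_coord i x y) - grad_base H (lift y) \<bullet> d_coord i x y"
    and "d_coord j (rhs i) y = d_coord i (rhs j) y \<longleftrightarrow>
      curvature H W Q (lift y) (d_coord j x y) (dp j y) (d_coord i x y) =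
      curvature H W Q (lift y) (d_coord i x y) (dp i y) (d_coord j x y)"
proof -
  let ?z = "lift y"
  show vel: "grad_fibre H ?z \<bullet> dp i y = W ?z * (covector Q ?z \<bullet> d_coord i x y) - grad_base H ?z \<bullet> d_coord i x y" for i
    using d_coord_energy[OF y, of i] d_coord_along[OF H y, of i] sol[of i] by simp
  define R where "R i y = W (lift y) * (covector Q (lift y) \<bullet> d_coord i x y)" for i y
  define T where "T i y = W (lift y) / \<nu> y * (d_coord i \<nu> y - rhs i y)" for i y
  note sm = smooth_along[OF smooth_W] smooth_along[OF smooth_gradients(3)] smooth_on_d_coord[OF smooth_patch(1)]
  have sR: "smooth_on V (R i)" for i
    unfolding R_def[abs_def] by (intro smooth_on_mult smooth_on_inner V(1) sm)
  have sd: "smooth_on V (\<lambda>y. d_coord i \<nu> y - rhs i y)" for i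
    by (intro smooth_on_diff V(1) smooth_on_d_coord \<nu> smooth_rhs)
  have sW: "smooth_on V (\<lambda>y. W (lift y) / \<nu> y)"
    by (intro smooth_on_divide V(1) sm \<nu> \<nu>_nz)
  have sT: "smooth_on V (T i)" for i
    unfolding T_def[abs_def] by (intro smooth_on_mult V(1) sW sd)
  \<comment> \<open>The defect vanishes at \<open>y\<close>, so the derivative of the factor in
    front of it does not contribute.\<close>
  have dT: "d_coord j (T i) y = W ?z / \<nu> y * (d_coord j (d_coord i \<nu>) y - d_coord j (rhs i) y)" for i j
    using d_coord_mult[OF sW sd y] d_coord_diff[OF smooth_on_d_coord[OF \<nu>] smooth_rhs y] sol
    by (simp add: T_def[abs_def])
  have ddH: "d_coord j (d_coord i (\<lambda>y. H (lift y))) y = d_coord j (R i) y + d_coord j (T i) y" for i j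
  proof -
    have "d_coord j (d_coord i (\<lambda>y. H (lift y))) y = d_coord j (\<lambda>y. R i y + T i y) y"
      by (rule d_coord_cong[OF V(1) y]) (simp add: d_coord_energy R_def T_def)
    then show ?thesis by (simp add: d_coord_add[OF sR sT y])
  qed
  have "d_coord j (R i) y + d_coord j (T i) y = d_coord i (R j) y + d_coord i (T j) y"
    using ddH d_coord_symmetric[OF V(1) smooth_along[OF H] y, of i j] by simp
  then have RT: "d_coord j (R i) y - d_coord i (R j) y = W ?z / \<nu> y * (d_coord j (rhs i) y - d_coord i (rhs j) y)"
    using d_coord_symmetric[OF V(1) \<nu> y, of i j] by (simp add: dT algebra_simps)
  \<comment> \<open>\<Omega> is differentiated in the form p \<bullet> \<partial>H/\<partial>p, and
    the value of the momentum derivative on \<partial>H/\<partial>p is replaced by the prescribed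
    one.\<close>
  have dW: "d_coord j (\<lambda>y. W (lift y)) y = W ?z * (covector Q ?z \<bullet> d_coord j x y)
      + (p_grad_base H ?z - grad_base H ?z) \<bullet> d_coord j x y + p_upper H ?z \<bullet> dp j y" for j
  proof -
    have "d_coord j (\<lambda>y. W (lift y)) y = d_coord j (\<lambda>y. (\<nu> y *\<^sub>R n y) \<bullet> grad_fibre H (lift y)) y"
    proof (rule d_coord_cong[OF V(1) y])
      fix y assume "y \<in> V"
      then have "x y \<in> D" using xD V(2) by blast
      then show "W (lift y) = (\<nu> y *\<^sub>R n y) \<bullet> grad_fibre H (lift y)" unfolding lift_def by (rule W_inner)
    qed
    also have "\<dots> = dp j y \<bullet> grad_fibre H ?z + (\<nu> y *\<^sub>R n y) \<bullet> d_coord j (\<lambda>y. grad_fibre H (lift y)) y"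
      unfolding dp_def by (rule d_coord_inner[OF smooth_p smooth_along[OF smooth_gradients(2)] y])
    also have "(\<nu> y *\<^sub>R n y) \<bullet> d_coord j (\<lambda>y. grad_fibre H (lift y)) y = p_grad_base H ?z \<bullet> d_coord j x y + p_upper H ?z \<bullet> dp j y"
    proof -
      have "d_coord j (\<lambda>y. grad_fibre H (lift y)) y $ k = grad_base (d_fibre k H) ?z \<bullet> d_coord j x y + grad_fibre (d_fibre k H) ?z \<bullet> dp j y" for k
        using d_coord_vec_nth[OF smooth_along[OF smooth_gradients(2)] y, of j k] d_coord_along[OF smooth_on_d_fibre[OF H] y, of j k]
        by (simp add: grad_fibre_def)
      moreover have "(\<Sum>k\<in>UNIV. snd ?z $ k * (grad_base (d_fibre k H) ?z \<bullet> u)) = p_grad_base H ?z \<bullet> u" for u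
        unfolding inner_vec_def by (simp add: p_grad_base_def grad_base_def sum_distrib_left sum_distrib_right mult_ac) (rule sum.swap)
      moreover have "(\<Sum>k\<in>UNIV. snd ?z $ k * (grad_fibre (d_fibre k H) ?z \<bullet> u)) = p_upper H ?z \<bullet> u" for u
        unfolding inner_vec_def by (simp add: p_upper_def p_up_def g_up_def grad_fibre_def sum_distrib_left sum_distrib_right mult_ac) (rule sum.swap)
      moreover have "\<nu> y *\<^sub>R n y = snd ?z" by (simp add: lift_def)
      ultimately show ?thesis unfolding inner_vec_def[of "\<nu> y *\<^sub>R n y"] by (simp add: distrib_left sum.distrib)
    qed
    finally show ?thesis using vel[of j] by (simp add: inner_commute inner_diff_right)
  qed
  have dQ: "d_coord j (\<lambda>y. covector Q (lift y)) y = jac_base Q ?z *v d_coord j x y + jac_fibre Q ?z *v dp j y" for j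
  proof -
    have "d_coord j (\<lambda>y. covector Q (lift y)) y $ k = grad_base (Q k) ?z \<bullet> d_coord j x y + grad_fibre (Q k) ?z \<bullet> dp j y" for k
      using d_coord_vec_nth[OF smooth_along[OF smooth_gradients(3)] y, of j k] d_coord_along[OF Q y, of j k]
      by (simp add: covector_def)
    then show ?thesis
      by (simp add: vec_eq_iff matrix_vector_mult_def gradient_defs inner_vec_def)
  qed
  interpret momentum_point H W Q "\<lambda>_ _ _ _. 0" ?z by (rule momentum_point_lift[OF y])
  \<comment> \<open>The first and the last summand are symmetric in \<open>i\<close> and
    \<open>j\<close>, which leaves the decision to the curvature term.\<close>
  have "d_coord j (R i) y = W ?z * (covector Q ?z \<bullet> d_coord j x y) * (covector Q ?z \<bullet> d_coord i x y)
      + W ?z * curvature H W Q ?z (d_coord j x y) (dp j y) (d_coord i x y)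
      + W ?z * (covector Q ?z \<bullet> d_coord j (d_coord i x) y)" for i j
  proof -
    have "d_coord j (R i) y = d_coord j (\<lambda>y. W (lift y)) y * (covector Q ?z \<bullet> d_coord i x y) +
        W ?z * (d_coord j (\<lambda>y. covector Q (lift y)) y \<bullet> d_coord i x y + covector Q ?z \<bullet> d_coord j (d_coord i x) y)"
      unfolding R_def[abs_def]
      using d_coord_mult[OF sm(1) smooth_on_inner[OF V(1) sm(2) sm(3)] y, of j i] d_coord_inner[OF sm(2) sm(3) y, of j i] by simp
    then show ?thesis
      unfolding dW dQ curvature_def curv_def using W_nz
      by (simp add: field_simps inner_add_left inner_add_right inner_diff_left inner_commute)
  qed
  then have "d_coord j (R i) y - d_coord i (R j) y = W ?z * (curvature H W Q ?z (d_coord j x y) (dp j y) (d_coord i x y)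
      - curvature H W Q ?z (d_coord i x y) (dp i y) (d_coord j x y))"
    using d_coord_symmetric_vec[OF V(1) smooth_patch(1) y, of i j] by (simp add: algebra_simps)
  with RT show "d_coord j (rhs i) y = d_coord i (rhs j) y \<longleftrightarrow>
      curvature H W Q ?z (d_coord j x y) (dp j y) (d_coord i x y) =
      curvature H W Q ?z (d_coord i x y) (dp i y) (d_coord j x y)"
    using W_lift_nz[OF y] \<nu>_nz[OF y] by auto
qed

end

section \<open>Proof of the theorem\<close>

text \<open>The common meeting point of both sides of the theorem. It mentions neither connection
  nor hypersurface, so the equations for a given connection and the geometric argument with the zero
  connection can both refer to it.\<close>

definition integrable_at ::
    "((real^'n) \<times> (real^'n) \<Rightarrow> real) \<Rightarrow> ((real^'n) \<times> (real^'n) \<Rightarrow> real) \<Rightarrow>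
     ('n \<Rightarrow> (real^'n) \<times> (real^'n) \<Rightarrow> real) \<Rightarrow> (real^'n) \<times> (real^'n) \<Rightarrow> bool" where
  "integrable_at H W Q z \<longleftrightarrow>
     (\<exists>\<kappa>. \<forall>u. snd z \<bullet> u = 0 \<longrightarrow> normality_algebra.proj (snd z) (grad_fibre H z) (W z)
        (normality_algebra.B (p_upper H z) (covector Q z) (jac_fibre Q z) (W z) u) = \<kappa> *\<^sub>R u) \<and>
     (let \<phi> = normality_algebra.base (snd z) (grad_base H z) (p_grad_base H z) (p_upper H z) (covector Q z)
          (jac_base Q z) (jac_fibre Q z) (W z)
      in \<forall>u w. snd z \<bullet> u = 0 \<longrightarrow> snd z \<bullet> w = 0 \<longrightarrow> \<phi> u w = \<phi> w u)"

lemma (in momentum_point) normality_equations_iff_integrable_at: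
  assumes "CARD('n) \<ge> 2"
  shows "first_normality_equations G H W Q z \<and> second_normality_equations H W Q z \<longleftrightarrow> integrable_at H W Q z"
  unfolding normality_equations_iff[OF assms] integrable_at_def Let_def ..

lemma (in momentum_section) integrable_at_imp_compatible:
  assumes y: "y \<in> V" and sol: "\<And>i. d_coord i \<nu> y = rhs i y" and int: "integrable_at H W Q (lift y)"
  shows "d_coord j (rhs i) y = d_coord i (rhs j) y"
proof -
  interpret momentum_point H W Q "\<lambda>_ _ _ _. 0" "lift y" by (rule momentum_point_lift[OF y])
  obtain \<kappa> where \<kappa>: "\<And>u. snd (lift y) \<bullet> u = 0 \<Longrightarrow> proj (B u) = \<kappa> *\<^sub>R u"
    using int unfolding integrable_at_def by blast
  have base: "base u w = base w u" if "snd (lift y) \<bullet> u = 0" "snd (lift y) \<bullet> w = 0" for u w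
    using int that unfolding integrable_at_def Let_def by blast
  have "curvature H W Q (lift y) (d_coord j x y) (dp j y) (d_coord i x y) =
      curvature H W Q (lift y) (d_coord i x y) (dp i y) (d_coord j x y)"
    unfolding curvature_def
    by (rule curv_symmetric[OF \<kappa> base]) (simp_all add: tangent_normal[OF y] second_form_symmetric[OF y, of j i] compatibility_iff(1)[OF y sol])
  then show ?thesis using compatibility_iff(2)[OF y sol] by simp
qed

lemma (in hypersurface_patch) integrable_imp_solvable:
  assumes int: "\<And>x p. x \<in> D \<Longrightarrow> p \<noteq> 0 \<Longrightarrow> integrable_at H W Q (x, p)"
    and y0: "y0 \<in> U" and \<nu>0: "\<nu>0 \<noteq> 0"
  shows "\<exists>V \<nu>. open V \<and> y0 \<in> V \<and> V \<subseteq> U \<and> smooth_on V \<nu> \<and> (\<forall>y\<in>V. \<nu> y \<noteq> 0) \<and> \<nu> y0 = \<nu>0 \<and>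
    (\<forall>y\<in>V. \<forall>i. pfaff_equation H W Q x n \<nu> i y)"
proof -
  define \<Psi> where "\<Psi> w = (\<chi> i. pfaff_rhs H W Q x n i w)" for w
  have smooth: "smooth_on nonzero_patch \<Psi>"
    unfolding \<Psi>_def[abs_def] by (intro smooth_on_vec_lambda open_nonzero_patch smooth_pfaff_rhs)
  have compat: "frechet_derivative \<Psi> (at z) (u, \<Psi> z \<bullet> u) \<bullet> v = frechet_derivative \<Psi> (at z) (v, \<Psi> z \<bullet> v) \<bullet> u"
    if z: "z \<in> nonzero_patch" for z u v
  proof -
    obtain y a where za: "z = (y, a)" "y \<in> U" "a \<noteq> 0" using z by (auto simp: nonzero_patch_def)
    \<comment> \<open>The affine function with value \<open>a\<close> and differential
      \<open>\<Psi> z\<close> at \<open>y\<close>. It solves the Pfaff equations at \<open>y\<close>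
      at least, which is all that the compatibility criterion asks for.\<close>
    define \<nu> where "\<nu> y' = a + \<Psi> z \<bullet> (y' - y)" for y'
    define V where "V = U \<inter> \<nu> -` (- {0})"
    have d\<nu>: "(\<nu> has_derivative (\<lambda>h. \<Psi> z \<bullet> h)) (at y')" for y'
      unfolding \<nu>_def by (auto intro!: derivative_eq_intros)
    have s\<nu>: "smooth_on S \<nu>" if "open S" for S
      unfolding \<nu>_def by (intro smooth_on_add smooth_on_inner smooth_on_diff smooth_on_const smooth_on_ident that)
    interpret momentum_section D H W Q U x n V \<nu>
    proof
      have "continuous_on UNIV \<nu>" using smooth_on_continuous_on[OF s\<nu>[OF open_UNIV]] .
      then show "open V" unfolding V_def by (intro open_Int U open_vimage) auto
      then show "smooth_on V \<nu>" by (rule s\<nu>)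
    qed (auto simp: V_def)
    have y: "y \<in> V" "\<nu> y = a" using za by (auto simp: V_def \<nu>_def)
    have sol: "d_coord i \<nu> y = rhs i y" for i
      using d_coord_at[OF d\<nu>] y by (simp add: \<Psi>_def za inner_axis)
    have "integrable_at H W Q (lift y)"
      unfolding lift_def using za y xD n_nz by (intro int) auto
    note sym = integrable_at_imp_compatible[OF y(1) sol this]
    let ?D = "frechet_derivative \<Psi> (at z)"
    have D: "(\<Psi> has_derivative ?D) (at z)" by (rule smooth_on_has_derivative[OF smooth z])
    have lin: "linear ?D" using D by (rule has_derivative_linear)
    \<comment> \<open>The lifted direction is tangent to the graph of \<nu>, so this is the total
      derivative of the right-hand side along that graph.\<close>
    have D_axis: "?D (axis j 1, \<Psi> z \<bullet> axis j 1) $ i = d_coord j (rhs i) y" for i j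
    proof -
      have "((\<lambda>y'. (y', \<nu> y')) has_derivative (\<lambda>h. (h, \<Psi> z \<bullet> h))) (at y)"
        by (intro has_derivative_Pair d\<nu> has_derivative_ident)
      moreover have "(\<Psi> has_derivative ?D) (at (y, \<nu> y))" using D za y by simp
      ultimately have "((\<lambda>y'. \<Psi> (y', \<nu> y')) has_derivative (\<lambda>h. ?D (h, \<Psi> z \<bullet> h))) (at y)"
        by (rule has_derivative_compose)
      then have "((\<lambda>y'. \<Psi> (y', \<nu> y') $ i) has_derivative (\<lambda>h. ?D (h, \<Psi> z \<bullet> h) $ i)) (at y)"
        by (rule bounded_linear.has_derivative[OF bounded_linear_vec_nth])
      from d_coord_at[OF this] show ?thesis by (simp add: \<Psi>_def)
    qed
    show ?thesis
    proof (rule bilinear_symmetric_axis[of "\<lambda>u v. ?D (u, \<Psi> z \<bullet> u) \<bullet> v"])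
      show "linear (\<lambda>u. ?D (u, \<Psi> z \<bullet> u) \<bullet> w)" for w
      proof (rule linearI)
        fix u v and c :: real
        show "?D (u + v, \<Psi> z \<bullet> (u + v)) \<bullet> w = ?D (u, \<Psi> z \<bullet> u) \<bullet> w + ?D (v, \<Psi> z \<bullet> v) \<bullet> w"
          using linear_add[OF lin, of "(u, \<Psi> z \<bullet> u)" "(v, \<Psi> z \<bullet> v)"] by (simp add: inner_add_right inner_add_left)
        show "?D (c *\<^sub>R u, \<Psi> z \<bullet> (c *\<^sub>R u)) \<bullet> w = c *\<^sub>R (?D (u, \<Psi> z \<bullet> u) \<bullet> w)"
          using linear_cmul[OF lin, of c "(u, \<Psi> z \<bullet> u)"] by simp
      qed
      show "linear (\<lambda>v. ?D (u, \<Psi> z \<bullet> u) \<bullet> v)" for u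
        by (rule bounded_linear.linear[OF bounded_linear_inner_right])
      show "?D (axis i 1, \<Psi> z \<bullet> axis i 1) \<bullet> axis j 1 = ?D (axis j 1, \<Psi> z \<bullet> axis j 1) \<bullet> axis i 1" for i j
        using sym[of i j] by (simp add: inner_axis[of "?D _"] D_axis)
    qed
  qed
  have "(y0, \<nu>0) \<in> nonzero_patch" using y0 \<nu>0 by (simp add: nonzero_patch_def)
  from frobenius_local[OF open_nonzero_patch this smooth compat]
  obtain r \<nu> where r: "r > 0" "smooth_on (ball y0 r) \<nu>" "\<nu> y0 = \<nu>0"
    and sol: "\<And>y. y \<in> ball y0 r \<Longrightarrow> (y, \<nu> y) \<in> nonzero_patch \<and> (\<nu> has_derivative (\<lambda>h. \<Psi> (y, \<nu> y) \<bullet> h)) (at y)"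
    by blast
  have "pfaff_equation H W Q x n \<nu> i y" if "y \<in> ball y0 r" for i y
    using d_coord_at[OF conjunct2[OF sol[OF that]], of i] by (simp add: pfaff_equation_iff \<Psi>_def inner_axis)
  then show ?thesis
    using r sol by (intro exI[of _ "ball y0 r"] exI[of _ \<nu>]) (auto simp: nonzero_patch_def)
qed

section \<open>Test hypersurfaces with given conormal and a second fundamental form of rank at most
  one\<close>

locale paraboloid =
  fixes \<tau> :: "real^'k \<Rightarrow> real^'n" and x0 p0 :: "real^'n" and c :: "real^'k"
  assumes p0: "p0 \<noteq> 0" and \<tau>: "linear \<tau>" and range: "range \<tau> = {u. p0 \<bullet> u = 0}"
    and iso: "\<And>a b. \<tau> a \<bullet> \<tau> b = a \<bullet> b"
begin

text \<open>The hyperplane through \<open>x0\<close> with conormal \<open>p0\<close>, bent along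
  \<open>p0\<close>. The bending vector has inner product 1 with \<open>p0\<close>, so that p0
  \<bullet> (par y - x0) is minus half the square of c \<bullet> y.\<close>

definition par :: "real^'k \<Rightarrow> real^'n" where
  "par y = x0 + \<tau> y - ((c \<bullet> y)\<^sup>2 / 2) *\<^sub>R (p0 /\<^sub>R (p0 \<bullet> p0))"

text \<open>The gradient of p0 \<bullet> (x - x0) + (\<tau> c \<bullet> (x - x0))^2 / 2, a function
  that vanishes on the paraboloid.\<close>

definition conormal :: "real^'k \<Rightarrow> real^'n" where
  "conormal y = p0 + (c \<bullet> y) *\<^sub>R \<tau> c"

lemma p0_\<tau> [simp]: "p0 \<bullet> \<tau> a = 0" "\<tau> a \<bullet> p0 = 0"
  using range by (auto simp: inner_commute)

lemma bounded_linear_\<tau>: "bounded_linear \<tau>"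
  using \<tau> by (simp add: linear_conv_bounded_linear)

lemma par_has_derivative:
  "(par has_derivative (\<lambda>h. \<tau> h - ((c \<bullet> y) * (c \<bullet> h)) *\<^sub>R (p0 /\<^sub>R (p0 \<bullet> p0)))) (at y)"
proof -
  have "((\<lambda>y. (c \<bullet> y)\<^sup>2 / 2) has_derivative (\<lambda>h. (c \<bullet> y) * (c \<bullet> h))) (at y)"
    by (auto intro!: derivative_eq_intros)
  from has_derivative_scaleR_left[OF this]
  have "((\<lambda>y. ((c \<bullet> y)\<^sup>2 / 2) *\<^sub>R (p0 /\<^sub>R (p0 \<bullet> p0))) has_derivative (\<lambda>h. ((c \<bullet> y) * (c \<bullet> h)) *\<^sub>R (p0 /\<^sub>R (p0 \<bullet> p0)))) (at y)" .
  moreover have "((\<lambda>y. x0 + \<tau> y) has_derivative \<tau>) (at y)"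
    using has_derivative_add[OF has_derivative_const bounded_linear_imp_has_derivative[OF bounded_linear_\<tau>], of x0 "at y"] by simp
  ultimately show ?thesis
    unfolding par_def[abs_def] by (intro has_derivative_diff)
qed

lemma smooth_par: "open S \<Longrightarrow> smooth_on S par"
  unfolding par_def[abs_def] power2_eq_square
  by (intro smooth_on_diff smooth_on_add smooth_on_scaleR smooth_on_divide smooth_on_mult smooth_on_inner
      smooth_on_const smooth_on_ident smooth_on_linear[OF bounded_linear_\<tau>]) simp_all

lemma smooth_conormal: "open S \<Longrightarrow> smooth_on S conormal"
  unfolding conormal_def[abs_def]
  by (intro smooth_on_add smooth_on_scaleR smooth_on_inner smooth_on_const smooth_on_ident)

lemma par_0: "par 0 = x0" "conormal 0 = p0"
  by (simp_all add: par_def conormal_def linear_0[OF \<tau>])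

lemma conormal_nz: "conormal y \<noteq> 0"
proof
  assume "conormal y = 0"
  then have "p0 \<bullet> conormal y = 0" by simp
  then show False using p0 by (simp add: conormal_def inner_add_right)
qed

lemma conormal_par: "conormal y \<bullet> d_coord i par y = 0"
  using p0 by (simp add: d_coord_at[OF par_has_derivative] conormal_def inner_add_left inner_diff_right iso)

text \<open>The adjoint of the isometry is a left inverse of \<tau> that kills the bending direction
  \<open>p0\<close>. It therefore recovers the parameter from the point, and a tangent vector of the
  parameter space from its image.\<close>

lemma adjoint_\<tau>: "adjoint \<tau> (\<tau> a) = a" "adjoint \<tau> p0 = 0" "linear (adjoint \<tau>)"
proof -
  show "adjoint \<tau> (\<tau> a) = a"
    by (rule vector_eq_rdot[THEN iffD1]) (simp add: adjoint_clauses[OF \<tau>] iso)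
  show "adjoint \<tau> p0 = 0"
    by (rule vector_eq_rdot[THEN iffD1]) (simp add: adjoint_clauses[OF \<tau>])
  show "linear (adjoint \<tau>)" by (rule adjoint_linear[OF \<tau>])
qed

lemma adjoint_par: "adjoint \<tau> (par y - x0) = y"
  by (simp add: par_def linear_diff[OF adjoint_\<tau>(3)] linear_add[OF adjoint_\<tau>(3)] linear_cmul[OF adjoint_\<tau>(3)] adjoint_\<tau>)

lemma inj_par: "inj (frechet_derivative par (at y))"
proof (rule injI)
  fix a b
  have "adjoint \<tau> (frechet_derivative par (at y) a) = a" for a
    by (simp add: frechet_derivative_at[OF par_has_derivative, symmetric] linear_diff[OF adjoint_\<tau>(3)] linear_cmul[OF adjoint_\<tau>(3)] adjoint_\<tau>)
  then show "frechet_derivative par (at y) a = frechet_derivative par (at y) b \<Longrightarrow> a = b" by metis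
qed

lemma homeomorphism_par: "homeomorphism S (par ` S) par (\<lambda>x. adjoint \<tau> (x - x0))"
  unfolding homeomorphism_def
proof (intro conjI ballI)
  show "continuous_on S par"
    using smooth_on_continuous_on[OF smooth_par[OF open_UNIV]] continuous_on_subset by blast
  show "continuous_on (par ` S) (\<lambda>x. adjoint \<tau> (x - x0))"
    by (intro linear_continuous_on_compose[OF _ adjoint_\<tau>(3)] continuous_intros)
qed (auto simp: adjoint_par image_image)

end

lemma paraboloid_exists:
  assumes "p0 \<noteq> (0 :: real^'n)" "CARD('k::finite) + 1 = CARD('n)"
  shows "\<exists>\<tau> :: real^'k \<Rightarrow> real^'n. paraboloid \<tau> p0"
proof -
  have "dim (UNIV :: (real^'k) set) = dim {u. p0 \<bullet> u = 0}"
    using assms by (simp add: dim_hyperplane)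
  then obtain \<tau> :: "real^'k \<Rightarrow> real^'n" where \<tau>: "linear \<tau>" "\<tau> ` UNIV = {u. p0 \<bullet> u = 0}" "\<And>x. norm (\<tau> x) = norm x"
    using isometry_subspaces[of "UNIV :: (real^'k) set" "{u. p0 \<bullet> u = 0}"] subspace_hyperplane by auto
  have "\<tau> a \<bullet> \<tau> b = a \<bullet> b" for a b
    using \<tau>(3)[of "a + b"] \<tau>(3)[of a] \<tau>(3)[of b]
    by (simp add: linear_add[OF \<tau>(1)] dot_norm)
  then show ?thesis using assms(1) \<tau> by (intro exI[of _ \<tau>]) (simp add: paraboloid_def)
qed

lemma linear_axis_eqI:
  fixes f g :: "real^'k \<Rightarrow> 'b::real_vector"
  assumes "linear f" "linear g" "\<And>i. f (axis i 1) = g (axis i 1)"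
  shows "f a = g a"
proof -
  have "a = (\<Sum>i\<in>UNIV. a $ i *\<^sub>R axis i 1)"
    by (simp add: scalar_mult_eq_scaleR[symmetric] basis_expansion)
  then have "f a = f (\<Sum>i\<in>UNIV. a $ i *\<^sub>R axis i 1)" "g a = g (\<Sum>i\<in>UNIV. a $ i *\<^sub>R axis i 1)" by simp_all
  then show ?thesis
    by (simp add: linear_sum[OF assms(1)] linear_sum[OF assms(2)] linear_cmul[OF assms(1)] linear_cmul[OF assms(2)] assms(3))
qed

context local_dynamics
begin

lemma paraboloid_patch:
  assumes "paraboloid \<tau> p0"
  shows "hypersurface_patch D H W Q (paraboloid.par \<tau> x0 p0 c -` D) (paraboloid.par \<tau> x0 p0 c) (paraboloid.conormal \<tau> p0 c)"
proof -
  interpret paraboloid \<tau> x0 p0 c by (rule assms)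
  have U: "open (par -` D)"
    using D smooth_on_continuous_on[OF smooth_par[OF open_UNIV]] by (intro open_vimage) auto
  show ?thesis
    by unfold_locales (auto simp: U smooth_par smooth_conormal conormal_nz conormal_par)
qed

text \<open>Every paraboloid in question passes through \<open>x0\<close> with conormal
  \<open>p0\<close>, and \<nu> 0 = 1 makes \<open>p0\<close> the momentum there; all choices of
  \<open>c\<close> thus test the same point of the cotangent bundle.\<close>

lemma solvable_imp_integrable:
  fixes \<tau> :: "real^'k \<Rightarrow> real^'n"
  assumes par: "paraboloid \<tau> p0" and x0: "x0 \<in> D"
    and solv: "\<And>c. \<exists>V \<nu>. open V \<and> 0 \<in> V \<and> V \<subseteq> paraboloid.par \<tau> x0 p0 c -` D \<and> smooth_on V \<nu> \<and>
      (\<forall>y\<in>V. \<nu> y \<noteq> 0) \<and> \<nu> 0 = 1 \<and>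
      (\<forall>y\<in>V. \<forall>i. pfaff_equation H W Q (paraboloid.par \<tau> x0 p0 c) (paraboloid.conormal \<tau> p0 c) \<nu> i y)"
  shows "integrable_at H W Q (x0, p0)"
proof -
  have p0: "p0 \<noteq> 0" and \<tau>: "linear \<tau>" and range: "range \<tau> = {u. p0 \<bullet> u = 0}" and iso: "\<And>a b. \<tau> a \<bullet> \<tau> b = a \<bullet> b"
    using par by (auto simp: paraboloid_def)
  let ?z = "(x0, p0)"
  interpret pt: momentum_point H W Q "\<lambda>_ _ _ _. 0" ?z
    using momentum_pointI[OF x0 p0, of "\<lambda>_ _ _ _. 0"] by simp
  have "\<exists>\<pi>. (\<forall>a b. \<pi> a \<bullet> \<tau> b = (c \<bullet> a) * (c \<bullet> b)) \<and>
      (\<forall>a. grad_fibre H ?z \<bullet> \<pi> a = W ?z * (covector Q ?z \<bullet> \<tau> a) - grad_base H ?z \<bullet> \<tau> a) \<and>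
      (\<forall>a b. pt.curv (\<tau> a) (\<pi> a) (\<tau> b) = pt.curv (\<tau> b) (\<pi> b) (\<tau> a))" for c
  proof -
    interpret paraboloid \<tau> x0 p0 c by (rule par)
    obtain V \<nu> where sec: "open V" "0 \<in> V" "V \<subseteq> par -` D" "smooth_on V \<nu>" "\<And>y. y \<in> V \<Longrightarrow> \<nu> y \<noteq> 0" "\<nu> 0 = 1"
      and sol: "\<And>y i. y \<in> V \<Longrightarrow> pfaff_equation H W Q par conormal \<nu> i y"
      using solv[of c] by blast
    interpret hypersurface_patch D H W Q "par -` D" par conormal by (rule paraboloid_patch[OF par])
    interpret momentum_section D H W Q "par -` D" par conormal V \<nu> by unfold_locales (fact sec)+
    have sol': "d_coord i \<nu> y = rhs i y" if "y \<in> V" for i y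
      using sol[OF that] by (simp add: pfaff_equation_iff)
    have lift0: "lift 0 = ?z" using sec(6) by (simp add: lift_def par_0)
    have d_par: "d_coord i par 0 = \<tau> (axis i 1)" for i
      by (simp add: d_coord_at[OF par_has_derivative])
    define \<delta> where "\<delta> = frechet_derivative \<nu> (at 0)"
    have \<delta>: "linear \<delta>"
      unfolding \<delta>_def using smooth_on_has_derivative[OF sec(4,2)] by (rule has_derivative_linear)
    \<comment> \<open>The product rule for \<nu> times the conormal at 0. Its first summand is
      annihilated by tangent vectors, so the unknown derivative of \<nu> does not disturb the form c
      \<otimes> c.\<close>
    define \<pi> where "\<pi> a = \<delta> a *\<^sub>R p0 + (c \<bullet> a) *\<^sub>R \<tau> c" for a
    have "(conormal has_derivative (\<lambda>h. (c \<bullet> h) *\<^sub>R \<tau> c)) (at 0)"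
      unfolding conormal_def[abs_def] by (auto intro!: derivative_eq_intros)
    from d_coord_at[OF this] have dp0: "dp i 0 = \<pi> (axis i 1)" for i
      by (simp add: dp_eq[OF sec(2)] sec(6) par_0 \<pi>_def) (simp add: \<delta>_def d_coord_def)
    have \<pi>: "linear \<pi>"
      by (rule linearI) (simp_all add: \<pi>_def linear_add[OF \<delta>] linear_cmul[OF \<delta>] inner_add_right algebra_simps)
    note compat = compatibility_iff[OF sec(2) sol'[OF sec(2)], unfolded lift0 d_par dp0]
    have vel: "grad_fibre H ?z \<bullet> \<pi> a = W ?z * (covector Q ?z \<bullet> \<tau> a) - grad_base H ?z \<bullet> \<tau> a" for a
    proof (rule linear_axis_eqI[of "\<lambda>a. grad_fibre H ?z \<bullet> \<pi> a" "\<lambda>a. W ?z * (covector Q ?z \<bullet> \<tau> a) - grad_base H ?z \<bullet> \<tau> a"])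
      show "linear (\<lambda>a. grad_fibre H ?z \<bullet> \<pi> a)"
        by (rule linearI) (simp_all add: linear_add[OF \<pi>] linear_cmul[OF \<pi>] inner_add_right)
      show "linear (\<lambda>a. W ?z * (covector Q ?z \<bullet> \<tau> a) - grad_base H ?z \<bullet> \<tau> a)"
        by (rule linearI) (simp_all add: linear_add[OF \<tau>] linear_cmul[OF \<tau>] inner_add_right algebra_simps)
    qed (rule compat(1))
    have "pt.curv (\<tau> a) (\<pi> a) (\<tau> b) = pt.curv (\<tau> b) (\<pi> b) (\<tau> a)" for a b
    proof (rule bilinear_symmetric_axis[of "\<lambda>a b. pt.curv (\<tau> a) (\<pi> a) (\<tau> b)"])
      show "linear (\<lambda>a. pt.curv (\<tau> a) (\<pi> a) (\<tau> b))" for b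
        by (rule linearI) (simp_all add: pt.curv_def linear_add[OF \<pi>] linear_cmul[OF \<pi>] linear_add[OF \<tau>] linear_cmul[OF \<tau>]
            inner_add_right matrix_vector_right_distrib matrix_vector_mult_scaleR divide_inverse algebra_simps)
      show "linear (\<lambda>b. pt.curv (\<tau> a) (\<pi> a) (\<tau> b))" for a
        by (rule linearI) (simp_all add: pt.curv_def linear_add[OF \<tau>] linear_cmul[OF \<tau>]
            inner_add_right inner_add_left divide_inverse algebra_simps)
      fix i j
      \<comment> \<open>\<nu> solves the system on a neighbourhood, so the criterion holds by
        symmetry of its second derivatives.\<close>
      have "d_coord i (rhs j) 0 = d_coord i (d_coord j \<nu>) 0" for i j
        by (rule d_coord_cong[OF sec(1,2)]) (simp add: sol')
      then have "d_coord i (rhs j) 0 = d_coord j (rhs i) 0"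
        using d_coord_symmetric[OF sec(1,4,2), of i j] by simp
      then show "pt.curv (\<tau> (axis i 1)) (\<pi> (axis i 1)) (\<tau> (axis j 1)) = pt.curv (\<tau> (axis j 1)) (\<pi> (axis j 1)) (\<tau> (axis i 1))"
        using compat(2)[of i j] by (simp add: curvature_def)
    qed
    moreover have "\<pi> a \<bullet> \<tau> b = (c \<bullet> a) * (c \<bullet> b)" for a b
      by (simp add: \<pi>_def inner_add_left iso)
    ultimately show ?thesis using vel by blast
  qed
  note conc = pt.curv_symmetric_imp[unfolded snd_conv, OF range iso this]
  show ?thesis
    unfolding integrable_at_def Let_def snd_conv using conc by blast
qed

end

section \<open>Passage between a chart and the manifold\<close>

lemma paraboloid_local_parametrization:
  fixes A :: "('m::topological_space, real^'n) chart set" and \<tau> :: "real^'k \<Rightarrow> real^'n" and x0 :: "real^'n" and b :: "real^'k"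
  assumes atlas: "smooth_atlas A" and c: "c \<in> A" and par: "paraboloid \<tau> p0"
  defines "X \<equiv> paraboloid.par \<tau> x0 p0 b"
  defines "U \<equiv> X -` chart_image c"
  shows "local_parametrization c (chart_inv c ` X ` U) U X"
proof -
  interpret paraboloid \<tau> x0 p0 b by (rule par)
  have U: "open U"
    unfolding U_def X_def using chart_homeomorphism(2)[OF atlas c] smooth_on_continuous_on[OF smooth_par[OF open_UNIV]]
    by (intro open_vimage) auto
  have "chart_map c ` (chart_inv c ` X ` U \<inter> chart_dom c) = X ` U"
  proof -
    have "chart_inv c ` X ` U \<inter> chart_dom c = chart_inv c ` X ` U"
      by (auto simp: U_def intro: chart_inv_in)
    moreover have "chart_map c ` chart_inv c ` X ` U = (\<lambda>y. y) ` X ` U"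
      unfolding image_image by (rule image_cong) (simp_all add: U_def chart_map_inv[OF atlas c])
    ultimately show ?thesis by simp
  qed
  \<comment> \<open>The chart domain itself serves as the open set that cuts out the piece of the
    hypersurface.\<close>
  then have "homeomorphism U (chart_map c ` (chart_inv c ` X ` U \<inter> chart_dom c)) X (\<lambda>x. adjoint \<tau> (x - x0))"
    using homeomorphism_par by (simp add: X_def)
  then show ?thesis
    unfolding local_parametrization_def using U smooth_par[OF U] inj_par chart_homeomorphism(1)[OF atlas c]
    by (auto simp: X_def)
qed

lemma local_dynamics_in_chart:
  fixes A :: "('m::topological_space, real^'n) chart set"
  assumes "smooth_atlas A" "c \<in> A" "smooth_lagrangian A L" "regular_lagrangian A L" "smooth_extended_covector_field A Q"
  shows "local_dynamics (chart_image c) (H_in A L c) (Omega_in A L c) (Q_in A Q c)"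
proof
  show "open (chart_image c)" by (rule chart_homeomorphism(2)[OF assms(1,2)])
  show "smooth_on (chart_image c \<times> UNIV) (Q_in A Q c i)" for i
    using assms(5) assms(2) unfolding smooth_extended_covector_field_def cotangent_chart(1)[OF assms(1,2), symmetric] by blast
  note ham = hamiltonian_in_chart[OF assms(1-4)]
  show "smooth_on (chart_image c \<times> UNIV) (H_in A L c)" by (rule ham(1))
  fix x p
  assume x: "x \<in> chart_image c"
  show "Omega_in A L c (x, p) = (\<Sum>i\<in>UNIV. p $ i * d_fibre i (H_in A L c) (x, p))" by (rule ham(2)[OF x])
  show "Omega_in A L c (x, p) \<noteq> 0" if "p \<noteq> 0" using ham(3)[OF x that] by simp
qed

theorem theorem14p1:
  fixes A :: "('m::{t2_space, second_countable_topology}, real^'n) chart set"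
    and L :: "'m \<times> ('m, 'n) components \<Rightarrow> real"
    and Q :: "'m \<times> ('m, 'n) components \<Rightarrow> ('m, 'n) components"
    and G :: "('m, real^'n) chart \<Rightarrow> 'n connection_components"
  assumes "smooth_atlas A"
    and "CARD('n) \<ge> 3"
    and "CARD('k::finite) + 1 = CARD('n)"
    and "smooth_lagrangian A L"
    and "regular_lagrangian A L"
    and "smooth_extended_covector_field A Q"
    and "extended_connection A G"
    and "symmetric_connection A G"
  shows "additional_normality_condition TYPE('k) A L Q \<longleftrightarrow>
         additional_normality_equations A L Q G"
proof -
  note dyn = local_dynamics_in_chart[OF assms(1) _ assms(4-6)]
  have card: "CARD('n) \<ge> 2" using assms(2) by simp
  \<comment> \<open>Here the given connection disappears; its symmetry makes the pointwise
    equivalence available.\<close>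
  have equations: "additional_normality_equations A L Q G \<longleftrightarrow>
    (\<forall>c\<in>A. \<forall>x\<in>chart_image c. \<forall>p. p \<noteq> 0 \<longrightarrow> integrable_at (H_in A L c) (Omega_in A L c) (Q_in A Q c) (x, p))"
  proof -
    have "first_normality_equations (G c) (H_in A L c) (Omega_in A L c) (Q_in A Q c) (x, p) \<and>
        second_normality_equations (H_in A L c) (Omega_in A L c) (Q_in A Q c) (x, p) \<longleftrightarrow>
        integrable_at (H_in A L c) (Omega_in A L c) (Q_in A Q c) (x, p)"
      if c: "c \<in> A" "x \<in> chart_image c" "p \<noteq> 0" for c x p
    proof -
      have "G c k i j (x, p) = G c k j i (x, p)" for k i j
        using assms(8) c cotangent_chart(1)[OF assms(1) c(1)] unfolding symmetric_connection_def by blast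
      then interpret momentum_point "H_in A L c" "Omega_in A L c" "Q_in A Q c" "G c" "(x, p)"
        by (rule local_dynamics.momentum_pointI[OF dyn[OF c(1)] c(2,3)])
      show ?thesis by (rule normality_equations_iff_integrable_at[OF card])
    qed
    then show ?thesis unfolding additional_normality_equations_in_charts[OF assms(1)] by blast
  qed
  show ?thesis
  proof
    assume cond: "additional_normality_condition TYPE('k) A L Q"
    show "additional_normality_equations A L Q G"
      unfolding equations
    proof (intro ballI allI impI)
      fix c and x0 p0 :: "real^'n"
      assume c: "c \<in> A" and x0: "x0 \<in> chart_image c" and p0: "p0 \<noteq> 0"
      obtain \<tau> :: "real^'k \<Rightarrow> real^'n" where pb: "paraboloid \<tau> p0"
        using paraboloid_exists[OF p0 assms(3)] by blast
      show "integrable_at (H_in A L c) (Omega_in A L c) (Q_in A Q c) (x0, p0)"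
      proof (rule local_dynamics.solvable_imp_integrable[OF dyn[OF c] pb x0])
        fix b
        interpret paraboloid \<tau> x0 p0 b by (rule pb)
        let ?U = "par -` chart_image c" and ?q = "chart_inv c x0"
        \<comment> \<open>The part of the paraboloid that fits into the chart, carried to the
          manifold.\<close>
        let ?S = "chart_inv c ` par ` ?U"
        have U: "open ?U"
          using chart_homeomorphism(2)[OF assms(1) c] smooth_on_continuous_on[OF smooth_par[OF open_UNIV]]
          by (intro open_vimage) auto
        have loc: "local_parametrization c ?S ?U par"
          by (rule paraboloid_local_parametrization[OF assms(1) c pb])
        have "hypersurface TYPE('k) A ?S"
          unfolding hypersurface_def
        proof
          fix q assume "q \<in> ?S"
          then obtain y where "y \<in> ?U" "q = chart_inv c (par y)" by blast
          then have "q \<in> chart_dom c" "chart_map c q \<in> par ` ?U"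
            using chart_map_inv[OF assms(1) c] by (auto intro: chart_inv_in)
          then show "\<exists>c\<in>A. \<exists>U (x :: real^'k \<Rightarrow> real^'n). q \<in> chart_dom c \<and> local_parametrization c ?S U x \<and> chart_map c q \<in> x ` U"
            using c loc by blast
        qed
        moreover have zero: "0 \<in> ?U" using x0 by (simp add: par_0)
        moreover have "?q \<in> ?S" using zero par_0(1) by (metis imageI)
        moreover have "?q \<in> chart_dom c" by (rule chart_inv_in[OF x0])
        moreover have "par 0 = chart_map c ?q" by (simp add: par_0 chart_map_inv[OF assms(1) c x0])
        moreover have "smooth_on ?U conormal" by (rule smooth_conormal[OF U])
        moreover have "\<forall>y\<in>?U. conormal y \<noteq> 0 \<and> (\<forall>i. (\<Sum>s\<in>UNIV. conormal y $ s * d_coord i par y $ s) = 0)"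
          using conormal_nz conormal_par by (simp add: inner_vec_def)
        ultimately show "\<exists>V \<nu>. open V \<and> 0 \<in> V \<and> V \<subseteq> ?U \<and> smooth_on V \<nu> \<and> (\<forall>y\<in>V. \<nu> y \<noteq> 0) \<and> \<nu> 0 = 1 \<and>
            (\<forall>y\<in>V. \<forall>i. pfaff_equation (H_in A L c) (Omega_in A L c) (Q_in A Q c) par conormal \<nu> i y)"
          using cond[unfolded additional_normality_condition_def, rule_format, of ?S ?q c 0 ?U par conormal 1] c loc by simp
      qed
    qed
  next
    assume "additional_normality_equations A L Q G"
    then have int: "\<And>c x p. c \<in> A \<Longrightarrow> x \<in> chart_image c \<Longrightarrow> p \<noteq> 0 \<Longrightarrow>
        integrable_at (H_in A L c) (Omega_in A L c) (Q_in A Q c) (x, p)"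
      unfolding equations by blast
    show "additional_normality_condition TYPE('k) A L Q"
      unfolding additional_normality_condition_def
    proof (intro allI impI ballI, elim conjE)
      fix S q0 c U and x n :: "real^'k \<Rightarrow> real^'n" and y0 and \<nu>0 :: real
      assume c: "c \<in> A" and loc: "local_parametrization c S U x" and y0: "y0 \<in> U" and n: "smooth_on U n"
        and normal: "\<forall>y\<in>U. n y \<noteq> 0 \<and> (\<forall>i. (\<Sum>s\<in>UNIV. n y $ s * d_coord i x y $ s) = 0)" and \<nu>0: "\<nu>0 \<noteq> 0"
      obtain V g where "V \<subseteq> chart_dom c" "homeomorphism U (chart_map c ` (S \<inter> V)) x g"
        using loc unfolding local_parametrization_def by blast
      then have xU: "x ` U \<subseteq> chart_image c"
        by (auto simp: homeomorphism_def chart_image_def)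
      interpret local_dynamics "chart_image c" "H_in A L c" "Omega_in A L c" "Q_in A Q c" by (rule dyn[OF c])
      interpret hypersurface_patch "chart_image c" "H_in A L c" "Omega_in A L c" "Q_in A Q c" U x n
        by unfold_locales (use loc n xU normal in \<open>auto simp: local_parametrization_def inner_vec_def\<close>)
      show "\<exists>V \<nu>. open V \<and> y0 \<in> V \<and> V \<subseteq> U \<and> smooth_on V \<nu> \<and> (\<forall>y\<in>V. \<nu> y \<noteq> 0) \<and> \<nu> y0 = \<nu>0 \<and>
          (\<forall>y\<in>V. \<forall>i. pfaff_equation (H_in A L c) (Omega_in A L c) (Q_in A Q c) x n \<nu> i y)"
        by (rule integrable_imp_solvable[OF int[OF c] y0 \<nu>0])
    qed
  qed
qed

end
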